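(* Let $m\ge2$ be an even integer, $\sigma_0=(-1)^{m/2}$, $T>0$, and let $f\in W^{2,\infty}_{\mathrm{loc}}(\mathbb{R})$ be such that $f''\in L^\infty(\mathbb{R})$. Let $u\in W^{m,\infty}((0,T)\times\Omega)$ be a solution of $$\partial_t u+\partial_x f(u)+\sigma_0\,\partial_x^mu=0\quad\text{in }(0,T)\times\Omega$$ with initial data $u|_{t=0}=u_0\in W^{m,\infty}(\Omega)$. For each $\tau>0$, let $q=(q_0,\dots,q_{m-1})$ (depending on $\tau$) be an entropy solution on $(0,T)\times\Omega$ of the system $$\begin{aligned} \partial_t q_0+\partial_x f(q_0)+\sigma_0\,\partial_x q_{m-1}&=0,\\ \tau\,\partial_t q_j+\sigma_0(-1)^j\,\partial_x q_{m-j-1}&=\sigma_0(-1)^jq_{m-j},&& j\in\{1,\dots,\tfrac m2-1\},\\ \tau\,\partial_t q_j+\sigma_0(-1)^{j+m-1}\,\partial_x q_{m-j-1}&=\sigma_0(-1)^{j+m-1}q_{m-j},&& j\in\{\tfrac m2,\dots,m-1\}, \end{aligned}$$ with initial data $q|_{t=0}=(u_0,\partial_xu_0,\dots,\partial_x^{m-1}u_0)$. Then, as $\tau\to0$, $$\|u-q_0\|_{L^\infty(0,T;L^2(\Omega))}+\sum_{j=1}^{m-1}\sqrt{\tau}\,\|\partial_x^ju-q_j\|_{L^\infty(0,T;L^2(\Omega))}=\mathcal{O}(\tau).$$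
   Context: $\Omega$ is a bounded one-dimensional interval with periodic boundary conditions (endpoints identified); all function spaces on $\Omega$ and $(0,T)\times\Omega$ are understood as spaces of functions periodic in $x$. $\mathcal{O}(\tau)$ means: there are $C>0$ and $\tau_0>0$, independent of $\tau$ (but possibly depending on $u$, $f$, $m$, $T$, $\Omega$), such that the quantity is at most $C\tau$ for all $\tau\in(0,\tau_0]$. Entropy solution: fix $\Phi$ with $\Phi'(a)=a f'(a)$ for $a\in\mathbb{R}$. The energy density, energy flux and energy source are $$e(q)=\tfrac12 q_0^2+\tfrac{\tau}{2}\sum_{j=1}^{m-1}q_j^2,\qquad G(q)=\Phi(q_0)+\sigma_0\sum_{j=0}^{m/2-1}(-1)^jq_jq_{m-1-j},\qquad S(q)=-q_{m/2}^2,$$ and smooth solutions satisfy $\partial_t e(q)+\partial_x G(q)=S(q)$. An entropy solution with initial data $q^{\mathrm{in}}$ is a function $q\in L^\infty((0,T)\times\Omega)^m$ that satisfies the system with initial data $q^{\mathrm{in}}$ in the sense of distributions (weak form with test functions in $C_c^\infty([0,T)\times\Omega)$, including the initial term) and the energy inequality $$\int_0^T\!\!\int_\Omega \bigl(e(q)\,\partial_t\varphi+G(q)\,\partial_x\varphi+S(q)\,\varphi\bigr)\,dx\,dt+\int_\Omega e(q^{\mathrm{in}})\,\varphi(0,\cdot)\,dx\ \ge 0$$ for all nonnegative $\varphi\in C_c^\infty([0,T)\times\Omega)$. *)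

theory Defs
  imports "HOL-Analysis.Analysis" "HOL-Probability.Essential_Supremum"
begin

text \<open>
  The torus \<open>\<Omega>\<close> is the interval \<open>(a, b)\<close>, \<open>a < b\<close>, with its endpoints identified.  Elements of
  \<open>L\<^sup>\<infinity>\<close> are represented by Lebesgue measurable functions whose values off \<open>\<Omega>\<close> (or off
  \<open>(0,T) \<times> \<Omega>\<close>) are irrelevant.  Periodicity is carried by the test functions, which are
  \<open>(b - a)\<close>-periodic in \<open>x\<close> and need not vanish at \<open>a\<close> and \<open>b\<close>: a weak derivative with respect to
  such test functions is a weak derivative on the torus, so that a jump between the two endpoints
  is seen by it.  Space-time points are pairs \<open>(t, x)\<close>.
\<close>

definition Linf :: "'a measure \<Rightarrow> ('a \<Rightarrow> real) \<Rightarrow> bool" where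
  "Linf M g \<longleftrightarrow> g \<in> borel_measurable M \<and> (\<exists>C. AE z in M. \<bar>g z\<bar> \<le> C)"

abbreviation circ :: "real \<Rightarrow> real \<Rightarrow> real measure" where
  "circ a b \<equiv> lebesgue_on {a<..<b}"

abbreviation cyl :: "real \<Rightarrow> real \<Rightarrow> real \<Rightarrow> (real \<times> real) measure" where
  "cyl T a b \<equiv> lebesgue_on ({0<..<T} \<times> {a<..<b})"


section \<open>Test functions\<close>

definition smooth1 :: "(real \<Rightarrow> real) \<Rightarrow> bool" where
  "smooth1 \<phi> \<longleftrightarrow> (\<forall>k x. (deriv ^^ k) \<phi> field_differentiable (at x))"

definition dt :: "(real \<times> real \<Rightarrow> real) \<Rightarrow> real \<times> real \<Rightarrow> real" where
  "dt \<phi> = (\<lambda>(t, x). deriv (\<lambda>s. \<phi> (s, x)) t)"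

definition dx :: "(real \<times> real \<Rightarrow> real) \<Rightarrow> real \<times> real \<Rightarrow> real" where
  "dx \<phi> = (\<lambda>(t, x). deriv (\<lambda>y. \<phi> (t, y)) x)"

text \<open>
  \<open>C\<^sup>\<infinity>\<close> on the plane: continuous partial derivatives \<open>D i j = \<partial>\<^sub>t\<^sup>i \<partial>\<^sub>x\<^sup>j \<phi>\<close> of all orders exist.
\<close>
definition smooth2 :: "(real \<times> real \<Rightarrow> real) \<Rightarrow> bool" where
  "smooth2 \<phi> \<longleftrightarrow>
     (\<exists>D :: nat \<Rightarrow> nat \<Rightarrow> real \<times> real \<Rightarrow> real.
        D 0 0 = \<phi> \<and>
        (\<forall>i j. continuous_on UNIV (D i j)) \<and>
        (\<forall>i j t x. ((\<lambda>s. D i j (s, x)) has_real_derivative D (Suc i) j (t, x)) (at t)) \<and>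
        (\<forall>i j t x. ((\<lambda>y. D i j (t, y)) has_real_derivative D i (Suc j) (t, x)) (at x)))"

definition test_line :: "(real \<Rightarrow> real) \<Rightarrow> bool" where
  "test_line \<phi> \<longleftrightarrow> smooth1 \<phi> \<and> (\<exists>R. \<forall>x. \<bar>x\<bar> > R \<longrightarrow> \<phi> x = 0)"

definition test_circ :: "real \<Rightarrow> real \<Rightarrow> (real \<Rightarrow> real) \<Rightarrow> bool" where
  "test_circ a b \<phi> \<longleftrightarrow> smooth1 \<phi> \<and> (\<forall>x. \<phi> (x + (b - a)) = \<phi> x)"

text \<open>
  \<open>C\<^sub>c\<^sup>\<infinity>([0,T) \<times> \<Omega>)\<close>: the elements are the restrictions to \<open>t \<ge> 0\<close> of the functions below, whose
  values for \<open>t < 0\<close> play no role.  They may be nonzero at \<open>t = 0\<close>.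
\<close>
definition test_init :: "real \<Rightarrow> real \<Rightarrow> real \<Rightarrow> (real \<times> real \<Rightarrow> real) \<Rightarrow> bool" where
  "test_init T a b \<phi> \<longleftrightarrow>
     smooth2 \<phi> \<and> (\<forall>t x. \<phi> (t, x + (b - a)) = \<phi> (t, x)) \<and>
     (\<exists>r<T. \<forall>t\<ge>r. \<forall>x. \<phi> (t, x) = 0)"

text \<open>\<open>C\<^sub>c\<^sup>\<infinity>((0,T) \<times> \<Omega>)\<close>\<close>
definition test_cyl :: "real \<Rightarrow> real \<Rightarrow> real \<Rightarrow> (real \<times> real \<Rightarrow> real) \<Rightarrow> bool" where
  "test_cyl T a b \<phi> \<longleftrightarrow>
     test_init T a b \<phi> \<and> (\<exists>s>0. \<forall>t\<le>s. \<forall>x. \<phi> (t, x) = 0)"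


section \<open>Weak derivatives and Sobolev spaces\<close>

text \<open>
  In the next two definitions both the function and its weak derivative are required to be in
  \<open>L\<^sup>\<infinity>\<close>; no other weak derivatives are needed on \<open>\<Omega>\<close> and on \<open>(0,T) \<times> \<Omega>\<close>.
\<close>
definition wderiv_circ ::
    "real \<Rightarrow> real \<Rightarrow> nat \<Rightarrow> (real \<Rightarrow> real) \<Rightarrow> (real \<Rightarrow> real) \<Rightarrow> bool" where
  "wderiv_circ a b k v g \<longleftrightarrow>
     Linf (circ a b) v \<and> Linf (circ a b) g \<and>
     (\<forall>\<phi>. test_circ a b \<phi> \<longrightarrow>
        (LINT x|circ a b. v x * (deriv ^^ k) \<phi> x) = (-1) ^ k * (LINT x|circ a b. g x * \<phi> x))"

text \<open>\<open>g = \<partial>\<^sub>t\<^sup>i \<partial>\<^sub>x\<^sup>j v\<close> weakly on \<open>(0,T) \<times> \<Omega>\<close>\<close>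
definition wderiv_cyl ::
    "real \<Rightarrow> real \<Rightarrow> real \<Rightarrow> nat \<Rightarrow> nat \<Rightarrow> (real \<times> real \<Rightarrow> real) \<Rightarrow> (real \<times> real \<Rightarrow> real) \<Rightarrow> bool" where
  "wderiv_cyl T a b i j v g \<longleftrightarrow>
     Linf (cyl T a b) v \<and> Linf (cyl T a b) g \<and>
     (\<forall>\<phi>. test_cyl T a b \<phi> \<longrightarrow>
        (LINT z|cyl T a b. v z * (dt ^^ i) ((dx ^^ j) \<phi>) z)
          = (-1) ^ (i + j) * (LINT z|cyl T a b. g z * \<phi> z))"

text \<open>\<open>W\<^sup>k\<^sup>,\<^sup>\<infinity>(\<Omega>)\<close> and \<open>W\<^sup>k\<^sup>,\<^sup>\<infinity>((0,T) \<times> \<Omega>)\<close>\<close>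
definition Winf_circ :: "real \<Rightarrow> real \<Rightarrow> nat \<Rightarrow> (real \<Rightarrow> real) \<Rightarrow> bool" where
  "Winf_circ a b k v \<longleftrightarrow> (\<forall>j\<le>k. \<exists>g. wderiv_circ a b j v g)"

definition Winf_cyl :: "real \<Rightarrow> real \<Rightarrow> real \<Rightarrow> nat \<Rightarrow> (real \<times> real \<Rightarrow> real) \<Rightarrow> bool" where
  "Winf_cyl T a b k v \<longleftrightarrow> (\<forall>i j. i + j \<le> k \<longrightarrow> (\<exists>g. wderiv_cyl T a b i j v g))"

definition Linf_loc :: "(real \<Rightarrow> real) \<Rightarrow> bool" where
  "Linf_loc g \<longleftrightarrow> (\<forall>R. Linf (lebesgue_on {-R..R}) g)"

definition wderiv_line :: "nat \<Rightarrow> (real \<Rightarrow> real) \<Rightarrow> (real \<Rightarrow> real) \<Rightarrow> bool" where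
  "wderiv_line k v g \<longleftrightarrow>
     Linf_loc v \<and> Linf_loc g \<and>
     (\<forall>\<phi>. test_line \<phi> \<longrightarrow>
        (LINT x|lebesgue. v x * (deriv ^^ k) \<phi> x) = (-1) ^ k * (LINT x|lebesgue. g x * \<phi> x))"

definition Winf_loc :: "nat \<Rightarrow> (real \<Rightarrow> real) \<Rightarrow> bool" where
  "Winf_loc k v \<longleftrightarrow> (\<forall>j\<le>k. \<exists>g. wderiv_line j v g)"

text \<open>
  The trace at \<open>t = 0\<close>, taken through the representative of \<open>u\<close> that is continuous up to \<open>t = 0\<close>
  (functions in \<open>W\<^sup>1\<^sup>,\<^sup>\<infinity>\<close> have one).
\<close>
definition initial_trace ::
    "real \<Rightarrow> real \<Rightarrow> real \<Rightarrow> (real \<times> real \<Rightarrow> real) \<Rightarrow> (real \<Rightarrow> real) \<Rightarrow> bool" where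
  "initial_trace T a b u u0 \<longleftrightarrow>
     (\<exists>v. continuous_on ({0..<T} \<times> {a<..<b}) v \<and>
          (AE z in cyl T a b. v z = u z) \<and> (AE x in circ a b. v (0, x) = u0 x))"


section \<open>The two systems\<close>

definition sigma0 :: "nat \<Rightarrow> real" where
  "sigma0 m = (-1) ^ (m div 2)"

text \<open>\<open>\<partial>\<^sub>t u + \<partial>\<^sub>x f(u) + \<sigma>\<^sub>0 \<partial>\<^sub>x\<^sup>m u = 0\<close>, an identity between \<open>L\<^sup>\<infinity>\<close> functions for \<open>u \<in> W\<^sup>m\<^sup>,\<^sup>\<infinity>\<close>\<close>
definition solves_eq ::
    "(real \<Rightarrow> real) \<Rightarrow> nat \<Rightarrow> real \<Rightarrow> real \<Rightarrow> real \<Rightarrow> (real \<times> real \<Rightarrow> real) \<Rightarrow> bool" where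
  "solves_eq f m T a b u \<longleftrightarrow>
     (\<exists>ut fux uxm.
        wderiv_cyl T a b 1 0 u ut \<and>
        wderiv_cyl T a b 0 1 (\<lambda>z. f (u z)) fux \<and>
        wderiv_cyl T a b 0 m u uxm \<and>
        (AE z in cyl T a b. ut z + fux z + sigma0 m * uxm z = 0))"

text \<open>Below, \<open>q j\<close> is the \<open>j\<close>-th component; only the components with \<open>j < m\<close> are used.\<close>

definition energy :: "nat \<Rightarrow> real \<Rightarrow> (nat \<Rightarrow> real) \<Rightarrow> real" where
  "energy m \<tau> q = 1/2 * (q 0)\<^sup>2 + \<tau>/2 * (\<Sum>j = 1..m - 1. (q j)\<^sup>2)"

definition energy_flux :: "(real \<Rightarrow> real) \<Rightarrow> nat \<Rightarrow> (nat \<Rightarrow> real) \<Rightarrow> real" where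
  "energy_flux \<Phi> m q = \<Phi> (q 0) + sigma0 m * (\<Sum>j<m div 2. (-1) ^ j * q j * q (m - 1 - j))"

definition energy_source :: "nat \<Rightarrow> (nat \<Rightarrow> real) \<Rightarrow> real" where
  "energy_source m q = - (q (m div 2))\<^sup>2"

text \<open>The common sign \<open>\<sigma>\<^sub>0 (-1)\<^sup>j\<close> or \<open>\<sigma>\<^sub>0 (-1)\<^sup>j\<^sup>+\<^sup>m\<^sup>-\<^sup>1\<close> of flux and source in the \<open>j\<close>-th equation, \<open>j \<ge> 1\<close>\<close>
definition sgn_eq :: "nat \<Rightarrow> nat \<Rightarrow> real" where
  "sgn_eq m j = (if j < m div 2 then sigma0 m * (-1) ^ j else sigma0 m * (-1) ^ (j + m - 1))"

text \<open>The first-order system with initial data \<open>qin\<close>, in the sense of distributions\<close>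
definition weak_sol_system ::
    "(real \<Rightarrow> real) \<Rightarrow> nat \<Rightarrow> real \<Rightarrow> real \<Rightarrow> real \<Rightarrow> real
      \<Rightarrow> (nat \<Rightarrow> real \<Rightarrow> real) \<Rightarrow> (nat \<Rightarrow> real \<times> real \<Rightarrow> real) \<Rightarrow> bool" where
  "weak_sol_system f m T a b \<tau> qin q \<longleftrightarrow>
     (\<forall>\<phi>. test_init T a b \<phi> \<longrightarrow>
        (LINT z|cyl T a b. q 0 z * dt \<phi> z + f (q 0 z) * dx \<phi> z + sigma0 m * q (m - 1) z * dx \<phi> z)
          + (LINT x|circ a b. qin 0 x * \<phi> (0, x)) = 0 \<and>
        (\<forall>j\<in>{1..m - 1}.
          (LINT z|cyl T a b. \<tau> * q j z * dt \<phi> z + sgn_eq m j * q (m - j - 1) z * dx \<phi> z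
              + sgn_eq m j * q (m - j) z * \<phi> z)
            + \<tau> * (LINT x|circ a b. qin j x * \<phi> (0, x)) = 0))"

definition entropy_solution ::
    "(real \<Rightarrow> real) \<Rightarrow> (real \<Rightarrow> real) \<Rightarrow> nat \<Rightarrow> real \<Rightarrow> real \<Rightarrow> real \<Rightarrow> real
      \<Rightarrow> (nat \<Rightarrow> real \<Rightarrow> real) \<Rightarrow> (nat \<Rightarrow> real \<times> real \<Rightarrow> real) \<Rightarrow> bool" where
  "entropy_solution f \<Phi> m T a b \<tau> qin q \<longleftrightarrow>
     (\<forall>j<m. Linf (cyl T a b) (q j)) \<and>
     weak_sol_system f m T a b \<tau> qin q \<and>
     (\<forall>\<phi>. test_init T a b \<phi> \<and> (\<forall>t\<ge>0. \<forall>x. \<phi> (t, x) \<ge> 0) \<longrightarrow>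
        (LINT z|cyl T a b. energy m \<tau> (\<lambda>j. q j z) * dt \<phi> z + energy_flux \<Phi> m (\<lambda>j. q j z) * dx \<phi> z
            + energy_source m (\<lambda>j. q j z) * \<phi> z)
          + (LINT x|circ a b. energy m \<tau> (\<lambda>j. qin j x) * \<phi> (0, x)) \<ge> 0)"


section \<open>The norm of \<open>L\<^sup>\<infinity>(0,T; L\<^sup>2(\<Omega>))\<close>, with values in \<open>[0, \<infinity>]\<close>\<close>

definition L2norm :: "real \<Rightarrow> real \<Rightarrow> (real \<Rightarrow> real) \<Rightarrow> ennreal" where
  "L2norm a b g =
     (let I = \<integral>\<^sup>+ x. ennreal ((g x)\<^sup>2) \<partial>circ a b
      in if I = \<infinity> then \<infinity> else ennreal (sqrt (enn2real I)))"

definition LinfL2norm :: "real \<Rightarrow> real \<Rightarrow> real \<Rightarrow> (real \<times> real \<Rightarrow> real) \<Rightarrow> ennreal" where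
  "LinfL2norm T a b g = esssup (lebesgue_on {0<..<T}) (\<lambda>t. L2norm a b (\<lambda>x. g (t, x)))"

end

theory Submission
  imports Defs "HOL-Computational_Algebra.Polynomial"
begin

text \<open>
  Relative energy argument. If \<open>W\<close> is an approximate solution of the first-order system, the energy
  inequality for \<open>q\<close> and the weak form of the system tested with \<open>W\<close> bound the growth of the energy
  of \<open>q - W\<close> by itself plus the residuals of \<open>W\<close> paired with \<open>q - W\<close>. With \<open>W j = \<partial>\<^sub>x\<^sup>j u\<close> the
  residuals \<open>\<tau> \<partial>\<^sub>t \<partial>\<^sub>x\<^sup>j u\<close> are too large: only the component \<open>m/2\<close> is damped, so the plain estimate
  loses a factor \<open>\<surd>\<tau>\<close> in all the others. We therefore compare with \<open>W j = \<partial>\<^sub>x\<^sup>j u + \<tau> Z j\<close>, where the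
  corrector \<open>Z\<close> moves all residuals of order \<open>\<tau>\<close> into the equations \<open>0\<close> and \<open>m/2\<close>. Since the equation
  \<open>m/2\<close> need not be corrected, \<open>Z\<close> can be chosen as a combination of \<open>\<partial>\<^sub>t \<partial>\<^sub>x\<^sup>i u\<close> with \<open>i \<le> m - 2\<close>,
  which is Lipschitz for \<open>u \<in> W\<^sup>m\<^sup>,\<^sup>\<infinity>\<close>. Gronwall's inequality then gives an energy of order \<open>\<tau>\<^sup>2\<close>.

  All test functions are products \<open>\<theta>(t) e\<^sub>k(x)\<close> with trigonometric \<open>e\<^sub>k\<close>: the weak equations become
  integral equations in time for Fourier coefficients, and bilinear expressions in \<open>q\<close> and \<open>W\<close> are
  recovered as limits of positive trigonometric means of these.
\<close>

section \<open>Smooth functions of one variable\<close>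

text \<open>The square root is lost in Young's inequality: an undamped component j >= 1 has only
  weight \<tau> in the energy, so a residual r costs r^2 / \<tau>, which is of order \<tau> when r =
  O(\<tau>) but of order \<tau>^3 when r = O(\<tau>^2). Component 0 has weight 1, and component m/2
  is controlled by a dissipation whose coefficient does not depend on \<tau>; both tolerate
  residuals of order \<tau>. The corrector does not vanish at time 0, but the mismatch of initial
  data is O(\<tau>) with weights at most 1, hence O(\<tau>^2) in energy; likewise \<tau> Z itself is
  within the claimed error.

  Two lacks of regularity shape the rest. Entropy solutions are merely bounded, without time traces
  or chain rule, so nothing is ever differentiated in q: weak statements are turned into integral
  relations valid at almost every time, and Gronwall's inequality is needed for bounded measurable
  functions. The profile W is only Lipschitz, hence not an admissible test function, and has to be
  inserted frequency by frequency. Chain rules are applied to W and u only.\<close>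

primrec diff_times :: "nat \<Rightarrow> (real \<Rightarrow> real) \<Rightarrow> bool" where
  "diff_times 0 f = True"
| "diff_times (Suc n) f = (\<exists>f'. (\<forall>x. (f has_real_derivative f' x) (at x)) \<and> diff_times n f')"

lemma diff_times_Suc_imp: "diff_times (Suc n) f \<Longrightarrow> diff_times n f"
proof (induction n arbitrary: f)
  case (Suc n)
  then obtain f' where "\<And>x. (f has_real_derivative f' x) (at x)" "diff_times (Suc n) f'"
    by auto
  with Suc.IH[of f'] show ?case by auto
qed simp

lemma deriv_funpow_Suc: "(deriv ^^ Suc k) f = (deriv ^^ k) (deriv f)"
  by (simp only: funpow_Suc_right comp_apply)

text \<open>Iterated \<open>deriv\<close> is awkward under sums and products, since each step needs
  differentiability of the previous one. In \<open>diff_times\<close> the derivative is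
  existentially quantified, so that closure properties become plain inductions on the order, which
  are carried over to \<open>smooth1\<close> here.\<close>

lemma smooth1_iff_diff_times: "smooth1 f \<longleftrightarrow> (\<forall>n. diff_times n f)"
proof
  assume "smooth1 f"
  then have D: "((deriv ^^ k) f has_real_derivative (deriv ^^ Suc k) f x) (at x)" for k x
    by (simp add: smooth1_def field_differentiable_derivI)
  have "diff_times n ((deriv ^^ k) f)" for n k
  proof (induction n arbitrary: k)
    case (Suc n)
    then show ?case using D[of k] by (auto simp del: funpow.simps)
  qed simp
  from this[of _ 0] show "\<forall>n. diff_times n f" by simp
next
  assume *: "\<forall>n. diff_times n f"
  have "diff_times (Suc k) f \<Longrightarrow> (deriv ^^ k) f field_differentiable (at x)" for k x
  proof (induction k arbitrary: f)
    case 0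
    then show ?case by (auto simp: field_differentiable_def)
  next
    case (Suc k)
    from Suc.prems obtain f' where f': "\<And>x. (f has_real_derivative f' x) (at x)" "diff_times (Suc k) f'"
      by auto
    then have "deriv f = f'" by (auto intro: DERIV_imp_deriv)
    then show ?case using Suc.IH[OF f'(2)] by (simp only: deriv_funpow_Suc)
  qed
  then show "smooth1 f" using * unfolding smooth1_def by blast
qed

lemma smooth1_deriv: "smooth1 f \<Longrightarrow> (f has_real_derivative deriv f x) (at x)"
  unfolding smooth1_def by (metis funpow_0 field_differentiable_derivI)

lemma smooth1_deriv_smooth1: "smooth1 f \<Longrightarrow> smooth1 (deriv f)"
  unfolding smooth1_def by (metis deriv_funpow_Suc)

lemma smooth1_derivs:
  "smooth1 f \<Longrightarrow> ((deriv ^^ k) f has_real_derivative (deriv ^^ Suc k) f x) (at x)"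
  by (simp add: smooth1_def field_differentiable_derivI)

lemma smooth1_funpow: "smooth1 f \<Longrightarrow> smooth1 ((deriv ^^ k) f)"
  by (induction k) (auto intro: smooth1_deriv_smooth1)

lemma smooth1_continuous_on: "smooth1 f \<Longrightarrow> continuous_on S f"
  by (meson DERIV_isCont continuous_at_imp_continuous_on smooth1_deriv)

lemma smooth1_antideriv:
  assumes "\<And>x. (F has_real_derivative f x) (at x)" "smooth1 f"
  shows "smooth1 F"
proof -
  have "diff_times n F" for n
    using assms by (cases n) (auto simp: smooth1_iff_diff_times)
  then show ?thesis by (simp add: smooth1_iff_diff_times)
qed

text \<open>Coinduction for smoothness: in a family closed under differentiation every member can be
  differentiated again and again. The families used below are flat exponentials with polynomial
  factors, multiples of trigonometric functions, and affine substitutions.\<close>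

lemma smooth1_closed_family:
  assumes "f \<in> S" and "\<And>g. g \<in> S \<Longrightarrow> \<exists>g'\<in>S. \<forall>x. (g has_real_derivative g' x) (at x)"
  shows "smooth1 f"
proof -
  have "diff_times n g" if "g \<in> S" for n g
    using that
  proof (induction n arbitrary: g)
    case (Suc n)
    then show ?case using assms(2)[of g] by auto
  qed simp
  then show ?thesis using assms(1) by (simp add: smooth1_iff_diff_times)
qed

lemma diff_times_add: "diff_times n f \<Longrightarrow> diff_times n g \<Longrightarrow> diff_times n (\<lambda>x. f x + g x)"
proof (induction n arbitrary: f g)
  case (Suc n)
  then obtain f' g' where "\<And>x. (f has_real_derivative f' x) (at x)" "diff_times n f'"
    "\<And>x. (g has_real_derivative g' x) (at x)" "diff_times n g'" by auto
  with Suc.IH[of f' g'] show ?case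
    by (auto intro!: exI[of _ "\<lambda>x. f' x + g' x"] derivative_eq_intros)
qed simp

lemma diff_times_mult: "diff_times n f \<Longrightarrow> diff_times n g \<Longrightarrow> diff_times n (\<lambda>x. f x * g x)"
proof (induction n arbitrary: f g)
  case (Suc n)
  then obtain f' g' where *: "\<And>x. (f has_real_derivative f' x) (at x)" "diff_times n f'"
    "\<And>x. (g has_real_derivative g' x) (at x)" "diff_times n g'" by auto
  have "diff_times n (\<lambda>x. f' x * g x + f x * g' x)"
    using Suc diff_times_Suc_imp[OF Suc.prems(1)] diff_times_Suc_imp[OF Suc.prems(2)] *
    by (intro diff_times_add Suc.IH) auto
  then show ?case using *
    by (auto intro!: exI[of _ "\<lambda>x. f' x * g x + f x * g' x"] derivative_eq_intros)
qed simp

lemma smooth1_add: "smooth1 f \<Longrightarrow> smooth1 g \<Longrightarrow> smooth1 (\<lambda>x. f x + g x)"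
  by (simp add: smooth1_iff_diff_times diff_times_add)

lemma smooth1_mult: "smooth1 f \<Longrightarrow> smooth1 g \<Longrightarrow> smooth1 (\<lambda>x. f x * g x)"
  by (simp add: smooth1_iff_diff_times diff_times_mult)

lemma smooth1_const: "smooth1 (\<lambda>x. c)"
  by (rule smooth1_closed_family[of _ "range (\<lambda>c x. c)"]) (auto intro!: exI[of _ 0])

lemma smooth1_cmult: "smooth1 f \<Longrightarrow> smooth1 (\<lambda>x. c * f x)"
  by (intro smooth1_mult smooth1_const)

lemma smooth1_diff: "smooth1 f \<Longrightarrow> smooth1 g \<Longrightarrow> smooth1 (\<lambda>x. f x - g x)"
  using smooth1_add[of f "\<lambda>x. (-1) * g x"] smooth1_cmult[of g "-1"] by simp

lemma smooth1_affine:
  assumes "smooth1 f"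
  shows "smooth1 (\<lambda>x. f (c * x + d))"
proof (rule smooth1_closed_family[where S = "{\<lambda>x. r * g (c * x + d) |r g. smooth1 g}"])
  show "(\<lambda>x. f (c * x + d)) \<in> {\<lambda>x. r * g (c * x + d) |r g. smooth1 g}"
    using assms by (auto intro!: exI[of _ 1] exI[of _ f])
next
  fix g :: "real \<Rightarrow> real"
  assume "g \<in> {\<lambda>x. r * g (c * x + d) |r g. smooth1 g}"
  then obtain r g1 where g: "g = (\<lambda>x. r * g1 (c * x + d))" "smooth1 g1" by auto
  have "(g has_real_derivative r * c * deriv g1 (c * x + d)) (at x)" for x
    unfolding g by (rule derivative_eq_intros DERIV_chain2[OF smooth1_deriv[OF g(2)]] refl | simp)+
  then show "\<exists>g'\<in>{\<lambda>x. r * g (c * x + d) |r g. smooth1 g}. \<forall>x. (g has_real_derivative g' x) (at x)"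
    using smooth1_deriv_smooth1[OF g(2)]
    by (intro bexI[of _ "\<lambda>x. r * c * deriv g1 (c * x + d)"]) auto
qed

section \<open>Flat exponentials and bump functions\<close>

definition flat_exp :: "real poly \<Rightarrow> real \<Rightarrow> real" where
  "flat_exp p x = (if x > 0 then poly p (1 / x) * exp (- (1 / x)) else 0)"

lemma poly_times_exp_tendsto_0: "((\<lambda>z::real. poly p z * exp (- z)) \<longlongrightarrow> 0) at_top"
proof -
  have "((\<lambda>z::real. \<Sum>i\<le>degree p. coeff p i * (z ^ i / exp z)) \<longlongrightarrow> (\<Sum>i\<le>degree p. coeff p i * 0)) at_top"
    by (intro tendsto_intros tendsto_power_div_exp_0)
  then show ?thesis
    by (simp add: poly_altdef sum_distrib_right exp_minus divide_inverse mult.assoc)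
qed

text \<open>The polynomial parameter closes the family under differentiation: for x > 0 and y = 1/x
  the chain rule replaces p by the polynomial y^2 (p - p'). At 0 the exponential beats every power
  of 1/x.\<close>

lemma flat_exp_has_derivative:
  "(flat_exp p has_real_derivative flat_exp ([:0, 0, 1:] * (p - pderiv p)) x) (at x)"
proof -
  consider "x > 0" | "x < 0" | "x = 0" by linarith
  then show ?thesis
  proof cases
    case 1
    have "((\<lambda>x. poly p (1 / x) * exp (- (1 / x))) has_real_derivative
        flat_exp ([:0, 0, 1:] * (p - pderiv p)) x) (at x)"
      using 1
      by (auto intro!: derivative_eq_intros DERIV_chain2[OF poly_DERIV]
          simp: flat_exp_def field_simps power2_eq_square)
    then show ?thesis
      by (rule has_field_derivative_transform_within_open[of _ _ _ "{0<..}"])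
        (use 1 in \<open>auto simp: flat_exp_def\<close>)
  next
    case 2
    have "((\<lambda>x. 0) has_real_derivative flat_exp ([:0, 0, 1:] * (p - pderiv p)) x) (at x)"
      using 2 by (simp add: flat_exp_def)
    then show ?thesis
      by (rule has_field_derivative_transform_within_open[of _ _ _ "{..<0}"])
        (use 2 in \<open>auto simp: flat_exp_def\<close>)
  next
    case 3
    have "((\<lambda>y. flat_exp p y / y) \<longlongrightarrow> 0) (at_right 0)"
    proof -
      \<comment> \<open>With z = 1/y the difference quotient at 0 is z p(z) exp(-z), and
        \<open>pCons 0 p\<close> is the polynomial z p(z).\<close>
      have "((\<lambda>y. poly (pCons 0 p) (inverse y) * exp (- inverse y)) \<longlongrightarrow> 0) (at_right 0)"
        using poly_times_exp_tendsto_0 filterlim_inverse_at_top_right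
        by (rule filterlim_compose)
      then show ?thesis
        by (rule Lim_transform_eventually)
          (auto simp: eventually_at_right_less flat_exp_def field_simps
            intro!: eventually_mono[OF eventually_at_right_less[of 0]])
    qed
    moreover have "((\<lambda>y. flat_exp p y / y) \<longlongrightarrow> 0) (at_left 0)"
      by (rule Lim_transform_eventually[OF tendsto_const])
        (auto simp: flat_exp_def eventually_at_left_field intro!: exI[of _ "-1"])
    ultimately have "((\<lambda>y. flat_exp p y / y) \<longlongrightarrow> 0) (at 0)"
      by (simp add: filterlim_split_at)
    then show ?thesis
      using 3 by (simp add: has_field_derivative_iff flat_exp_def)
  qed
qed

lemma smooth1_flat_exp: "smooth1 (flat_exp p)"
  by (rule smooth1_closed_family[of _ "range flat_exp"]) (use flat_exp_has_derivative in blast)+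

text \<open>The factor \<open>n\<close> steepens both flanks, so that the bumps tend to the
  indicator of the open interval from c to d as n grows. For \<open>n = 0\<close> the function is
  identically zero, a case that is split off where positive mass is needed.\<close>

definition bump :: "real \<Rightarrow> real \<Rightarrow> nat \<Rightarrow> real \<Rightarrow> real" where
  "bump c d n t = flat_exp 1 (real n * (t - c)) * flat_exp 1 (real n * (d - t))"

lemma smooth1_bump: "smooth1 (bump c d n)"
proof -
  have "smooth1 (\<lambda>t. flat_exp 1 (real n * t + (- real n * c)) * flat_exp 1 ((- real n) * t + real n * d))"
    by (intro smooth1_mult smooth1_affine smooth1_flat_exp)
  then show ?thesis by (simp add: bump_def[abs_def] algebra_simps)
qed

lemma flat_exp_1_bounds: "0 \<le> flat_exp 1 x" "flat_exp 1 x \<le> 1"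
  by (auto simp: flat_exp_def)

lemma bump_bounds: "0 \<le> bump c d n t" "bump c d n t \<le> 1"
  unfolding bump_def using flat_exp_1_bounds by (auto intro: mult_le_one)

lemma bump_zero: "t \<le> c \<or> d \<le> t \<Longrightarrow> bump c d n t = 0"
  unfolding bump_def flat_exp_def
  by (auto simp: zero_less_mult_iff)

lemma bump_tendsto: "(\<lambda>n. bump c d n t) \<longlonglongrightarrow> indicator {c<..<d} t"
proof (cases "c < t \<and> t < d")
  case True
  have *: "(\<lambda>n. flat_exp 1 (real n * y)) \<longlonglongrightarrow> 1" if "y > 0" for y
  proof -
    have "(\<lambda>n. exp (- (inverse y * (1 / real n)))) \<longlonglongrightarrow> exp (- (inverse y * 0))"
      by (intro tendsto_intros lim_1_over_n)
    then have "(\<lambda>n. exp (- (inverse y * (1 / real n)))) \<longlonglongrightarrow> 1" by simp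
    then show ?thesis
      by (rule Lim_transform_eventually)
        (use that in \<open>auto simp: flat_exp_def field_simps intro!: eventually_mono[OF eventually_gt_at_top[of 0]]\<close>)
  qed
  have "(\<lambda>n. bump c d n t) \<longlonglongrightarrow> 1 * 1"
    unfolding bump_def by (intro tendsto_mult *) (use True in auto)
  then show ?thesis using True by simp
next
  case False
  then have "bump c d n t = 0" for n using bump_zero[of t c d] by auto
  with False show ?thesis by simp
qed

section \<open>Bounded Borel functions\<close>

abbreviation J :: "real \<Rightarrow> real \<Rightarrow> real measure" where
  "J l r \<equiv> restrict_space lborel {l<..<r}"

text \<open>Boundedness on the whole space, not only on the domain, makes integrability over bounded
  intervals, products, slices and Fubini free of side conditions. The price is that L-infinity
  functions must first be replaced by such representatives, and that unbounded continuous factors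
  must be cut off.\<close>

definition bb :: "('a::topological_space \<Rightarrow> real) \<Rightarrow> bool" where
  "bb g \<longleftrightarrow> g \<in> borel_measurable borel \<and> (\<exists>C. \<forall>x. \<bar>g x\<bar> \<le> C)"

lemma bbI: "g \<in> borel_measurable borel \<Longrightarrow> (\<And>x. \<bar>g x\<bar> \<le> C) \<Longrightarrow> bb g"
  unfolding bb_def by blast

lemma bb_measurable: "bb g \<Longrightarrow> g \<in> borel_measurable borel"
  unfolding bb_def by blast

lemma bb_bound:
  assumes "bb g"
  obtains C where "C \<ge> 0" "\<And>x. \<bar>g x\<bar> \<le> C"
proof -
  obtain C where "\<And>x. \<bar>g x\<bar> \<le> C" using assms unfolding bb_def by blast
  moreover from this[of undefined] have "C \<ge> 0" by linarith
  ultimately show ?thesis using that by blast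
qed

lemma bb_const: "bb (\<lambda>x. c)"
  by (rule bbI[of _ "\<bar>c\<bar>"]) auto

lemma bb_add:
  assumes "bb f" "bb g"
  shows "bb (\<lambda>x. f x + g x)"
proof -
  note [measurable] = bb_measurable[OF assms(1)] bb_measurable[OF assms(2)]
  obtain C D where C: "\<And>x. \<bar>f x\<bar> \<le> C" and D: "\<And>x. \<bar>g x\<bar> \<le> D"
    using bb_bound[OF assms(1)] bb_bound[OF assms(2)] by metis
  have "\<bar>f x + g x\<bar> \<le> C + D" for x using C[of x] D[of x] by linarith
  then show ?thesis by (intro bbI) auto
qed

lemma bb_mult:
  assumes "bb f" "bb g"
  shows "bb (\<lambda>x. f x * g x)"
proof -
  note [measurable] = bb_measurable[OF assms(1)] bb_measurable[OF assms(2)]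
  obtain C D where C: "\<And>x. \<bar>f x\<bar> \<le> C" and D: "\<And>x. \<bar>g x\<bar> \<le> D"
    using bb_bound[OF assms(1)] bb_bound[OF assms(2)] by metis
  have "\<bar>f x * g x\<bar> \<le> C * D" for x
    using C[of x] D[of x] by (auto simp: abs_mult intro!: mult_mono order_trans[OF abs_ge_zero C])
  then show ?thesis by (intro bbI) auto
qed

lemma bb_minus: "bb f \<Longrightarrow> bb (\<lambda>x. - f x)"
  using bb_mult[OF bb_const[of "-1"]] by simp

lemma bb_diff: "bb f \<Longrightarrow> bb g \<Longrightarrow> bb (\<lambda>x. f x - g x)"
  using bb_add[of f "\<lambda>x. - g x"] bb_minus[of g] by simp

lemma bb_sum: "(\<And>i. i \<in> A \<Longrightarrow> bb (f i)) \<Longrightarrow> bb (\<lambda>x. \<Sum>i\<in>A. f i x)"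
  by (induction A rule: infinite_finite_induct) (auto intro: bb_const bb_add)

lemma bb_power2: "bb f \<Longrightarrow> bb (\<lambda>x. (f x)\<^sup>2)"
  unfolding power2_eq_square by (rule bb_mult)

lemma bb_abs: "bb f \<Longrightarrow> bb (\<lambda>x. \<bar>f x\<bar>)"
  unfolding bb_def by auto

lemma bb_continuous_compose:
  assumes "continuous_on UNIV f" "bb g"
  shows "bb (\<lambda>x. f (g x))"
proof -
  obtain C where C: "\<And>x. \<bar>g x\<bar> \<le> C" using bb_bound[OF assms(2)] by metis
  have "compact (f ` {-C..C})"
    by (rule compact_continuous_image) (auto intro: continuous_on_subset[OF assms(1)])
  then have "bounded (f ` {-C..C})" by (rule compact_imp_bounded)
  then obtain D where D: "\<forall>y\<in>f ` {-C..C}. \<bar>y\<bar> \<le> D" unfolding bounded_real by blast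
  have [measurable]: "f \<in> borel_measurable borel"
    by (rule borel_measurable_continuous_onI) (rule assms)
  note [measurable] = bb_measurable[OF assms(2)]
  have "\<bar>f (g x)\<bar> \<le> D" for x using C[of x] D by (auto simp: abs_le_iff)
  then show ?thesis by (intro bbI) auto
qed

lemma bb_indicator: "A \<in> sets borel \<Longrightarrow> bb (indicator A :: 'a::topological_space \<Rightarrow> real)"
  by (rule bbI[of _ 1]) (auto simp: indicator_def)

lemma bb_slice:
  fixes g :: "real \<times> real \<Rightarrow> real"
  assumes "bb g"
  shows "bb (\<lambda>x. g (t, x))"
proof -
  have "(\<lambda>x. (t, x)) \<in> borel \<rightarrow>\<^sub>M borel"
    by (intro borel_measurable_continuous_onI continuous_intros)
  then have "(\<lambda>x. g (t, x)) \<in> borel_measurable borel"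
    by (rule measurable_compose) (rule bb_measurable[OF assms])
  then show ?thesis using assms unfolding bb_def by blast
qed

lemma bb_fst: "bb (f :: real \<Rightarrow> real) \<Longrightarrow> bb (\<lambda>z::real \<times> real. f (fst z))"
  unfolding bb_def borel_prod[symmetric] by auto

lemma bb_snd: "bb (f :: real \<Rightarrow> real) \<Longrightarrow> bb (\<lambda>z::real \<times> real. f (snd z))"
  unfolding bb_def borel_prod[symmetric] by auto

lemmas bb_intros = bb_const bb_add bb_mult bb_minus bb_diff bb_sum bb_power2 bb_abs bb_slice
  bb_fst bb_snd

lemma id_borel: "(\<lambda>x. x) \<in> borel_measurable borel"
  by simp

lemma finite_measure_J: "finite_measure (J l r)"
  by (rule finite_measureI, cases "l \<le> r") (auto simp: emeasure_restrict_space space_restrict_space)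

lemma sigma_finite_J: "sigma_finite_measure (J l r)"
  using finite_measure_J finite_measure.axioms(1) by blast

lemma pair_sigma_finite_J: "pair_sigma_finite (J l r) (J l' r')"
  by (intro pair_sigma_finite.intro sigma_finite_J)

lemma measure_J: "l \<le> r \<Longrightarrow> measure (J l r) {l<..<r} = r - l"
  by (simp add: measure_restrict_space)

lemma space_J: "space (J l r) = {l<..<r}"
  by (simp add: space_restrict_space)

lemma measurable_J: "g \<in> borel_measurable borel \<Longrightarrow> g \<in> borel_measurable (J l r)"
  by (simp add: measurable_restrict_space1)

lemma AE_J_iff: "(AE x in J l r. P x) \<longleftrightarrow> (AE x in lborel. x \<in> {l<..<r} \<longrightarrow> P x)"
  by (rule AE_restrict_space_iff) simp

lemma AE_J_I: "(AE x in lborel. P x) \<Longrightarrow> AE x in J l r. P x"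
  by (auto simp: AE_J_iff)

lemma AE_J_neq: "AE x in J l r. x \<noteq> c"
  by (rule AE_J_I) (rule AE_lborel_singleton)

lemma integrable_J:
  fixes g :: "real \<Rightarrow> real"
  assumes "g \<in> borel_measurable borel" "\<And>x. l < x \<Longrightarrow> x < r \<Longrightarrow> \<bar>g x\<bar> \<le> C"
  shows "integrable (J l r) g"
  using finite_measure_J assms measurable_J
  by (intro finite_measure.integrable_const_bound[of _ _ C]) (auto simp: space_restrict_space)

lemma bb_integrable: "bb g \<Longrightarrow> integrable (J l r) g"
  by (metis bb_bound bb_measurable integrable_J)

lemma J_integral_lborel: "(LINT x|J l r. g x) = (LINT x|lborel. indicator {l<..<r} x * (g x :: real))"
  by (subst integral_restrict_space) auto

lemma J_integral_bound:
  assumes "l \<le> r" "\<And>x. l < x \<Longrightarrow> x < r \<Longrightarrow> \<bar>g x\<bar> \<le> C" "g \<in> borel_measurable borel"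
  shows "\<bar>LINT x|J l r. g x\<bar> \<le> C * (r - l)"
proof -
  interpret finite_measure "J l r" by (rule finite_measure_J)
  have "\<bar>LINT x|J l r. g x\<bar> \<le> (LINT x|J l r. \<bar>g x\<bar>)"
    by (rule integral_abs_bound)
  also have "\<dots> \<le> (LINT x|J l r. C)"
    using integrable_J[of g l r C] assms by (intro integral_mono) (auto simp: space_restrict_space)
  finally have "\<bar>LINT x|J l r. g x\<bar> \<le> (LINT x|J l r. C)" .
  then show ?thesis using assms(1) by (simp add: space_J measure_J mult.commute)
qed

lemma J_dominated_convergence:
  assumes "\<And>n. s n \<in> borel_measurable borel" "f \<in> borel_measurable borel"
    and "AE x in J l r. (\<lambda>n. s n x) \<longlonglongrightarrow> (f x :: real)"
    and "\<And>n x. l < x \<Longrightarrow> x < r \<Longrightarrow> \<bar>s n x\<bar> \<le> C"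
  shows "(\<lambda>n. LINT x|J l r. s n x) \<longlonglongrightarrow> (LINT x|J l r. f x)"
proof (rule integral_dominated_convergence[where w = "\<lambda>_. C"])
  interpret finite_measure "J l r" by (rule finite_measure_J)
  show "integrable (J l r) (\<lambda>_. C)" by simp
qed (use assms in \<open>auto simp: space_restrict_space intro!: measurable_J\<close>)

lemma id_measurable_pair_J: "(\<lambda>z. z) \<in> borel \<Otimes>\<^sub>M J l r \<rightarrow>\<^sub>M (borel :: (real \<times> real) measure)"
proof -
  have "snd \<in> borel_measurable ((borel :: real measure) \<Otimes>\<^sub>M J l r)"
    by (rule measurable_compose[OF measurable_snd measurable_J[OF id_borel]])
  then have "(\<lambda>z. (fst z, snd z)) \<in> borel_measurable ((borel :: real measure) \<Otimes>\<^sub>M J l r)"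
    by (intro borel_measurable_Pair) auto
  then show ?thesis by simp
qed

lemma bb_integral:
  fixes g :: "real \<times> real \<Rightarrow> real"
  assumes "bb g"
  shows "bb (\<lambda>t. LINT x|J l r. g (t, x))"
proof -
  obtain C where C: "\<And>z. \<bar>g z\<bar> \<le> C" "C \<ge> 0" using bb_bound[OF assms] by metis
  interpret sigma_finite_measure "J l r" by (rule sigma_finite_J)
  have "(\<lambda>(t, x). g (t, x)) \<in> borel_measurable (borel \<Otimes>\<^sub>M J l r)"
    using measurable_compose[OF id_measurable_pair_J bb_measurable[OF assms]] by simp
  then have "(\<lambda>t. LINT x|J l r. g (t, x)) \<in> borel_measurable borel"
    using borel_measurable_lebesgue_integral[of "\<lambda>t x. g (t, x)"] by simp
  moreover have "\<bar>LINT x|J l r. g (t, x)\<bar> \<le> C * \<bar>r - l\<bar>" for t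
  proof (cases "l \<le> r")
    case True
    then show ?thesis
      using J_integral_bound[of l r "\<lambda>x. g (t, x)" C] C bb_measurable[OF bb_slice[OF assms]] by simp
  next
    case False
    then have "{l<..<r} = {}" by auto
    then have "(LINT x|J l r. g (t, x)) = 0" by (subst J_integral_lborel) simp
    then show ?thesis using C by simp
  qed
  ultimately show ?thesis by (rule bbI)
qed

lemma bb_Fubini:
  fixes g :: "real \<times> real \<Rightarrow> real"
  assumes "bb g"
  shows "(LINT x|J l' r'. LINT t|J l r. g (t, x)) = (LINT t|J l r. LINT x|J l' r'. g (t, x))"
proof -
  interpret pair_sigma_finite "J l r" "J l' r'" by (rule pair_sigma_finite_J)
  interpret M1: finite_measure "J l r" by (rule finite_measure_J)
  interpret M2: finite_measure "J l' r'" by (rule finite_measure_J)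
  obtain C where C: "\<And>z. \<bar>g z\<bar> \<le> C" using bb_bound[OF assms] by metis
  have "snd \<in> borel_measurable (J l r \<Otimes>\<^sub>M J l' r')" "fst \<in> borel_measurable (J l r \<Otimes>\<^sub>M J l' r')"
    by (rule measurable_compose[OF measurable_snd measurable_J[OF id_borel]]
        measurable_compose[OF measurable_fst measurable_J[OF id_borel]])+
  then have "(\<lambda>z. (fst z, snd z)) \<in> borel_measurable (J l r \<Otimes>\<^sub>M J l' r')"
    by (intro borel_measurable_Pair)
  from measurable_compose[OF this bb_measurable[OF assms]]
  have m: "g \<in> borel_measurable (J l r \<Otimes>\<^sub>M J l' r')" by simp
  interpret P: finite_measure "J l r \<Otimes>\<^sub>M J l' r'"
    by (rule finite_measure_pair_measure) unfold_locales
  have "integrable (J l r \<Otimes>\<^sub>M J l' r') g"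
    using m C by (intro P.integrable_const_bound[of _ C]) auto
  then show ?thesis using Fubini_integral[of "\<lambda>t x. g (t, x)"] by simp
qed

text \<open>Measurability in the sense of \<open>measurable_on\<close> provides continuous functions
  converging off a negligible set. Clamping them between \<open>lo\<close> and \<open>hi\<close>
  preserves convergence and gives the uniform bounds for dominated convergence.\<close>

lemma continuous_approx:
  fixes g :: "real \<Rightarrow> real"
  assumes "g \<in> borel_measurable borel" "\<And>x. lo \<le> g x" "\<And>x. g x \<le> hi"
  shows "\<exists>c. (\<forall>n. continuous_on UNIV (c n)) \<and> (\<forall>n x. lo \<le> c n x \<and> c n x \<le> hi) \<and>
      (AE x in lborel. (\<lambda>n. c n x) \<longlonglongrightarrow> g x)"
proof -
  have "g measurable_on UNIV"
    using assms(1) by (intro lebesgue_measurable_imp_measurable_on) (auto intro: measurable_completion)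
  then obtain N c where N: "negligible N" and c: "\<And>n. continuous_on UNIV (c n)"
    and lim: "\<And>x. x \<notin> N \<Longrightarrow> (\<lambda>n. c n x) \<longlonglongrightarrow> g x"
    unfolding measurable_on_def by auto
  have "AE x in lebesgue. x \<notin> N"
    using N AE_not_in by (simp add: negligible_iff_null_sets)
  then have "AE x in lborel. x \<notin> N" by (simp add: AE_completion_iff)
  then have "AE x in lborel. (\<lambda>n. max lo (min hi (c n x))) \<longlonglongrightarrow> g x"
  proof eventually_elim
    case (elim x)
    have "(\<lambda>n. max lo (min hi (c n x))) \<longlonglongrightarrow> max lo (min hi (g x))"
      by (intro tendsto_intros lim elim)
    then show ?case using assms(2,3)[of x] by (simp add: min_absorb2 max_absorb2)
  qed
  moreover have "lo \<le> hi" using assms(2,3)[of 0] by linarith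
  ultimately show ?thesis using c
    by (intro exI[of _ "\<lambda>n x. max lo (min hi (c n x))"])
      (auto intro!: continuous_intros)
qed

lemma LIMSEQ_upper_bound: "X \<longlonglongrightarrow> x \<Longrightarrow> (\<And>n. X n \<le> a) \<Longrightarrow> x \<le> (a::real)"
  by (rule LIMSEQ_le_const2) auto

lemma abs_mult_le: "\<bar>x\<bar> \<le> C \<Longrightarrow> 0 \<le> y \<Longrightarrow> y \<le> 1 \<Longrightarrow> \<bar>x * y\<bar> \<le> (C::real)"
  using mult_mono[of "\<bar>x\<bar>" C y 1] by (simp add: abs_mult)

section \<open>Weak inequalities and identities in one variable\<close>

text \<open>The continuous weight is replaced by its values at the left end points of a grid of mesh
  1/(k+1). For such a step function the integral is a nonnegative combination of integrals over grid
  intervals; then the mesh tends to zero.\<close>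

lemma step_function_integral_nonpos:
  assumes H: "bb H" and lr: "l < r"
    and neg: "\<And>c d. (LINT t|J l r. H t * indicator {c<..<d} t) \<le> 0"
    and g: "continuous_on UNIV g" "\<And>x. 0 \<le> g x" "\<And>x. g x \<le> 1"
  shows "(LINT t|J l r. H t * g t) \<le> 0"
proof -
  define s where "s k t = g (of_int \<lfloor>real (Suc k) * t\<rfloor> / real (Suc k))" for k t
  have gm: "g \<in> borel_measurable borel" using g(1) by (rule borel_measurable_continuous_onI)
  have sm: "s k \<in> borel_measurable borel" for k
    unfolding s_def using gm by measurable
  obtain C where C: "\<And>x. \<bar>H x\<bar> \<le> C" "C \<ge> 0" using bb_bound[OF H] by metis
  have "(\<lambda>k. s k t) \<longlonglongrightarrow> g t" for t
  proof -
    have "(\<lambda>k. of_int \<lfloor>real (Suc k) * t\<rfloor> / real (Suc k) - t) \<longlonglongrightarrow> 0"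
    proof (rule tendsto_rabs_zero_cancel, rule tendsto_sandwich[OF _ _ tendsto_const])
      show "(\<lambda>k. 1 / real (Suc k)) \<longlonglongrightarrow> 0"
        by (rule LIMSEQ_Suc) (rule lim_1_over_n)
      have "\<bar>of_int \<lfloor>real (Suc k) * t\<rfloor> / real (Suc k) - t\<bar> \<le> 1 / real (Suc k)" for k
      proof -
        have "\<bar>of_int \<lfloor>real (Suc k) * t\<rfloor> - real (Suc k) * t\<bar> \<le> 1" by linarith
        moreover have "of_int \<lfloor>real (Suc k) * t\<rfloor> / real (Suc k) - t
            = (of_int \<lfloor>real (Suc k) * t\<rfloor> - real (Suc k) * t) / real (Suc k)"
          by (simp add: field_simps)
        ultimately show ?thesis by (simp add: divide_right_mono)
      qed
      then show "\<forall>\<^sub>F k in sequentially. \<bar>of_int \<lfloor>real (Suc k) * t\<rfloor> / real (Suc k) - t\<bar> \<le> 1 / real (Suc k)"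
        by simp
    qed auto
    from tendsto_add[OF this tendsto_const[of t]]
    have "(\<lambda>k. of_int \<lfloor>real (Suc k) * t\<rfloor> / real (Suc k)) \<longlonglongrightarrow> t" by simp
    moreover have "isCont g t" using g(1) by (simp add: continuous_on_eq_continuous_at)
    ultimately show ?thesis unfolding s_def by (rule isCont_tendsto_compose[rotated])
  qed
  then have "(\<lambda>k. LINT t|J l r. H t * s k t) \<longlonglongrightarrow> (LINT t|J l r. H t * g t)"
    using C g gm sm bb_measurable[OF H]
    by (intro J_dominated_convergence[where C = C])
      (auto simp: s_def intro!: tendsto_intros abs_mult_le)
  moreover have "(LINT t|J l r. H t * s k t) \<le> 0" for k
  proof -
    define I where "I = {\<lfloor>real (Suc k) * l\<rfloor> .. \<lfloor>real (Suc k) * r\<rfloor>}"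
    define S where "S i = {of_int i / real (Suc k) <..< of_int (i + 1) / real (Suc k)}" for i :: int
    \<comment> \<open>Off the countable set of grid points, every t lies in exactly one open grid
      interval, the one numbered by the floor.\<close>
    have "AE t in J l r. \<forall>i::int. t \<noteq> of_int i / real (Suc k)"
      by (simp add: AE_all_countable AE_J_neq)
    moreover have "AE t in J l r. l < t \<and> t < r"
      by (rule AE_I2) (simp add: space_J)
    ultimately have "AE t in J l r. H t * s k t = (\<Sum>i\<in>I. g (of_int i / real (Suc k)) * (H t * indicator (S i) t))"
    proof eventually_elim
      case (elim t)
      let ?i = "\<lfloor>real (Suc k) * t\<rfloor>"
      have S: "t \<in> S i \<longleftrightarrow> i = ?i" for i
      proof
        assume "t \<in> S i"
        then have "of_int i < real (Suc k) * t" "real (Suc k) * t < of_int i + 1"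
          unfolding S_def by (auto simp: field_simps simp del: of_nat_Suc)
        then have "?i = i" by (intro floor_unique) auto
        then show "i = ?i" ..
      next
        assume i: "i = ?i"
        have "of_int ?i \<noteq> real (Suc k) * t"
        proof
          assume "of_int ?i = real (Suc k) * t"
          then have "t = of_int ?i / real (Suc k)"
            by (metis nonzero_mult_div_cancel_left of_nat_neq_0)
          with elim(1) show False by blast
        qed
        then have "of_int ?i < real (Suc k) * t" "real (Suc k) * t < of_int ?i + 1"
          by (linarith+)
        then show "t \<in> S i" unfolding S_def i by (simp add: field_simps del: of_nat_Suc)
      qed
      have "?i \<in> I" unfolding I_def using elim(2) by (auto intro!: floor_mono mult_left_mono)
      then have "(\<Sum>i\<in>I. g (of_int i / real (Suc k)) * (H t * indicator (S i) t))
          = (\<Sum>i\<in>I. if i = ?i then g (of_int i / real (Suc k)) * H t else 0)"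
        using S by (intro sum.cong) (auto simp: indicator_def)
      also have "\<dots> = H t * s k t"
        using \<open>?i \<in> I\<close> by (simp add: I_def s_def)
      finally show ?case by simp
    qed
    then have "(LINT t|J l r. H t * s k t)
        = (LINT t|J l r. (\<Sum>i\<in>I. g (of_int i / real (Suc k)) * (H t * indicator (S i) t)))"
      using sm bb_measurable[OF H] by (intro integral_cong_AE measurable_J) (auto simp: S_def)
    also have "\<dots> = (\<Sum>i\<in>I. g (of_int i / real (Suc k)) * (LINT t|J l r. H t * indicator (S i) t))"
      by (subst Bochner_Integration.integral_sum)
        (auto simp: S_def intro!: bb_integrable bb_intros H bb_indicator)
    also have "\<dots> \<le> 0"
      by (intro sum_nonpos mult_nonneg_nonpos g) (auto simp: S_def neg)
    finally show ?thesis .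
  qed
  ultimately show ?thesis by (rule LIMSEQ_upper_bound)
qed

text \<open>Fundamental lemma of the calculus of variations, for inequalities. Bumps approximate
  indicators of intervals, these yield continuous weights between 0 and 1, and these approximate
  indicators of Borel sets; the sign of an integrable function can be read off from its integrals
  over such sets.\<close>

lemma nonpos_AE:
  assumes H: "bb H" and lr: "l < r"
    and neg: "\<And>c d n. l < c \<Longrightarrow> c < d \<Longrightarrow> d < r \<Longrightarrow> (LINT t|J l r. H t * bump c d n t) \<le> 0"
  shows "AE t in J l r. H t \<le> 0"
proof -
  note Hm [measurable] = bb_measurable[OF H]
  obtain C where C: "\<And>x. \<bar>H x\<bar> \<le> C" "C \<ge> 0" using bb_bound[OF H] by metis
  have bm: "bump c d n \<in> borel_measurable borel" for c d n
    by (rule borel_measurable_continuous_onI) (rule smooth1_continuous_on[OF smooth1_bump])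
  have inner: "(LINT t|J l r. H t * indicator {c<..<d} t) \<le> 0" if "l < c" "d < r" for c d
  proof (cases "c < d")
    case True
    have "(\<lambda>n. LINT t|J l r. H t * bump c d n t) \<longlonglongrightarrow> (LINT t|J l r. H t * indicator {c<..<d} t)"
      using C bump_bounds bm
      by (intro J_dominated_convergence[where C = C])
        (auto intro!: tendsto_intros abs_mult_le bump_tendsto)
    then show ?thesis by (rule LIMSEQ_le_const2) (use neg[OF that(1) True that(2)] in auto)
  qed simp
  have neg': "(LINT t|J l r. H t * indicator {c<..<d} t) \<le> 0" for c d
  proof -
    \<comment> \<open>Bumps are only available strictly inside the interval, so intervals reaching
      the end points are exhausted by intervals at distance at least 1/(n+1) from \<open>l\<close>
      and \<open>r\<close>.\<close>
    define c' where "c' n = max c (l + 1 / real (Suc n))" for n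
    define d' where "d' n = min d (r - 1 / real (Suc n))" for n
    have "(\<lambda>n. indicator {c' n<..<d' n} t) \<longlonglongrightarrow> (indicator {c<..<d} t :: real)" if "l < t" "t < r" for t
    proof -
      have "(\<lambda>n. 1 / real (Suc n)) \<longlonglongrightarrow> 0" by (rule LIMSEQ_Suc) (rule lim_1_over_n)
      then have "\<forall>\<^sub>F n in sequentially. 1 / real (Suc n) < min (t - l) (r - t)"
        by (rule order_tendstoD) (use that in auto)
      then have "\<forall>\<^sub>F n in sequentially. (indicator {c<..<d} t :: real) = indicator {c' n<..<d' n} t"
        by eventually_elim (auto simp: c'_def d'_def indicator_def)
      then show ?thesis by (rule Lim_transform_eventually[OF tendsto_const])
    qed
    then have "(\<lambda>n. LINT t|J l r. H t * indicator {c' n<..<d' n} t)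
        \<longlonglongrightarrow> (LINT t|J l r. H t * indicator {c<..<d} t)"
      using C
      by (intro J_dominated_convergence[where C = C] AE_I2)
        (auto simp: space_J intro!: tendsto_mult tendsto_const abs_mult_le)
    then show ?thesis
      by (rule LIMSEQ_upper_bound) (rule inner, auto simp: c'_def d'_def less_max_iff_disj min_less_iff_disj)
  qed
  have "AE t in J l r. 0 \<le> - H t"
  proof (rule sigma_finite_measure.density_nonneg[OF sigma_finite_J])
    show "integrable (J l r) (\<lambda>x. - H x)" by (intro bb_integrable bb_intros H)
    fix A assume "A \<in> sets (J l r)"
    then have A: "A \<in> sets borel" by (auto simp: sets_restrict_space)
    obtain g where g: "\<And>n. continuous_on UNIV (g n)" "\<And>n x. 0 \<le> g n x \<and> g n x \<le> 1"
      "AE x in lborel. (\<lambda>n. g n x) \<longlonglongrightarrow> (indicator A x :: real)"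
    proof -
      have ind: "(indicator A :: real \<Rightarrow> real) \<in> borel_measurable borel" "0 \<le> (indicator A x :: real)" "indicator A x \<le> (1 :: real)" for x
        using A by auto
      have "\<exists>c. (\<forall>n. continuous_on UNIV (c n)) \<and> (\<forall>n x. 0 \<le> c n x \<and> c n x \<le> 1) \<and>
          (AE x in lborel. (\<lambda>n. c n x) \<longlonglongrightarrow> (indicator A x :: real))"
        by (rule continuous_approx[OF ind])
      then show ?thesis using that by blast
    qed
    have gm: "g n \<in> borel_measurable borel" for n
      by (rule borel_measurable_continuous_onI) (rule g(1))
    have "(\<lambda>n. LINT t|J l r. H t * g n t) \<longlonglongrightarrow> (LINT t|J l r. H t * indicator A t)"
    proof (rule J_dominated_convergence[where C = C])
      show "AE x in J l r. (\<lambda>n. H x * g n x) \<longlonglongrightarrow> H x * indicator A x"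
        using AE_J_I[OF g(3)] by eventually_elim (intro tendsto_intros)
    qed (use C g gm A in \<open>auto intro!: abs_mult_le\<close>)
    moreover have "(LINT t|J l r. H t * g n t) \<le> 0" for n
      using step_function_integral_nonpos[OF H lr neg' g(1)] g(2) by blast
    ultimately have "(LINT t|J l r. H t * indicator A t) \<le> 0" by (rule LIMSEQ_upper_bound)
    then show "0 \<le> set_lebesgue_integral (J l r) A (\<lambda>x. - H x)"
      by (simp add: set_lebesgue_integral_def mult.commute)
  qed
  then show ?thesis by simp
qed

lemma zero_AE:
  assumes H: "bb H" and lr: "l < r"
    and neg: "\<And>c d n. l < c \<Longrightarrow> c < d \<Longrightarrow> d < r \<Longrightarrow> (LINT t|J l r. H t * bump c d n t) = 0"
  shows "AE t in J l r. H t = 0"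
proof -
  have "AE t in J l r. H t \<le> 0" by (rule nonpos_AE[OF H lr]) (simp add: neg)
  moreover have "AE t in J l r. - H t \<le> 0" by (rule nonpos_AE[OF bb_minus[OF H] lr]) (simp add: neg)
  ultimately show ?thesis by eventually_elim simp
qed

section \<open>Primitives of bounded functions, integration by parts and Gronwall's
  inequality\<close>

definition prim :: "real \<Rightarrow> real \<Rightarrow> (real \<Rightarrow> real) \<Rightarrow> real \<Rightarrow> real" where
  "prim l r g t = (LINT s|J l r. indicator {..<t} s * g s)"

text \<open>The primitive is a parameter integral of a bounded Borel function of two variables, so
  its measurability in t is an instance of \<open>bb_integral\<close>. The indicator defines it for
  every real t, with constant values on either side of the interval.\<close>

lemma bb_prim:
  assumes "bb g"
  shows "bb (prim l r g)"
proof -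
  have o: "open {z::real \<times> real. snd z < fst z}" by (intro open_Collect_less continuous_intros)
  have "bb (\<lambda>z::real \<times> real. indicator {z. snd z < fst z} z * g (snd z))"
    using o by (intro bb_mult bb_indicator bb_snd assms) auto
  from bb_integral[OF this, of l r] show ?thesis
    by (simp add: prim_def[abs_def] indicator_def)
qed

lemma bb_cut: "bb g \<Longrightarrow> bb (\<lambda>s. indicator {..<t::real} s * g s)"
  by (intro bb_mult bb_indicator) auto

lemma prim_end: "prim l r g r = (LINT s|J l r. g s)"
  unfolding prim_def by (rule Bochner_Integration.integral_cong) (auto simp: space_J)

lemma prim_J: "t \<le> r \<Longrightarrow> prim l r g t = (LINT s|J l t. g s)"
  unfolding prim_def J_integral_lborel
  by (rule Bochner_Integration.integral_cong) (auto simp: indicator_def)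

lemma prim_add: "bb f \<Longrightarrow> bb g \<Longrightarrow> prim l r (\<lambda>s. f s + g s) t = prim l r f t + prim l r g t"
  unfolding prim_def
  by (subst Bochner_Integration.integral_add[symmetric])
    (auto intro!: bb_integrable bb_cut simp: distrib_left)

lemma prim_cmult: "prim l r (\<lambda>s. c * g s) t = c * prim l r g t"
  unfolding prim_def by (simp add: mult.left_commute)

lemma prim_diff: "bb f \<Longrightarrow> bb g \<Longrightarrow> prim l r (\<lambda>s. f s - g s) t = prim l r f t - prim l r g t"
  using prim_add[of f "\<lambda>s. (-1) * g s" l r t] prim_cmult[of l r "-1" g t] bb_minus[of g] by simp

lemma prim_sum:
  "(\<And>i. i \<in> A \<Longrightarrow> bb (f i)) \<Longrightarrow> prim l r (\<lambda>s. \<Sum>i\<in>A. f i s) t = (\<Sum>i\<in>A. prim l r (f i) t)"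
proof (induction A rule: infinite_finite_induct)
  case (insert x F)
  then show ?case using prim_add[of "f x" "\<lambda>s. \<Sum>i\<in>F. f i s" l r t] by (auto intro: bb_sum)
qed (auto simp: prim_def)

lemma prim_mono_AE:
  assumes "bb f" "bb g" "AE s in J l r. f s \<le> g s"
  shows "prim l r f t \<le> prim l r g t"
  unfolding prim_def
  by (rule integral_mono_AE) (use assms in \<open>auto intro!: bb_integrable bb_cut mult_left_mono elim!: eventually_mono\<close>)

lemma prim_cong_AE:
  assumes "bb f" "bb g" "AE s in J l r. f s = g s"
  shows "prim l r f t = prim l r g t"
proof (rule antisym)
  show "prim l r f t \<le> prim l r g t"
    by (rule prim_mono_AE[OF assms(1,2)]) (use assms(3) in \<open>auto elim!: eventually_mono\<close>)
  show "prim l r g t \<le> prim l r f t"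
    by (rule prim_mono_AE[OF assms(2,1)]) (use assms(3) in \<open>auto elim!: eventually_mono\<close>)
qed

text \<open>For merely bounded factors, integration by parts is Fubini on a square split along its
  diagonal into the two triangles where one integration variable is below the other.\<close>

lemma prim_parts:
  assumes f: "bb f" and g: "bb g"
  shows "prim l r f t * prim l r g t = prim l r (\<lambda>s. f s * prim l r g s + prim l r f s * g s) t"
proof -
  have half: "(LINT s|J l r. LINT v|J l r. indicator {..<t} s * f s * (indicator {..<t} v * g v) * indicator {..<s} v)
      = prim l r (\<lambda>s. f s * prim l r g s) t" for f g :: "real \<Rightarrow> real"
  proof -
    have "(LINT v|J l r. indicator {..<t} s * f s * (indicator {..<t} v * g v) * indicator {..<s} v)
        = indicator {..<t} s * (f s * prim l r g s)" for s
    proof -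
      have "(LINT v|J l r. indicator {..<t} s * f s * (indicator {..<t} v * g v) * indicator {..<s} v)
        = (LINT v|J l r. (indicator {..<t} s * f s) * (indicator {..<s} v * g v))"
        by (rule Bochner_Integration.integral_cong) (auto simp: indicator_def)
      then show ?thesis by (simp add: prim_def)
    qed
    then show ?thesis by (simp add: prim_def)
  qed
  have o: "open {z::real \<times> real. snd z < fst z}" "open {z::real \<times> real. fst z < snd z}"
    by (intro open_Collect_less continuous_intros)+
  let ?h = "\<lambda>z. indicator {..<t} (fst z) * f (fst z) * (indicator {..<t} (snd z) * g (snd z))"
  have bh: "bb ?h"
    using bb_fst[OF bb_cut[OF f, of t]] bb_snd[OF bb_cut[OF g, of t]] by (rule bb_mult)
  have b1: "bb (\<lambda>z. ?h z * indicator {z. snd z < fst z} z)" "bb (\<lambda>z. ?h z * indicator {z. fst z < snd z} z)"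
    by (rule bb_mult[OF bh bb_indicator[OF borel_open[OF o(1)]]] bb_mult[OF bh bb_indicator[OF borel_open[OF o(2)]]])+
  have "prim l r f t * prim l r g t = (LINT s|J l r. LINT v|J l r. ?h (s, v))"
    by (simp add: prim_def)
  also have "\<dots> = (LINT s|J l r. (LINT v|J l r. ?h (s, v) * indicator {z. snd z < fst z} (s, v))
        + (LINT v|J l r. ?h (s, v) * indicator {z. fst z < snd z} (s, v)))"
  proof (rule Bochner_Integration.integral_cong[OF refl])
    fix s
    have "(LINT v|J l r. ?h (s, v))
        = (LINT v|J l r. ?h (s, v) * indicator {z. snd z < fst z} (s, v) + ?h (s, v) * indicator {z. fst z < snd z} (s, v))"
    proof (intro integral_cong_AE measurable_J bb_measurable bb_add bb_slice[OF bh]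
        bb_slice[OF b1(1)] bb_slice[OF b1(2)])
      \<comment> \<open>The diagonal meets each slice in a single point, which is a null
        set.\<close>
      show "AE v in J l r. ?h (s, v)
          = ?h (s, v) * indicator {z. snd z < fst z} (s, v) + ?h (s, v) * indicator {z. fst z < snd z} (s, v)"
        using AE_J_neq[where c = s] by eventually_elim (auto simp: indicator_def)
    qed
    then show "(LINT v|J l r. ?h (s, v)) = (LINT v|J l r. ?h (s, v) * indicator {z. snd z < fst z} (s, v))
        + (LINT v|J l r. ?h (s, v) * indicator {z. fst z < snd z} (s, v))"
      by (simp only: Bochner_Integration.integral_add[OF bb_integrable[OF bb_slice[OF b1(1)]] bb_integrable[OF bb_slice[OF b1(2)]]])
  qed
  also have "\<dots> = (LINT s|J l r. LINT v|J l r. ?h (s, v) * indicator {z. snd z < fst z} (s, v))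
       + (LINT s|J l r. LINT v|J l r. ?h (s, v) * indicator {z. fst z < snd z} (s, v))"
    by (intro Bochner_Integration.integral_add bb_integrable bb_integral b1)
  also have "(LINT s|J l r. LINT v|J l r. ?h (s, v) * indicator {z. snd z < fst z} (s, v))
      = prim l r (\<lambda>s. f s * prim l r g s) t"
    unfolding half[symmetric] by (simp add: indicator_def)
  also have "(LINT s|J l r. LINT v|J l r. ?h (s, v) * indicator {z. fst z < snd z} (s, v))
      = (LINT v|J l r. LINT s|J l r. ?h (s, v) * indicator {z. fst z < snd z} (s, v))"
    by (rule bb_Fubini[OF b1(2), symmetric])
  also have "\<dots> = prim l r (\<lambda>s. g s * prim l r f s) t"
    unfolding half[symmetric] by (simp add: indicator_def mult.commute mult.left_commute)
  also have "prim l r (\<lambda>s. f s * prim l r g s) t + prim l r (\<lambda>s. g s * prim l r f s) t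
      = prim l r (\<lambda>s. f s * prim l r g s + prim l r f s * g s) t"
    by (subst prim_add[symmetric]) (auto intro!: bb_mult f g bb_prim simp: mult.commute)
  finally show ?thesis .
qed

text \<open>Agreement of \<open>g\<close> with the derivative is asked only inside the interval;
  thus \<open>g\<close> may be a bounded cut-off of a derivative that is unbounded on the
  line.\<close>

lemma prim_FTC:
  assumes "l \<le> t" "t \<le> r"
    and D: "\<And>x. (F has_real_derivative f x) (at x)" and c: "continuous_on UNIV f"
    and eq: "\<And>x. l < x \<Longrightarrow> x < r \<Longrightarrow> g x = f x"
  shows "F t = F l + prim l r g t"
proof -
  have "prim l r g t = (LINT s|J l t. f s)"
    unfolding prim_J[OF assms(2)]
    by (rule Bochner_Integration.integral_cong) (use eq assms in \<open>auto simp: space_J\<close>)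
  also have "\<dots> = (LINT s|lborel. f s * indicator {l..t} s)"
    unfolding J_integral_lborel
  proof (rule integral_cong_AE)
    have [measurable]: "f \<in> borel_measurable borel" using c by (rule borel_measurable_continuous_onI)
    show "(\<lambda>s. indicator {l<..<t} s * f s) \<in> borel_measurable lborel" by measurable
    show "(\<lambda>s. f s * indicator {l..t} s) \<in> borel_measurable lborel" by measurable
    show "AE x in lborel. indicator {l<..<t} x * f x = f x * indicator {l..t} x"
      using AE_lborel_singleton[of l] AE_lborel_singleton[of t]
      by eventually_elim (auto simp: indicator_def)
  qed
  also have "\<dots> = F t - F l"
    using c by (intro integral_FTC_Icc_real D assms) (auto simp: continuous_on_eq_continuous_at)
  finally show ?thesis by simp
qed

text \<open>The inequality holds only almost everywhere and \<open>E\<close> is only bounded and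
  measurable, so the integrating factor is applied to the primitive of \<open>E\<close>, with
  \<open>prim_parts\<close> as product rule. This bounds the primitive by
  \<open>A * (r - l) * exp (K * (r - l))\<close>; inserting that into the hypothesis gives the
  stated constant, which is larger than the usual exponential.\<close>

lemma gronwall_AE:
  assumes lr: "l \<le> r" and E: "bb E" and K: "0 \<le> K" and A: "0 \<le> A"
    and le: "AE t in J l r. E t \<le> A + K * prim l r E t"
  shows "AE t in J l r. E t \<le> A * (1 + K * (r - l) * exp (K * (r - l)))"
proof -
  define w where "w t = exp (- K * (t - l))" for t
  \<comment> \<open>The derivative of the integrating factor \<open>w\<close> on the interval;
    \<open>max l s\<close> keeps it bounded to the left of \<open>l\<close>.\<close>
  define b where "b s = - K * exp (- K * (max l s - l))" for s
  have bb_b: "bb b"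
  proof (rule bbI[of _ K])
    show "b \<in> borel_measurable borel" unfolding b_def by measurable
    show "\<bar>b x\<bar> \<le> K" for x using K by (auto simp: b_def abs_mult intro!: mult_left_le)
  qed
  have w: "w t = 1 + prim l r b t" if "l \<le> t" "t \<le> r" for t
  proof -
    have "w t = w l + prim l r b t"
      by (rule prim_FTC[where f = "\<lambda>x. - K * w x"])
        (use that in \<open>auto simp: w_def b_def max_def intro!: derivative_eq_intros continuous_intros\<close>)
    then show ?thesis by (simp add: w_def)
  qed
  note bbs = bb_add bb_mult bb_const bb_diff E bb_b bb_prim
  have y: "prim l r E t \<le> A * (r - l) * exp (K * (r - l))" if t: "l < t" "t < r" for t
  proof -
    have "w t * prim l r E t = prim l r E t + prim l r E t * prim l r b t"
      using w[of t] t by (simp add: algebra_simps)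
    also have "\<dots> = prim l r (\<lambda>s. E s + (E s * prim l r b s + prim l r E s * b s)) t"
      unfolding prim_parts[OF E bb_b] by (rule prim_add[symmetric]) (intro bbs)+
    also have "\<dots> \<le> prim l r (\<lambda>s. A) t"
    proof (rule prim_mono_AE)
      have "AE s in J l r. l < s \<and> s < r" by (rule AE_I2) (simp add: space_J)
      then show "AE s in J l r. E s + (E s * prim l r b s + prim l r E s * b s) \<le> A"
        using le
      proof eventually_elim
        case (elim s)
        have "b s = - K * w s" using elim by (simp add: b_def w_def)
        then have "E s + (E s * prim l r b s + prim l r E s * b s) = w s * (E s - K * prim l r E s)"
        proof -
          have "w s = 1 + prim l r b s" using w elim by simp
          then show ?thesis using \<open>b s = - K * w s\<close> by algebra
        qed
        also have "\<dots> \<le> w s * A" using elim by (intro mult_left_mono) (auto simp: w_def)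
        also have "\<dots> \<le> A" using A K elim by (intro mult_left_le_one_le) (auto simp: w_def)
        finally show ?case .
      qed
    qed (intro bbs)+
    also have "\<dots> \<le> A * (r - l)"
    proof -
      have "prim l r (\<lambda>s. A) t \<le> prim l r (\<lambda>s. A) r"
        unfolding prim_def
        by (rule integral_mono[OF bb_integrable[OF bb_cut[OF bb_const]] bb_integrable[OF bb_cut[OF bb_const]]])
          (use t A in \<open>auto simp: indicator_def\<close>)
      also have "\<dots> = A * (r - l)"
        unfolding prim_end using lr by (simp add: space_J measure_J)
      finally show ?thesis .
    qed
    finally have "w t * prim l r E t \<le> A * (r - l)" .
    then have "exp (K * (t - l)) * (w t * prim l r E t) \<le> exp (K * (t - l)) * (A * (r - l))"
      by (intro mult_left_mono) auto
    moreover have "exp (K * (t - l)) * (w t * prim l r E t) = prim l r E t"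
      by (simp add: w_def exp_minus)
    ultimately have "prim l r E t \<le> A * (r - l) * exp (K * (t - l))"
      by (simp add: mult.commute)
    also have "\<dots> \<le> A * (r - l) * exp (K * (r - l))"
      using t A lr K by (intro mult_left_mono) (auto intro!: mult_left_mono)
    finally show ?thesis .
  qed
  have "AE s in J l r. l < s \<and> s < r" by (rule AE_I2) (simp add: space_J)
  then show ?thesis using le
  proof eventually_elim
    case (elim t)
    then have "E t \<le> A + K * (A * (r - l) * exp (K * (r - l)))"
      using mult_left_mono[OF y K, of t] by linarith
    then show ?case by (simp add: algebra_simps)
  qed
qed

section \<open>From weak statements in time to statements at almost every time\<close>

lemma bump_primitive:
  assumes "c < d" "n > 0"
  obtains Q where "smooth1 Q" "\<And>x. (Q has_real_derivative bump c d n x) (at x)"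
    "\<And>x. x \<le> c \<Longrightarrow> Q x = 0" "\<And>x. d \<le> x \<Longrightarrow> Q x = Q d" "\<And>x. 0 \<le> Q x" "\<And>x. Q x \<le> Q d" "Q d > 0"
proof -
  have "isCont (bump c d n) x" for x
    using smooth1_deriv[OF smooth1_bump] DERIV_isCont by blast
  then obtain P where "\<And>x. (P has_vector_derivative bump c d n x) (at x)"
    using einterval_antiderivative[of "-\<infinity>" "\<infinity>" "bump c d n"] by auto
  then have P: "(P has_real_derivative bump c d n x) (at x)" for x
    by (simp add: has_real_derivative_iff_has_vector_derivative)
  have mono: "P x \<le> P y" if "x \<le> y" for x y
    by (rule DERIV_nonneg_imp_nondecreasing[OF that]) (use P bump_bounds in blast)
  have const: "P x = P y" if xy: "x < y" and "y \<le> c \<or> d \<le> x" for x y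
  proof -
    have "P y - P x = (y - x) * 0"
    proof -
      obtain z where "x < z" "z < y" "P y - P x = (y - x) * bump c d n z"
        using MVT2[OF xy, of P "bump c d n"] P by auto
      then show ?thesis using bump_zero[of z c d n] \<open>y \<le> c \<or> d \<le> x\<close> by auto
    qed
    then show ?thesis by simp
  qed
  have pos: "P c < P d"
  proof -
    obtain z where z: "c < z" "z < d" "P d - P c = (d - c) * bump c d n z"
      using MVT2[OF assms(1), of P "bump c d n"] P by auto
    then have "bump c d n z > 0" using assms by (auto simp: bump_def flat_exp_def)
    then have "(d - c) * bump c d n z > 0" using assms by simp
    then show ?thesis using z(3) by linarith
  qed
  have smooth: "smooth1 (\<lambda>x. P x - P c)"
    by (rule smooth1_antideriv[OF _ smooth1_bump]) (rule derivative_eq_intros P refl | simp)+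
  show ?thesis
  proof (rule that[of "\<lambda>x. P x - P c"])
    show "((\<lambda>x. P x - P c) has_real_derivative bump c d n x) (at x)" for x
      by (rule derivative_eq_intros P refl | simp)+
    show "P x - P c = 0" if "x \<le> c" for x using const[of x c] that by (cases "x = c") auto
    show e: "P x - P c = P d - P c" if "d \<le> x" for x using const[of d x] that by (cases "x = d") auto
    show "0 \<le> P x - P c" for x
      using const[of x c] mono[of c x] by (cases "x < c") auto
    show "P x - P c \<le> P d - P c" for x
      using e[of x] mono[of x d] by (cases "x < d") auto
    show "P d - P c > 0" using pos by simp
  qed (fact smooth)
qed

lemma bb_bump: "bb (bump c d n)"
proof (rule bbI[of _ 1])
  show "bump c d n \<in> borel_measurable borel"
    by (rule borel_measurable_continuous_onI) (rule smooth1_continuous_on[OF smooth1_bump])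
qed (use bump_bounds in \<open>auto simp: abs_le_iff intro: order_trans[of _ 0]\<close>)

lemma bump_at_0: "bump c d 0 = (\<lambda>t. 0)"
  by (auto simp: bump_def flat_exp_def)

text \<open>If Q is the primitive of a bump, then \<open>Q d - Q\<close> is an admissible test:
  nonnegative, zero near the final time, with derivative minus the bump. Integration by parts then
  shows that \<open>A - A0 - prim l r B\<close> has a nonpositive integral against every
  bump.\<close>

lemma weak_upper_bound:
  assumes A: "bb A" and B: "bb B" and lr: "l < r"
    and weak: "\<And>\<theta> \<theta>' s. smooth1 \<theta> \<Longrightarrow> bb \<theta> \<Longrightarrow> (\<And>x. (\<theta> has_real_derivative \<theta>' x) (at x)) \<Longrightarrow> bb \<theta>' \<Longrightarrow>
      (\<And>t. \<theta> t \<ge> 0) \<Longrightarrow> s < r \<Longrightarrow> (\<And>t. t \<ge> s \<Longrightarrow> \<theta> t = 0) \<Longrightarrow>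
      (LINT t|J l r. A t * \<theta>' t + B t * \<theta> t) + A0 * \<theta> l \<ge> 0"
  shows "AE t in J l r. A t \<le> A0 + prim l r B t"
proof -
  define H where "H t = A t - A0 - prim l r B t" for t
  have bbH: "bb H" unfolding H_def by (intro bb_diff A bb_const bb_prim B)
  have "AE t in J l r. H t \<le> 0"
  proof (rule nonpos_AE[OF bbH lr])
    fix c d n assume cd: "l < c" "c < d" "d < r"
    show "(LINT t|J l r. H t * bump c d n t) \<le> 0"
    proof (cases "n = 0")
      case False
      then have n: "n > 0" by simp
      obtain Q where Q: "smooth1 Q" "\<And>x. (Q has_real_derivative bump c d n x) (at x)"
        "\<And>x. x \<le> c \<Longrightarrow> Q x = 0" "\<And>x. d \<le> x \<Longrightarrow> Q x = Q d" "\<And>x. 0 \<le> Q x" "\<And>x. Q x \<le> Q d"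
        by (rule bump_primitive[OF cd(2) n]) (rule that; assumption)
      define \<theta> where "\<theta> t = Q d - Q t" for t
      let ?\<theta>' = "\<lambda>t. - bump c d n t"
      have s: "smooth1 \<theta>" unfolding \<theta>_def by (intro smooth1_diff smooth1_const Q)
      have D: "(\<theta> has_real_derivative ?\<theta>' x) (at x)" for x
        unfolding \<theta>_def by (rule derivative_eq_intros Q(2) refl | simp)+
      have b\<theta>: "bb \<theta>"
        by (rule bbI[of _ "Q d"])
          (use Q(5,6) in \<open>auto simp: \<theta>_def abs_le_iff intro!: borel_measurable_diff borel_measurable_continuous_onI
            continuous_on_diff continuous_on_const smooth1_continuous_on[OF Q(1)] add_increasing\<close>)
      have b\<theta>': "bb ?\<theta>'" by (intro bb_minus bb_bump)
      have \<theta>: "\<theta> t = \<theta> l + prim l r ?\<theta>' t" if "l \<le> t" "t \<le> r" for t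
        by (rule prim_FTC[OF that D])
          (auto intro!: continuous_on_minus smooth1_continuous_on[OF smooth1_bump])
      have "\<theta> r = 0" using Q(4)[of r] cd by (simp add: \<theta>_def)
      have 1: "(LINT t|J l r. A t * ?\<theta>' t + B t * \<theta> t) + A0 * \<theta> l \<ge> 0"
      proof (rule weak[OF s b\<theta> D b\<theta>', of d])
        show "0 \<le> \<theta> t" for t using Q(6)[of t] by (simp add: \<theta>_def)
        show "\<theta> t = 0" if "d \<le> t" for t using Q(4)[OF that] by (simp add: \<theta>_def)
      qed (use cd in auto)
      \<comment> \<open>Integration by parts of the primitive of \<open>B\<close> against \<theta>;
        there is no boundary term, since the primitive vanishes at \<open>l\<close> and \<theta>
        vanishes at \<open>r\<close>.\<close>
      have "0 = prim l r B r * \<theta> r" using \<open>\<theta> r = 0\<close> by simp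
      also have "\<dots> = \<theta> l * prim l r B r + prim l r B r * prim l r ?\<theta>' r"
      proof -
        have "\<theta> r = \<theta> l + prim l r ?\<theta>' r" using \<theta>[of r] lr by simp
        then show ?thesis by algebra
      qed
      also have "\<dots> = prim l r (\<lambda>s. \<theta> l * B s + (B s * prim l r ?\<theta>' s + prim l r B s * ?\<theta>' s)) r"
        unfolding prim_parts[OF B b\<theta>']
        by (subst prim_add) (auto intro!: bb_intros B bb_prim bb_bump simp: prim_cmult)
      also have "\<dots> = (LINT s|J l r. B s * \<theta> s + prim l r B s * ?\<theta>' s)"
        unfolding prim_end
      proof (rule Bochner_Integration.integral_cong[OF refl])
        fix s assume "s \<in> space (J l r)"
        then have "\<theta> s = \<theta> l + prim l r ?\<theta>' s" by (intro \<theta>) (auto simp: space_J)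
        then show "\<theta> l * B s + (B s * prim l r ?\<theta>' s + prim l r B s * ?\<theta>' s)
            = B s * \<theta> s + prim l r B s * ?\<theta>' s"
          by algebra
      qed
      finally have 2: "0 = (LINT s|J l r. B s * \<theta> s + prim l r B s * ?\<theta>' s)" .
      have "0 = \<theta> l + prim l r ?\<theta>' r" using \<theta>[of r] lr \<open>\<theta> r = 0\<close> by simp
      then have 3: "(LINT s|J l r. ?\<theta>' s) = - \<theta> l" by (simp only: prim_end)
      have "(LINT t|J l r. H t * ?\<theta>' t)
          = (LINT t|J l r. (A t * ?\<theta>' t + B t * \<theta> t) - A0 * ?\<theta>' t - (B t * \<theta> t + prim l r B t * ?\<theta>' t))"
        by (rule Bochner_Integration.integral_cong) (auto simp: H_def algebra_simps)
      also have "\<dots> = (LINT t|J l r. A t * ?\<theta>' t + B t * \<theta> t) - A0 * (LINT t|J l r. ?\<theta>' t)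
          - (LINT s|J l r. B s * \<theta> s + prim l r B s * ?\<theta>' s)"
        by (simp add: Bochner_Integration.integral_diff bb_integrable bb_add bb_mult bb_diff bb_const bb_minus
            A B b\<theta> bb_bump bb_prim)
      also have "\<dots> \<ge> 0" using 1 2 3 by simp
      finally show ?thesis by simp
    qed (simp add: bump_at_0)
  qed
  then show ?thesis by (auto simp: H_def elim!: eventually_mono)
qed

text \<open>Du Bois-Reymond's lemma. Tests vanish near both ends, so their derivatives have mean
  zero. Subtracting a multiple of one fixed bump turns an arbitrary bump into such a derivative, and
  the fixed bump determines the constant.\<close>

lemma weak_derivative_imp_prim:
  assumes A: "bb A" and B: "bb B" and lr: "l < r"
    and weak: "\<And>\<theta> \<theta>' s s'. smooth1 \<theta> \<Longrightarrow> bb \<theta> \<Longrightarrow> (\<And>x. (\<theta> has_real_derivative \<theta>' x) (at x)) \<Longrightarrow> bb \<theta>' \<Longrightarrow>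
      l < s \<Longrightarrow> s' < r \<Longrightarrow> (\<And>t. t \<le> s \<or> t \<ge> s' \<Longrightarrow> \<theta> t = 0) \<Longrightarrow>
      (LINT t|J l r. A t * \<theta>' t) = - (LINT t|J l r. B t * \<theta> t)"
  shows "\<exists>c. AE t in J l r. A t = c + prim l r B t"
proof -
  define H where "H t = A t - prim l r B t" for t
  have bbH: "bb H" unfolding H_def by (intro bb_diff A bb_prim B)
  define c0 d0 where "c0 = (3 * l + r) / 4" and "d0 = (l + 3 * r) / 4"
  have c0: "l < c0" "c0 < d0" "d0 < r" using lr by (auto simp: c0_def d0_def)
  obtain R where R: "smooth1 R" "\<And>x. (R has_real_derivative bump c0 d0 1 x) (at x)"
    "\<And>x. x \<le> c0 \<Longrightarrow> R x = 0" "\<And>x. d0 \<le> x \<Longrightarrow> R x = R d0" "\<And>x. 0 \<le> R x" "\<And>x. R x \<le> R d0" "R d0 > 0"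
    by (rule bump_primitive[OF c0(2) zero_less_one]) (rule that; assumption)
  \<comment> \<open>The average of \<open>H\<close> weighted by the fixed bump, whose mass is
    \<open>R d0\<close>; it becomes the constant of integration.\<close>
  define \<kappa> where "\<kappa> = (LINT t|J l r. H t * bump c0 d0 1 t) / R d0"
  have "AE t in J l r. H t - \<kappa> = 0"
  proof (rule zero_AE[OF _ lr])
    show "bb (\<lambda>t. H t - \<kappa>)" by (intro bb_diff bbH bb_const)
    fix c d n assume cd: "l < c" "c < d" "d < r"
    show "(LINT t|J l r. (H t - \<kappa>) * bump c d n t) = 0"
    proof (cases "n = 0")
      case False
      then have n: "n > 0" by simp
      obtain Q where Q: "smooth1 Q" "\<And>x. (Q has_real_derivative bump c d n x) (at x)"
        "\<And>x. x \<le> c \<Longrightarrow> Q x = 0" "\<And>x. d \<le> x \<Longrightarrow> Q x = Q d" "\<And>x. 0 \<le> Q x" "\<And>x. Q x \<le> Q d"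
        by (rule bump_primitive[OF cd(2) n]) (rule that; assumption)
      \<comment> \<open>The two bumps have masses \<open>Q d\<close> and \<open>R d0\<close>; this
        combination has total mass zero in its derivative, so \<theta> vanishes to the right of both
        supports.\<close>
      define \<theta> where "\<theta> t = R d0 * Q t - Q d * R t" for t
      define \<theta>' where "\<theta>' t = R d0 * bump c d n t - Q d * bump c0 d0 1 t" for t
      have s: "smooth1 \<theta>" unfolding \<theta>_def by (intro smooth1_diff smooth1_cmult Q R)
      have D: "(\<theta> has_real_derivative \<theta>' x) (at x)" for x
        unfolding \<theta>_def \<theta>'_def by (rule derivative_eq_intros Q(2) R(2) refl | simp)+
      have bQ: "bb Q" "bb R"
        by (rule bbI[of _ "Q d"] bbI[of _ "R d0"],
            use Q(5,6) R(5,6) in \<open>auto intro!: borel_measurable_continuous_onI smooth1_continuous_on Q(1) R(1)\<close>)+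
      have b\<theta>: "bb \<theta>" unfolding \<theta>_def by (intro bb_intros bQ)
      have b\<theta>': "bb \<theta>'" unfolding \<theta>'_def by (intro bb_intros bb_bump)
      have z: "\<theta> t = 0" if "t \<le> min c c0 \<or> max d d0 \<le> t" for t
        using that Q(3)[of t] Q(4)[of t] R(3)[of t] R(4)[of t] by (auto simp: \<theta>_def)
      have cont: "continuous_on UNIV \<theta>'"
        unfolding \<theta>'_def by (intro continuous_intros smooth1_continuous_on smooth1_bump)
      have \<theta>: "\<theta> t = prim l r \<theta>' t" if "l \<le> t" "t \<le> r" for t
        using prim_FTC[OF that D cont, of \<theta>'] z[of l] cd c0 by simp
      have 1: "(LINT t|J l r. A t * \<theta>' t) = - (LINT t|J l r. B t * \<theta> t)"
        by (rule weak[OF s b\<theta> D b\<theta>', of "min c c0" "max d d0"]) (use cd c0 z in auto)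
      have "0 = prim l r B r * prim l r \<theta>' r" using \<theta>[of r] z[of r] cd c0 lr by simp
      also have "\<dots> = (LINT s|J l r. B s * \<theta> s + prim l r B s * \<theta>' s)"
        unfolding prim_parts[OF B b\<theta>'] prim_end[of l r "\<lambda>s. B s * prim l r \<theta>' s + prim l r B s * \<theta>' s"]
        by (rule Bochner_Integration.integral_cong) (use \<theta> in \<open>auto simp: space_J\<close>)
      also have "\<dots> = (LINT s|J l r. B s * \<theta> s) + (LINT s|J l r. prim l r B s * \<theta>' s)"
        by (intro Bochner_Integration.integral_add bb_integrable bb_intros B b\<theta> b\<theta>' bb_prim)
      finally have 2: "(LINT s|J l r. prim l r B s * \<theta>' s) = - (LINT s|J l r. B s * \<theta> s)" by simp
      have "(LINT t|J l r. H t * \<theta>' t) = (LINT t|J l r. A t * \<theta>' t) - (LINT s|J l r. prim l r B s * \<theta>' s)"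
        unfolding H_def left_diff_distrib
        by (intro Bochner_Integration.integral_diff bb_integrable bb_intros A B b\<theta> b\<theta>' bb_prim)
      then have "(LINT t|J l r. H t * \<theta>' t) = 0" using 1 2 by simp
      moreover have "(LINT t|J l r. H t * \<theta>' t)
          = (LINT t|J l r. R d0 * (H t * bump c d n t) - Q d * (H t * bump c0 d0 1 t))"
        by (rule Bochner_Integration.integral_cong) (auto simp: \<theta>'_def algebra_simps)
      moreover have "\<dots> = R d0 * (LINT t|J l r. H t * bump c d n t) - Q d * (LINT t|J l r. H t * bump c0 d0 1 t)"
        by (simp add: Bochner_Integration.integral_diff bb_integrable bb_mult bb_const bbH bb_bump)
      ultimately have 3: "R d0 * (LINT t|J l r. H t * bump c d n t) = Q d * (\<kappa> * R d0)"
        using R(7) by (simp add: \<kappa>_def)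
      have "Q r = Q l + prim l r (bump c d n) r"
        by (rule prim_FTC[OF _ _ Q(2)]) (use lr in \<open>auto intro!: smooth1_continuous_on smooth1_bump\<close>)
      then have 4: "(LINT t|J l r. bump c d n t) = Q d"
        using Q(3)[of l] Q(4)[of r] cd by (simp add: prim_end)
      have "(LINT t|J l r. (H t - \<kappa>) * bump c d n t)
          = (LINT t|J l r. H t * bump c d n t) - \<kappa> * (LINT t|J l r. bump c d n t)"
        unfolding left_diff_distrib
        by (simp add: Bochner_Integration.integral_diff bb_integrable bb_mult bb_const bbH bb_bump)
      also have "\<dots> = 0" using 3 4 R(7) by (simp add: field_simps)
      finally show ?thesis .
    qed (simp add: bump_at_0)
  qed
  then show ?thesis by (intro exI[of _ \<kappa>]) (auto simp: H_def elim!: eventually_mono)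
qed

section \<open>Trigonometric kernels on the circle\<close>

lemma LIMSEQ_abs_diff_bound:
  fixes X :: "nat \<Rightarrow> real"
  assumes "\<And>n. \<bar>X n - x\<bar> \<le> Y n" "Y \<longlonglongrightarrow> 0"
  shows "X \<longlonglongrightarrow> x"
proof -
  have "(\<lambda>n. X n - x) \<longlonglongrightarrow> 0"
    by (rule Lim_null_comparison[OF _ assms(2)]) (simp add: assms(1))
  then show ?thesis by (rule LIM_zero_cancel)
qed

locale circle =
  fixes a b :: real
  assumes a_less_b: "a < b"
begin

definition w :: real where "w = 2 * pi / (b - a)"

text \<open>
  The real Fourier system \<open>cos + sin\<close> has one function for each integer frequency, and
  differentiation maps the function of frequency \<open>k\<close> to a multiple of that of frequency \<open>-k\<close>.
\<close>
definition e :: "int \<Rightarrow> real \<Rightarrow> real" where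
  "e k x = cos (of_int k * w * x) + sin (of_int k * w * x)"

definition ip :: "(real \<Rightarrow> real) \<Rightarrow> (real \<Rightarrow> real) \<Rightarrow> real" where
  "ip g h = (LINT x|J a b. g x * h x)"

lemma w_pos: "w > 0"
  using a_less_b by (simp add: w_def)

lemma w_period: "w * (b - a) = 2 * pi"
  using a_less_b by (simp add: w_def)

lemma e_deriv: "(e k has_real_derivative of_int k * w * e (- k) x) (at x)"
  unfolding e_def by (auto intro!: derivative_eq_intros simp: algebra_simps)

lemma e_smooth: "smooth1 (e k)"
proof (rule smooth1_closed_family[of _ "{\<lambda>x. c * e k x |c k. True}"])
  show "e k \<in> {\<lambda>x. c * e k x |c k. True}" by (auto intro!: exI[of _ 1] exI[of _ k])
next
  fix g assume "g \<in> {\<lambda>x. c * e k x |c k. True}"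
  then obtain c k where g: "g = (\<lambda>x. c * e k x)" by auto
  have "(g has_real_derivative (c * (of_int k * w)) * e (- k) x) (at x)" for x
    unfolding g using DERIV_cmult[OF e_deriv, of c k x] by (simp add: mult.assoc)
  then show "\<exists>g'\<in>{\<lambda>x. c * e k x |c k. True}. \<forall>x. (g has_real_derivative g' x) (at x)"
    by (intro bexI[of _ "\<lambda>x. (c * (of_int k * w)) * e (- k) x"]) auto
qed

lemma deriv_e: "deriv (e k) = (\<lambda>x. of_int k * w * e (- k) x)"
  using e_deriv by (auto intro: DERIV_imp_deriv)

lemma e_periodic: "e k (x + (b - a)) = e k x"
proof -
  have "of_int k * w * (x + (b - a)) = of_int k * w * x + of_int k * (2 * pi)"
    unfolding w_period[symmetric] by (simp add: algebra_simps)
  moreover have "cos (of_int k * (2 * pi)) = 1" "sin (of_int k * (2 * pi)) = 0"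
    using cos_int_2pin[of k] sin_int_2pin[of k] by (simp_all add: mult.commute mult.left_commute)
  ultimately show ?thesis by (simp add: e_def cos_add sin_add)
qed

lemma e_bound: "\<bar>e k x\<bar> \<le> 2"
proof -
  have "\<bar>cos (of_int k * w * x)\<bar> \<le> 1" "\<bar>sin (of_int k * w * x)\<bar> \<le> 1" by simp_all
  then show ?thesis unfolding e_def by linarith
qed

lemma bb_e: "bb (e k)"
  by (rule bbI[OF borel_measurable_continuous_onI e_bound]) (rule smooth1_continuous_on[OF e_smooth])

text \<open>A single product \<open>e k x * e k y\<close> is in general not a function of x - y, but
  the sum over a frequency and its negative is. Hence weights that are even in k give
  convolutions.\<close>

lemma e_product: "e k x * e k y + e (- k) x * e (- k) y = 2 * cos (of_int k * w * (x - y))"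
  by (simp add: e_def right_diff_distrib cos_diff algebra_simps)

section \<open>A positive trigonometric kernel\<close>

primrec kcoef :: "nat \<Rightarrow> int \<Rightarrow> real" where
  "kcoef 0 k = (if k = 0 then 1 else 0)"
| "kcoef (Suc N) k = kcoef N k / 2 + (kcoef N (k - 1) + kcoef N (k + 1)) / 4"

lemma kcoef_even: "kcoef N (- k) = kcoef N k"
proof (induction N arbitrary: k)
  case (Suc N)
  have "kcoef N (- k - 1) = kcoef N (k + 1)" "kcoef N (- k + 1) = kcoef N (k - 1)"
    using Suc[of "k + 1"] Suc[of "k - 1"] by simp_all
  then show ?case using Suc[of k] by simp
qed simp

lemma kcoef_zero: "\<bar>k\<bar> > int N \<Longrightarrow> kcoef N k = 0"
  by (induction N arbitrary: k) auto

text \<open>The de la Vallee Poussin kernel before normalisation. The recursion \<open>kcoef\<close>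
  is multiplication by (1 + cos(w z)) / 2 on the level of cosine coefficients. The closed form shows
  positivity and the bound 1, the expansion shows that only finitely many frequencies occur.\<close>

definition ker :: "nat \<Rightarrow> real \<Rightarrow> real" where
  "ker N z = ((1 + cos (w * z)) / 2) ^ N"

lemma ker_expansion: "ker N z = (\<Sum>k\<in>{- int N..int N}. kcoef N k * cos (of_int k * w * z))"
proof (induction N)
  case 0
  show ?case by (simp add: ker_def)
next
  case (Suc N)
  define c where "c k = cos (of_int k * w * z)" for k :: int
  let ?A = "{- int N..int N}" and ?B = "{- int (Suc N)..int (Suc N)}"
  \<comment> \<open>Multiplication by cos(w z) shifts frequencies by one in both directions. The
    shifted sums are then extended to a common range, on which the added coefficients
    vanish.\<close>
  have c: "cos (w * z) * c k = (c (k + 1) + c (k - 1)) / 2" for k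
    by (simp add: c_def distrib_right left_diff_distrib cos_add cos_diff)
  have up: "(\<Sum>k\<in>?A. kcoef N k * c (k + 1)) = (\<Sum>k\<in>?B. kcoef N (k - 1) * c k)"
  proof -
    have "(\<Sum>k\<in>?A. kcoef N k * c (k + 1)) = (\<Sum>k\<in>{- int N + 1..int N + 1}. kcoef N (k - 1) * c k)"
      by (rule sum.reindex_bij_witness[of _ "\<lambda>k. k - 1" "\<lambda>k. k + 1"]) auto
    also have "\<dots> = (\<Sum>k\<in>?B. kcoef N (k - 1) * c k)"
      by (rule sum.mono_neutral_left) (auto simp: kcoef_zero)
    finally show ?thesis .
  qed
  have down: "(\<Sum>k\<in>?A. kcoef N k * c (k - 1)) = (\<Sum>k\<in>?B. kcoef N (k + 1) * c k)"
  proof -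
    have "(\<Sum>k\<in>?A. kcoef N k * c (k - 1)) = (\<Sum>k\<in>{- int N - 1..int N - 1}. kcoef N (k + 1) * c k)"
      by (rule sum.reindex_bij_witness[of _ "\<lambda>k. k + 1" "\<lambda>k. k - 1"]) auto
    also have "\<dots> = (\<Sum>k\<in>?B. kcoef N (k + 1) * c k)"
      by (rule sum.mono_neutral_left) (auto simp: kcoef_zero)
    finally show ?thesis .
  qed
  have mid: "(\<Sum>k\<in>?A. kcoef N k * c k) = (\<Sum>k\<in>?B. kcoef N k * c k)"
    by (rule sum.mono_neutral_left) (auto simp: kcoef_zero)
  have "ker (Suc N) z = ker N z / 2 + cos (w * z) * ker N z / 2"
    by (simp add: ker_def field_simps)
  also have "ker N z = (\<Sum>k\<in>?A. kcoef N k * c k)" using Suc by (simp add: c_def)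
  also have "cos (w * z) * (\<Sum>k\<in>?A. kcoef N k * c k)
      = ((\<Sum>k\<in>?A. kcoef N k * c (k + 1)) + (\<Sum>k\<in>?A. kcoef N k * c (k - 1))) / 2"
    by (simp add: sum_distrib_left mult.left_commute c sum.distrib[symmetric] sum_divide_distrib distrib_left)
  finally have "ker (Suc N) z = (\<Sum>k\<in>?B. kcoef N k * c k) / 2
      + ((\<Sum>k\<in>?B. kcoef N (k - 1) * c k) + (\<Sum>k\<in>?B. kcoef N (k + 1) * c k)) / 2 / 2"
    unfolding up down mid .
  also have "\<dots> = (\<Sum>k\<in>?B. kcoef (Suc N) k * c k)"
    by (simp add: sum_divide_distrib sum.distrib[symmetric] field_simps)
  finally show ?case by (simp add: c_def)
qed

lemma cos_w_abs: "cos (w * \<bar>x - y\<bar>) = cos (w * (x - y))"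
proof -
  have "w * \<bar>x - y\<bar> = \<bar>w * (x - y)\<bar>" using w_pos by (simp add: abs_mult)
  then show ?thesis by (simp only: cos_abs_real)
qed

lemma ker_base: "0 \<le> (1 + cos z) / (2 :: real)" "(1 + cos z) / (2 :: real) \<le> 1"
proof -
  have *: "-1 \<le> c \<Longrightarrow> c \<le> 1 \<Longrightarrow> 0 \<le> (1 + c) / 2 \<and> (1 + c) / 2 \<le> 1" for c :: real by simp
  show "0 \<le> (1 + cos z) / 2" "(1 + cos z) / 2 \<le> 1"
    using *[OF cos_ge_minus_one cos_le_one] by blast+
qed

lemma ker_nonneg: "0 \<le> ker N z"
  unfolding ker_def by (intro zero_le_power ker_base)

lemma ker_le_1: "ker N z \<le> 1"
  unfolding ker_def by (intro power_le_one ker_base)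

lemma bb_ker: "bb (\<lambda>y. ker N (x - y))"
  by (rule bbI[of _ 1], rule borel_measurable_continuous_onI)
    (use ker_nonneg ker_le_1 in \<open>auto simp: abs_le_iff ker_def intro!: continuous_intros intro: order_trans[of _ 0]\<close>)

definition Z :: "nat \<Rightarrow> real" where "Z N = kcoef N 0 * (b - a)"

lemma cos_integral: "k \<noteq> 0 \<Longrightarrow> (LINT y|J a b. cos (of_int k * w * (x - y))) = 0"
proof -
  assume k: "k \<noteq> 0"
  define F where "F y = - sin (of_int k * w * (x - y)) / (of_int k * w)" for y
  have "F b = F a + prim a b (\<lambda>y. cos (of_int k * w * (x - y))) b"
    using a_less_b k w_pos
    by (intro prim_FTC[of _ _ _ _ "\<lambda>y. cos (of_int k * w * (x - y))"])
      (auto simp: F_def intro!: derivative_eq_intros continuous_intros)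
  moreover have "F b = F a"
  proof -
    have "of_int k * w * (x - a) = of_int k * w * (x - b) + of_int k * (w * (b - a))"
      by (simp add: algebra_simps)
    then have "of_int k * w * (x - a) = of_int k * w * (x - b) + of_int k * (2 * pi)"
      unfolding w_period .
    moreover have "cos (of_int k * (2 * pi)) = 1" "sin (of_int k * (2 * pi)) = 0"
      using cos_int_2pin[of k] sin_int_2pin[of k] by (simp_all add: mult.commute mult.left_commute)
    ultimately show ?thesis by (simp add: F_def sin_add)
  qed
  ultimately show ?thesis by (simp add: prim_end)
qed

lemma bb_cos_shift: "bb (\<lambda>y. cos (c * (x - y)))"
  by (rule bbI[of _ 1]) (auto intro!: borel_measurable_continuous_onI continuous_intros)

lemma ker_integral: "(LINT y|J a b. ker N (x - y)) = Z N"
proof -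
  have "(LINT y|J a b. ker N (x - y))
      = (\<Sum>k\<in>{- int N..int N}. kcoef N k * (LINT y|J a b. cos (of_int k * w * (x - y))))"
    unfolding ker_expansion
    by (subst Bochner_Integration.integral_sum) (auto intro!: bb_integrable bb_mult bb_const bb_cos_shift)
  also have "\<dots> = (\<Sum>k\<in>{- int N..int N}. if k = 0 then kcoef N 0 * (b - a) else 0)"
    using a_less_b by (intro sum.cong) (auto simp: cos_integral space_J measure_J)
  finally show ?thesis by (simp add: Z_def)
qed

lemma ker_symmetric: "ker N (x - y) = ker N (y - x)"
proof -
  have "cos (w * (x - y)) = cos (w * (y - x))"
    using cos_minus[of "w * (x - y)"] by (simp add: algebra_simps)
  then show ?thesis by (simp add: ker_def)
qed

text \<open>Within distance d the kernel is at least its value at d, because the cosine decreases on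
  a half period and the hypotheses force w d to be at most pi. This lower bound on the mass replaces
  a closed formula for it.\<close>

lemma Z_lower:
  assumes "0 < d" "a < x - d" "x + d < b"
  shows "2 * d * ((1 + cos (w * d)) / 2) ^ N \<le> Z N"
proof -
  let ?p = "((1 + cos (w * d)) / 2) ^ N"
  have wd: "w * d \<le> pi"
  proof -
    have "w * d \<le> w * ((b - a) / 2)" using assms w_pos by (intro mult_left_mono) auto
    then show ?thesis using w_period by simp
  qed
  have "2 * d * ?p = (LINT y|J a b. indicator {x - d<..<x + d} y * ?p)"
  proof -
    have "(LINT y|J a b. indicator {x - d<..<x + d} y * ?p)
        = (LINT y|lborel. indicator {a<..<b} y * (indicator {x - d<..<x + d} y * ?p))"
      by (rule J_integral_lborel)
    also have "\<dots> = (LINT y|lborel. indicator {x - d<..<x + d} y * ?p)"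
      using assms by (intro Bochner_Integration.integral_cong) (auto simp: indicator_def)
    also have "\<dots> = (LINT y|J (x - d) (x + d). ?p)" by (rule J_integral_lborel[symmetric])
    finally have "(LINT y|J a b. indicator {x - d<..<x + d} y * ?p) = (LINT y|J (x - d) (x + d). ?p)" .
    moreover have "(LINT y|J (x - d) (x + d). ?p) = 2 * d * ?p"
      using assms by (simp add: space_J measure_J)
    ultimately show ?thesis by (rule trans[symmetric])
  qed
  also have "\<dots> \<le> (LINT y|J a b. ker N (x - y))"
  proof (rule integral_mono)
    show "integrable (J a b) (\<lambda>y. indicator {x - d<..<x + d} y * ?p)"
      by (intro bb_integrable bb_mult bb_indicator bb_const) auto
    fix y
    show "indicator {x - d<..<x + d} y * ?p \<le> ker N (x - y)"
    proof (cases "y \<in> {x - d<..<x + d}")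
      case True
      have "cos (w * d) \<le> cos (w * \<bar>x - y\<bar>)"
        using True w_pos wd by (intro cos_monotone_0_pi_le) auto
      also have "\<dots> = cos (w * (x - y))"
        by (rule cos_w_abs)
      finally have "(1 + cos (w * d)) / 2 \<le> (1 + cos (w * (x - y))) / 2" by simp
      moreover have "0 \<le> (1 + cos (w * d)) / 2" by (rule ker_base)
      ultimately show ?thesis using True by (simp add: ker_def power_mono)
    qed (simp add: ker_nonneg)
  qed (intro bb_integrable bb_ker)
  also have "\<dots> = Z N" by (rule ker_integral)
  finally show ?thesis .
qed

lemma Z_pos: "Z N > 0"
proof -
  define d where "d = (b - a) / 4"
  have wd: "w * d = pi / 2" using w_period by (simp add: d_def)
  have "(1 + cos (w * d)) / 2 = 1 / 2" unfolding wd by simp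
  moreover have "0 < 2 * d" using a_less_b by (simp add: d_def)
  ultimately have "2 * d * ((1 + cos (w * d)) / 2) ^ N > 0"
    by (simp only:) (intro mult_pos_pos zero_less_power; simp)
  also have "2 * d * ((1 + cos (w * d)) / 2) ^ N \<le> Z N"
    by (rule Z_lower[of _ "(a + b) / 2"]) (use a_less_b in \<open>auto simp: d_def field_simps\<close>)
  finally show ?thesis .
qed

section \<open>Trigonometric means and their convergence\<close>

definition gam :: "nat \<Rightarrow> int \<Rightarrow> real" where "gam N k = kcoef N k / Z N"

abbreviation freqs :: "nat \<Rightarrow> int set" where "freqs N \<equiv> {- int N..int N}"

definition P :: "nat \<Rightarrow> (real \<Rightarrow> real) \<Rightarrow> real \<Rightarrow> real" where
  "P N g x = (\<Sum>k\<in>freqs N. gam N k * ip g (e k) * e k x)"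

lemma sum_freqs_minus: "(\<Sum>k\<in>freqs N. f (- k)) = (\<Sum>k\<in>freqs N. f k)"
  by (rule sum.reindex_bij_witness[of _ uminus uminus]) auto

lemma gam_even: "gam N (- k) = gam N k"
  by (simp add: gam_def kcoef_even)

text \<open>The weights are even in k, so the terms of k and -k may be averaged;
  \<open>e_product\<close> then turns the Fourier multiplier into integration against the
  kernel.\<close>

lemma P_kernel:
  assumes "bb g"
  shows "P N g x = (LINT y|J a b. ker N (x - y) * g y) / Z N"
proof -
  have "(LINT y|J a b. cos (of_int k * w * (x - y)) * g y)
      = (ip g (e k) * e k x + ip g (e (- k)) * e (- k) x) / 2" for k
  proof -
    have "(LINT y|J a b. cos (of_int k * w * (x - y)) * g y)
        = (LINT y|J a b. (e k x / 2) * (g y * e k y) + (e (- k) x / 2) * (g y * e (- k) y))"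
    proof (rule Bochner_Integration.integral_cong[OF refl])
      fix y
      have E: "cos (of_int k * w * (x - y)) = (e k x * e k y + e (- k) x * e (- k) y) / 2"
        by (simp only: e_product nonzero_mult_div_cancel_left zero_neq_numeral[symmetric] not_False_eq_True)
      show "cos (of_int k * w * (x - y)) * g y = (e k x / 2) * (g y * e k y) + (e (- k) x / 2) * (g y * e (- k) y)"
        unfolding E by (simp add: field_simps)
    qed
    also have "\<dots> = (LINT y|J a b. (e k x / 2) * (g y * e k y)) + (LINT y|J a b. (e (- k) x / 2) * (g y * e (- k) y))"
      by (intro Bochner_Integration.integral_add bb_integrable bb_mult assms bb_e bb_const)
    also have "\<dots> = (e k x / 2) * ip g (e k) + (e (- k) x / 2) * ip g (e (- k))"
      by (simp only: ip_def integral_mult_right_zero)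
    finally show ?thesis by (simp add: field_simps)
  qed
  note key = this
  have "(LINT y|J a b. ker N (x - y) * g y)
      = (LINT y|J a b. (\<Sum>k\<in>freqs N. kcoef N k * cos (of_int k * w * (x - y)) * g y))"
    unfolding ker_expansion sum_distrib_right ..
  also have "\<dots> = (\<Sum>k\<in>freqs N. LINT y|J a b. kcoef N k * cos (of_int k * w * (x - y)) * g y)"
    by (intro Bochner_Integration.integral_sum bb_integrable bb_mult bb_const bb_cos_shift assms)
  also have "\<dots> = (\<Sum>k\<in>freqs N. kcoef N k * ((ip g (e k) * e k x + ip g (e (- k)) * e (- k) x) / 2))"
  proof (rule sum.cong[OF refl])
    fix k
    have "(LINT y|J a b. kcoef N k * cos (of_int k * w * (x - y)) * g y)
        = (LINT y|J a b. kcoef N k * (cos (of_int k * w * (x - y)) * g y))"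
      by (rule Bochner_Integration.integral_cong) (simp_all only: mult.assoc)
    also have "\<dots> = kcoef N k * (LINT y|J a b. cos (of_int k * w * (x - y)) * g y)"
      by (rule integral_mult_right_zero)
    finally show "(LINT y|J a b. kcoef N k * cos (of_int k * w * (x - y)) * g y)
        = kcoef N k * ((ip g (e k) * e k x + ip g (e (- k)) * e (- k) x) / 2)"
      unfolding key .
  qed
  also have "\<dots> = (\<Sum>k\<in>freqs N. kcoef N k * ip g (e k) * e k x) / 2
      + (\<Sum>k\<in>freqs N. kcoef N (- k) * ip g (e (- k)) * e (- k) x) / 2"
    by (simp add: kcoef_even sum.distrib[symmetric] sum_divide_distrib field_simps)
  also have "(\<Sum>k\<in>freqs N. kcoef N (- k) * ip g (e (- k)) * e (- k) x) = (\<Sum>k\<in>freqs N. kcoef N k * ip g (e k) * e k x)"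
    by (rule sum_freqs_minus)
  finally have "(LINT y|J a b. ker N (x - y) * g y) = (\<Sum>k\<in>freqs N. kcoef N k * ip g (e k) * e k x)"
    by simp
  then show ?thesis by (simp add: P_def gam_def sum_divide_distrib)
qed

lemma bb_P: "bb (P N g)"
  unfolding P_def[abs_def] by (intro bb_sum bb_mult bb_const bb_e)

lemma P_bound:
  assumes "bb g" "\<And>y. \<bar>g y\<bar> \<le> C"
  shows "\<bar>P N g x\<bar> \<le> C"
proof -
  have "\<bar>LINT y|J a b. ker N (x - y) * g y\<bar> \<le> (LINT y|J a b. \<bar>ker N (x - y) * g y\<bar>)"
    by (rule integral_abs_bound)
  also have "\<dots> \<le> (LINT y|J a b. C * ker N (x - y))"
    using assms(2) ker_nonneg
    by (intro integral_mono bb_integrable bb_abs bb_mult bb_ker assms(1) bb_const)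
      (auto simp: abs_mult mult.commute intro!: mult_right_mono)
  also have "\<dots> = C * Z N" by (simp add: ker_integral)
  finally show ?thesis using Z_pos[of N] by (simp add: P_kernel[OF assms(1)] divide_le_eq)
qed

lemma P_diff: "bb f \<Longrightarrow> bb g \<Longrightarrow> P N (\<lambda>x. f x - g x) x = P N f x - P N g x"
  unfolding P_def ip_def left_diff_distrib
  by (simp add: Bochner_Integration.integral_diff bb_integrable bb_mult bb_e algebra_simps sum_subtractf)

lemma ker_pair: "bb (\<lambda>z::real \<times> real. ker N (fst z - snd z))"
  by (rule bbI[of _ 1], rule borel_measurable_continuous_onI)
    (use ker_nonneg ker_le_1 in \<open>auto simp: abs_le_iff ker_def intro!: continuous_intros intro: order_trans[of _ 0]\<close>)

text \<open>The kernel is positive and symmetric and has integral \<open>Z N\<close> in either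
  variable, so by Fubini the means do not increase the L1 norm.\<close>

lemma P_L1_bound:
  assumes "bb g"
  shows "(LINT x|J a b. \<bar>P N g x\<bar>) \<le> (LINT x|J a b. \<bar>g x\<bar>)"
proof -
  have bk: "bb (\<lambda>z::real \<times> real. ker N (fst z - snd z) * \<bar>g (snd z)\<bar>)"
    by (intro bb_mult ker_pair bb_abs bb_snd assms)
  have "(LINT x|J a b. \<bar>P N g x\<bar>) \<le> (LINT x|J a b. (1 / Z N) * (LINT y|J a b. ker N (x - y) * \<bar>g y\<bar>))"
  proof (rule integral_mono)
    show "integrable (J a b) (\<lambda>x. \<bar>P N g x\<bar>)" by (intro bb_integrable bb_abs bb_P)
    show "integrable (J a b) (\<lambda>x. (1 / Z N) * (LINT y|J a b. ker N (x - y) * \<bar>g y\<bar>))"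
      using bb_integral[OF bk] by (intro bb_integrable bb_mult bb_const) simp
    fix x
    have "\<bar>LINT y|J a b. ker N (x - y) * g y\<bar> \<le> (LINT y|J a b. \<bar>ker N (x - y) * g y\<bar>)"
      by (rule integral_abs_bound)
    then show "\<bar>P N g x\<bar> \<le> (1 / Z N) * (LINT y|J a b. ker N (x - y) * \<bar>g y\<bar>)"
      using Z_pos[of N] ker_nonneg by (simp add: P_kernel[OF assms] abs_mult divide_right_mono)
  qed
  also have "\<dots> = (1 / Z N) * (LINT x|J a b. LINT y|J a b. ker N (x - y) * \<bar>g y\<bar>)" by simp
  also have "(LINT x|J a b. LINT y|J a b. ker N (x - y) * \<bar>g y\<bar>)
      = (LINT y|J a b. LINT x|J a b. ker N (x - y) * \<bar>g y\<bar>)"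
    using bb_Fubini[OF bk, of a b a b] by simp
  also have "\<dots> = (LINT y|J a b. (LINT x|J a b. ker N (y - x)) * \<bar>g y\<bar>)"
    using ker_symmetric by simp
  also have "(1 / Z N) * \<dots> = (LINT x|J a b. \<bar>g x\<bar>)"
    using Z_pos[of N] by (simp add: ker_integral)
  finally show ?thesis .
qed

lemma cos_away:
  assumes "0 < d" "d \<le> \<theta>" "\<theta> \<le> 2 * pi - d"
  shows "cos \<theta> \<le> cos d"
proof (cases "\<theta> \<le> pi")
  case True
  then show ?thesis using assms by (intro cos_monotone_0_pi_le) auto
next
  case False
  then have "cos (2 * pi - \<theta>) \<le> cos d" using assms by (intro cos_monotone_0_pi_le) auto
  then show ?thesis by (simp add: cos_diff)
qed

text \<open>Away from x the kernel is at most q^N, while its mass is at least d p^N, with q and p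
  the bases of the power at distances d and d/2. As q < p, the far part decays geometrically; near x
  continuity of \<open>g\<close> is used.\<close>

lemma P_pointwise:
  assumes g: "bb g" and c: "isCont g x" and x: "a < x" "x < b"
  shows "(\<lambda>N. P N g x) \<longlonglongrightarrow> g x"
proof (rule LIMSEQ_I)
  fix \<epsilon> :: real assume "\<epsilon> > 0"
  obtain C where C: "\<And>y. \<bar>g y\<bar> \<le> C" "C \<ge> 0" using bb_bound[OF g] by metis
  obtain d0 where d0: "d0 > 0" "\<And>y. \<bar>y - x\<bar> < d0 \<Longrightarrow> \<bar>g y - g x\<bar> < \<epsilon> / 2"
    using c[unfolded continuous_at_eps_delta, rule_format, of "\<epsilon> / 2"] \<open>\<epsilon> > 0\<close>
    by (auto simp: dist_real_def)
  \<comment> \<open>Being below the distances from x to both end points, d also bounds from below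
    the distance around the circle of the far points y, although \<open>g\<close> may jump across
    the end points.\<close>
  define d where "d = min d0 (min (x - a) (b - x)) / 2"
  have d: "0 < d" "d < d0" "d < x - a" "d < b - x" using d0(1) x by (auto simp: d_def)
  define q p where "q = (1 + cos (w * d)) / 2" and "p = (1 + cos (w * (d / 2))) / 2"
  have wd: "0 < w * d" "w * d < pi"
  proof -
    have "w * d < w * ((b - a) / 2)" using d w_pos by (intro mult_strict_left_mono) auto
    then show "w * d < pi" using w_period by simp
  qed (rule mult_pos_pos[OF w_pos d(1)])
  have "cos (w * d) < cos (w * (d / 2))"
    using wd d w_pos by (intro cos_monotone_0_pi mult_strict_left_mono mult_nonneg_nonneg) auto
  then have qp: "q < p" "0 \<le> q" using ker_base(1)[of "w * d"] by (auto simp: q_def p_def)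
  have Zl: "d * p ^ N \<le> Z N" for N
    using Z_lower[of "d / 2" x N] d by (simp add: p_def)
  have est: "\<bar>P N g x - g x\<bar> \<le> \<epsilon> / 2 + (2 * C * (b - a) / d) * (q / p) ^ N" for N
  proof -
    have pw: "\<bar>ker N (x - y) * (g y - g x)\<bar> \<le> ker N (x - y) * (\<epsilon> / 2) + 2 * C * q ^ N"
      if y: "y \<in> space (J a b)" for y
    proof (cases "\<bar>y - x\<bar> < d0")
      case True
      then have "ker N (x - y) * \<bar>g y - g x\<bar> \<le> ker N (x - y) * (\<epsilon> / 2)"
        using d0(2)[of y] ker_nonneg by (intro mult_left_mono) auto
      moreover have "0 \<le> 2 * C * q ^ N" using C qp by simp
      ultimately show ?thesis using ker_nonneg[of N "x - y"] by (simp add: abs_mult)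
    next
      case False
      have "cos (w * (x - y)) = cos (w * \<bar>x - y\<bar>)"
        by (rule cos_w_abs[symmetric])
      also have "\<dots> \<le> cos (w * d)"
      proof (rule cos_away)
        show "w * d \<le> w * \<bar>x - y\<bar>" using False d w_pos by (intro mult_left_mono) auto
        have "w * \<bar>x - y\<bar> \<le> w * (b - a - d)"
          using y d w_pos x by (intro mult_left_mono) (auto simp: space_J)
        then show "w * \<bar>x - y\<bar> \<le> 2 * pi - w * d" using w_period by (simp add: algebra_simps)
      qed (use wd in auto)
      finally have "ker N (x - y) \<le> q ^ N"
        unfolding ker_def q_def by (intro power_mono[OF _ ker_base(1)]) simp
      moreover have "\<bar>g y - g x\<bar> \<le> 2 * C" using C(1)[of y] C(1)[of x] by linarith
      ultimately have "ker N (x - y) * \<bar>g y - g x\<bar> \<le> q ^ N * (2 * C)"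
        using ker_nonneg qp by (intro mult_mono) auto
      moreover have "0 \<le> ker N (x - y) * (\<epsilon> / 2)" using ker_nonneg \<open>\<epsilon> > 0\<close> by simp
      ultimately show ?thesis using ker_nonneg[of N "x - y"] by (simp add: abs_mult mult.commute)
    qed
    have "P N g x - g x = ((LINT y|J a b. ker N (x - y) * g y) - g x * (LINT y|J a b. ker N (x - y))) / Z N"
      using Z_pos[of N] by (simp add: P_kernel[OF g] ker_integral field_simps)
    also have "(LINT y|J a b. ker N (x - y) * g y) - g x * (LINT y|J a b. ker N (x - y))
        = (LINT y|J a b. ker N (x - y) * (g y - g x))"
    proof -
      have "(LINT y|J a b. ker N (x - y) * (g y - g x))
          = (LINT y|J a b. ker N (x - y) * g y - g x * ker N (x - y))"
        by (rule Bochner_Integration.integral_cong) (auto simp: algebra_simps)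
      also have "\<dots> = (LINT y|J a b. ker N (x - y) * g y) - (LINT y|J a b. g x * ker N (x - y))"
        by (intro Bochner_Integration.integral_diff bb_integrable bb_mult bb_ker bb_const g)
      finally show ?thesis by simp
    qed
    finally have eq: "P N g x - g x = (LINT y|J a b. ker N (x - y) * (g y - g x)) / Z N" .
    have "\<bar>LINT y|J a b. ker N (x - y) * (g y - g x)\<bar> \<le> (LINT y|J a b. \<bar>ker N (x - y) * (g y - g x)\<bar>)"
      by (rule integral_abs_bound)
    also have "\<dots> \<le> (LINT y|J a b. ker N (x - y) * (\<epsilon> / 2) + 2 * C * q ^ N)"
      by (rule integral_mono[OF _ _ pw]) (intro bb_integrable bb_abs bb_add bb_diff bb_mult bb_ker g bb_const)+
    also have "\<dots> = Z N * (\<epsilon> / 2) + 2 * C * q ^ N * (b - a)"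
    proof -
      have "(LINT y|J a b. ker N (x - y) * (\<epsilon> / 2) + 2 * C * q ^ N)
          = (LINT y|J a b. ker N (x - y) * (\<epsilon> / 2)) + (LINT y|J a b. 2 * C * q ^ N)"
        by (intro Bochner_Integration.integral_add bb_integrable bb_mult bb_ker bb_const)
      then show ?thesis using a_less_b by (simp add: ker_integral space_J measure_J)
    qed
    finally have "\<bar>P N g x - g x\<bar> \<le> (Z N * (\<epsilon> / 2) + 2 * C * q ^ N * (b - a)) / Z N"
      unfolding eq using Z_pos[of N] by (simp add: divide_right_mono)
    also have "\<dots> = \<epsilon> / 2 + 2 * C * q ^ N * (b - a) / Z N"
      using Z_pos[of N] by (simp add: field_simps)
    also have "2 * C * q ^ N * (b - a) / Z N \<le> 2 * C * q ^ N * (b - a) / (d * p ^ N)"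
      using C qp a_less_b d Z_pos[of N] by (intro divide_left_mono Zl) auto
    also have "\<dots> = (2 * C * (b - a) / d) * (q / p) ^ N"
      by (simp add: power_divide)
    finally show ?thesis by simp
  qed
  have "(\<lambda>N. (2 * C * (b - a) / d) * (q / p) ^ N) \<longlonglongrightarrow> (2 * C * (b - a) / d) * 0"
    using qp by (intro tendsto_mult tendsto_const LIMSEQ_power_zero) auto
  then have "\<forall>\<^sub>F N in sequentially. (2 * C * (b - a) / d) * (q / p) ^ N < \<epsilon> / 2"
    by (rule order_tendstoD) (use \<open>\<epsilon> > 0\<close> in simp)
  then obtain N0 where N0: "\<And>N. N \<ge> N0 \<Longrightarrow> (2 * C * (b - a) / d) * (q / p) ^ N < \<epsilon> / 2"
    by (auto simp: eventually_sequentially)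
  have "norm (P N g x - g x) < \<epsilon>" if "N \<ge> N0" for N
    using est[of N] N0[OF that] by simp
  then show "\<exists>no. \<forall>n\<ge>no. norm (P n g x - g x) < \<epsilon>" by blast
qed

text \<open>Density argument: \<open>g\<close> is approximated in L1 by one continuous function,
  whose means converge at every interior point, and \<open>P_L1_bound\<close> controls the means of
  the difference.\<close>

lemma P_L1:
  assumes g: "bb g"
  shows "(\<lambda>N. LINT x|J a b. \<bar>P N g x - g x\<bar>) \<longlonglongrightarrow> 0"
proof (rule LIMSEQ_I)
  fix \<epsilon> :: real assume "\<epsilon> > 0"
  obtain C where C: "\<And>y. \<bar>g y\<bar> \<le> C" using bb_bound[OF g] by metis
  have "- C \<le> g y" "g y \<le> C" for y using C[of y] by (auto simp: abs_le_iff)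
  from continuous_approx[OF bb_measurable[OF g] this]
  obtain c where c: "\<And>n. continuous_on UNIV (c n)" "\<And>n x. - C \<le> c n x \<and> c n x \<le> C"
    "AE x in lborel. (\<lambda>n. c n x) \<longlonglongrightarrow> g x" by blast
  have bc: "bb (c n)" for n
    by (rule bbI[OF borel_measurable_continuous_onI[OF c(1)], of _ C]) (use c(2) in \<open>simp add: abs_le_iff minus_le_iff\<close>)
  have "(\<lambda>n. LINT x|J a b. \<bar>c n x - g x\<bar>) \<longlonglongrightarrow> (LINT x|J a b. 0)"
  proof (rule J_dominated_convergence)
    show "AE x in J a b. (\<lambda>n. \<bar>c n x - g x\<bar>) \<longlonglongrightarrow> 0"
      using AE_J_I[OF c(3)] by eventually_elim (auto intro!: tendsto_rabs_zero LIM_zero)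
    show "\<bar>\<bar>c n x - g x\<bar>\<bar> \<le> 2 * C" for n x using c(2)[of n x] C[of x] by (auto simp: abs_le_iff)
  qed (auto intro!: bb_measurable bb_intros bc g)
  then have "\<forall>\<^sub>F n in sequentially. (LINT x|J a b. \<bar>c n x - g x\<bar>) < \<epsilon> / 3"
    by (rule order_tendstoD) (use \<open>\<epsilon> > 0\<close> in simp)
  then obtain n where n: "(LINT x|J a b. \<bar>c n x - g x\<bar>) < \<epsilon> / 3"
    by (auto simp: eventually_sequentially)
  have "(\<lambda>N. LINT x|J a b. \<bar>P N (c n) x - c n x\<bar>) \<longlonglongrightarrow> (LINT x|J a b. 0)"
  proof (rule J_dominated_convergence)
    have "AE x in J a b. a < x \<and> x < b" by (rule AE_I2) (simp add: space_J)
    then show "AE x in J a b. (\<lambda>N. \<bar>P N (c n) x - c n x\<bar>) \<longlonglongrightarrow> 0"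
    proof eventually_elim
      case (elim x)
      have "isCont (c n) x" using c(1) by (simp add: continuous_on_eq_continuous_at)
      then show ?case using P_pointwise[OF bc] elim by (auto intro!: tendsto_rabs_zero LIM_zero)
    qed
    show "\<bar>\<bar>P N (c n) x - c n x\<bar>\<bar> \<le> 2 * C" for N x
    proof -
      have 1: "\<bar>c n y\<bar> \<le> C" for y using c(2)[of n y] by (auto simp: abs_le_iff)
      show ?thesis using P_bound[OF bc 1, of N x] 1[of x] by linarith
    qed
  qed (auto intro!: bb_measurable bb_intros bc bb_P)
  then have "\<forall>\<^sub>F N in sequentially. (LINT x|J a b. \<bar>P N (c n) x - c n x\<bar>) < \<epsilon> / 3"
    by (rule order_tendstoD) (use \<open>\<epsilon> > 0\<close> in simp)
  then obtain N0 where N0: "\<And>N. N \<ge> N0 \<Longrightarrow> (LINT x|J a b. \<bar>P N (c n) x - c n x\<bar>) < \<epsilon> / 3"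
    by (auto simp: eventually_sequentially)
  have "norm ((LINT x|J a b. \<bar>P N g x - g x\<bar>) - 0) < \<epsilon>" if "N \<ge> N0" for N
  proof -
    have bd: "bb (\<lambda>x. c n x - g x)" by (intro bb_diff bc g)
    have "(LINT x|J a b. \<bar>P N g x - g x\<bar>)
        \<le> (LINT x|J a b. \<bar>P N (\<lambda>x. c n x - g x) x\<bar> + (\<bar>P N (c n) x - c n x\<bar> + \<bar>c n x - g x\<bar>))"
      by (rule integral_mono) (auto intro!: bb_integrable bb_add bb_abs bb_diff bb_P g bc simp: P_diff[OF bc g])
    also have "\<dots> = (LINT x|J a b. \<bar>P N (\<lambda>x. c n x - g x) x\<bar>)
        + ((LINT x|J a b. \<bar>P N (c n) x - c n x\<bar>) + (LINT x|J a b. \<bar>c n x - g x\<bar>))"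
      by (simp add: Bochner_Integration.integral_add bb_integrable bb_add bb_abs bb_diff bb_P g bc)
    also have "\<dots> < \<epsilon>"
      using P_L1_bound[OF bd, of N] n N0[OF that] by linarith
    finally have "(LINT x|J a b. \<bar>P N g x - g x\<bar>) < \<epsilon>" .
    moreover have "0 \<le> (LINT x|J a b. \<bar>P N g x - g x\<bar>)" by (rule integral_nonneg_AE) auto
    ultimately show ?thesis by simp
  qed
  then show "\<exists>no. \<forall>n\<ge>no. norm ((LINT x|J a b. \<bar>P n g x - g x\<bar>) - 0) < \<epsilon>" by blast
qed

section \<open>Integrals of products as limits of finite Fourier sums\<close>

definition bil :: "nat \<Rightarrow> (real \<Rightarrow> real) \<Rightarrow> (real \<Rightarrow> real) \<Rightarrow> real" where
  "bil N g h = (\<Sum>k\<in>freqs N. gam N k * (ip g (e k) * ip h (e k)))"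

lemma bil_eq:
  assumes "bb h"
  shows "bil N g h = (LINT x|J a b. P N g x * h x)"
proof -
  have "(LINT x|J a b. P N g x * h x) = (LINT x|J a b. (\<Sum>k\<in>freqs N. gam N k * ip g (e k) * (h x * e k x)))"
    unfolding P_def
    by (intro Bochner_Integration.integral_cong refl) (auto simp: sum_distrib_right intro!: sum.cong)
  also have "\<dots> = (\<Sum>k\<in>freqs N. gam N k * ip g (e k) * ip h (e k))"
    by (subst Bochner_Integration.integral_sum)
      (auto intro!: bb_integrable bb_mult bb_const assms bb_e simp: ip_def)
  finally show ?thesis by (simp add: bil_def mult.assoc)
qed

text \<open>This takes the place of Parseval's identity: the finite weighted sum of products of
  coefficients is the integral of \<open>P N g * h\<close>, where \<open>P N g\<close> tends to
  \<open>g\<close> in L1 and \<open>h\<close> is bounded.\<close>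

lemma bil_tendsto:
  assumes g: "bb g" and h: "bb h"
  shows "(\<lambda>N. bil N g h) \<longlonglongrightarrow> ip g h"
proof -
  obtain C where C: "\<And>y. \<bar>h y\<bar> \<le> C" "C \<ge> 0" using bb_bound[OF h] by metis
  have "\<bar>bil N g h - ip g h\<bar> \<le> C * (LINT x|J a b. \<bar>P N g x - g x\<bar>)" for N
  proof -
    have "bil N g h - ip g h = (LINT x|J a b. (P N g x - g x) * h x)"
      by (simp add: bil_eq[OF h] ip_def left_diff_distrib Bochner_Integration.integral_diff bb_integrable bb_mult bb_P g h)
    also have "\<bar>\<dots>\<bar> \<le> (LINT x|J a b. \<bar>(P N g x - g x) * h x\<bar>)" by (rule integral_abs_bound)
    also have "\<dots> \<le> (LINT x|J a b. C * \<bar>P N g x - g x\<bar>)"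
      using C by (intro integral_mono bb_integrable bb_abs bb_mult bb_diff bb_const bb_P g h)
        (auto simp: abs_mult mult.commute intro!: mult_right_mono)
    finally show ?thesis by simp
  qed
  moreover have "(\<lambda>N. C * (LINT x|J a b. \<bar>P N g x - g x\<bar>)) \<longlonglongrightarrow> 0"
    by (rule tendsto_mult_right_zero) (rule P_L1[OF g])
  ultimately show ?thesis by (rule LIMSEQ_abs_diff_bound)
qed

lemma ip_bound:
  assumes "bb g" "bb h" "\<And>x. \<bar>g x\<bar> \<le> C" "\<And>x. \<bar>h x\<bar> \<le> D"
  shows "\<bar>ip g h\<bar> \<le> C * D * (b - a)"
  unfolding ip_def
proof (rule J_integral_bound)
  show "\<bar>g x * h x\<bar> \<le> C * D" for x
    using assms(3,4)[of x] by (auto simp: abs_mult intro!: mult_mono order_trans[OF abs_ge_zero assms(3)])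
qed (use a_less_b assms in \<open>auto intro!: bb_measurable bb_mult\<close>)

lemma bil_bound:
  assumes "bb g" "bb h" "\<And>x. \<bar>g x\<bar> \<le> C" "\<And>x. \<bar>h x\<bar> \<le> D"
  shows "\<bar>bil N g h\<bar> \<le> C * D * (b - a)"
  using ip_bound[OF bb_P assms(2) P_bound[OF assms(1,3)] assms(4)]
  by (simp add: bil_eq[OF assms(2)] ip_def)

text \<open>Uniqueness of Fourier coefficients: \<open>g\<close> is the L1 limit of means that all
  vanish.\<close>

lemma ip_zero_AE:
  assumes g: "bb g" and z: "\<And>k. ip g (e k) = 0"
  shows "AE x in J a b. g x = 0"
proof -
  have "P N g x = 0" for N x by (simp add: P_def z)
  then have "(\<lambda>N. LINT x|J a b. \<bar>g x\<bar>) \<longlonglongrightarrow> 0" using P_L1[OF g] by simp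
  then have "(LINT x|J a b. \<bar>g x\<bar>) = 0" by (simp add: LIMSEQ_const_iff)
  then have "AE x in J a b. \<bar>g x\<bar> = 0"
    by (subst (asm) integral_nonneg_eq_0_iff_AE) (auto intro!: bb_integrable bb_abs g)
  then show ?thesis by simp
qed

text \<open>\<open>sd g g'\<close> says that \<open>g'\<close> is the weak derivative of \<open>g\<close> on the circle.\<close>
definition sd :: "(real \<Rightarrow> real) \<Rightarrow> (real \<Rightarrow> real) \<Rightarrow> bool" where
  "sd g g' \<longleftrightarrow> (\<forall>k. of_int k * w * ip g (e (- k)) = - ip g' (e k))"

text \<open>Summation by parts on the Fourier side: renaming k to -k and evenness of the weights
  move the factor \<open>of_int k * w\<close> from the coefficients of \<open>F\<close> to those of
  \<open>W\<close>, where it produces the derivative \<open>Y\<close>.\<close>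

lemma sd_bil:
  assumes "sd W Y"
  shows "(\<Sum>k\<in>freqs N. gam N k * ((of_int k * w * ip F (e (- k))) * ip W (e k))) = bil N F Y"
proof -
  have "(\<Sum>k\<in>freqs N. gam N k * ((of_int k * w * ip F (e (- k))) * ip W (e k)))
      = (\<Sum>k\<in>freqs N. gam N (- k) * ((of_int (- k) * w * ip F (e (- (- k)))) * ip W (e (- k))))"
    by (rule sum_freqs_minus[symmetric])
  also have "\<dots> = (\<Sum>k\<in>freqs N. gam N k * (ip F (e k) * ip Y (e k)))"
  proof (rule sum.cong[OF refl])
    fix k
    have "ip Y (e k) = - (of_int k * w * ip W (e (- k)))" using assms by (simp add: sd_def)
    then show "gam N (- k) * ((of_int (- k) * w * ip F (e (- (- k)))) * ip W (e (- k)))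
        = gam N k * (ip F (e k) * ip Y (e k))"
      by (simp add: gam_even)
  qed
  finally show ?thesis by (simp add: bil_def)
qed

lemma P_deriv:
  assumes "sd W Y"
  shows "(P N W has_real_derivative P N Y x) (at x)"
proof -
  have "(P N W has_real_derivative (\<Sum>k\<in>freqs N. gam N k * ip W (e k) * (of_int k * w * e (- k) x))) (at x)"
    unfolding P_def[abs_def] by (intro DERIV_sum DERIV_cmult e_deriv)
  also have "(\<Sum>k\<in>freqs N. gam N k * ip W (e k) * (of_int k * w * e (- k) x))
      = (\<Sum>k\<in>freqs N. gam N (- k) * ip W (e (- k)) * (of_int (- k) * w * e (- (- k)) x))"
    by (rule sum_freqs_minus[symmetric])
  also have "\<dots> = P N Y x"
    unfolding P_def
  proof (rule sum.cong[OF refl])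
    fix k
    have "ip Y (e k) = - (of_int k * w * ip W (e (- k)))" using assms by (simp add: sd_def)
    then show "gam N (- k) * ip W (e (- k)) * (of_int (- k) * w * e (- (- k)) x) = gam N k * ip Y (e k) * e k x"
      by (simp add: gam_even)
  qed
  finally show ?thesis .
qed

lemma P_periodic: "P N g b = P N g a"
  using e_periodic[of _ a] by (simp add: P_def)

text \<open>For the smooth means \<open>P N W\<close> the identity says that a periodic derivative
  has integral zero. It passes to the limit along a subsequence for which the means of
  \<open>W\<close> and of \<open>Y\<close> converge almost everywhere; uniform bounds on the means
  give domination.\<close>

lemma sd_chain:
  assumes sd: "sd W Y" and W: "bb W" and Y: "bb Y"
    and D: "\<And>s. (F has_real_derivative f s) (at s)" and f: "continuous_on UNIV f"
  shows "sd (\<lambda>x. F (W x)) (\<lambda>x. f (W x) * Y x)"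
  unfolding sd_def
proof
  fix k
  obtain C1 where C1: "\<And>y. \<bar>W y\<bar> \<le> C1" "C1 \<ge> 0" using bb_bound[OF W] by metis
  obtain C2 where C2: "\<And>y. \<bar>Y y\<bar> \<le> C2" "C2 \<ge> 0" using bb_bound[OF Y] by metis
  have Fc: "continuous_on UNIV F" using D by (meson DERIV_isCont continuous_at_imp_continuous_on)
  have bbFf: "bb (\<lambda>x. F (g x))" "bb (\<lambda>x. f (g x))" if "bb g" for g :: "real \<Rightarrow> real"
    using that Fc f by (auto intro: bb_continuous_compose)
  have zero: "(LINT x|J a b. f (P N W x) * P N Y x * e k x + F (P N W x) * (of_int k * w * e (- k) x)) = 0" for N
  proof -
    let ?G = "\<lambda>x. F (P N W x) * e k x"
    let ?g = "\<lambda>x. f (P N W x) * P N Y x * e k x + F (P N W x) * (of_int k * w * e (- k) x)"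
    have DG: "(?G has_real_derivative ?g x) (at x)" for x
      by (rule derivative_eq_intros DERIV_chain2[OF D P_deriv[OF sd]] e_deriv refl | simp)+
    have Pc: "continuous_on UNIV (P N g)" for g
      unfolding P_def[abs_def] by (intro continuous_intros smooth1_continuous_on e_smooth)
    have "continuous_on UNIV ?g"
      by (intro continuous_intros Pc smooth1_continuous_on e_smooth
          continuous_on_compose2[OF f Pc] continuous_on_compose2[OF Fc Pc]) auto
    from prim_FTC[OF _ _ DG this, of a b b ?g] a_less_b
    have "?G b = ?G a + (LINT x|J a b. ?g x)" by (simp add: prim_end)
    moreover have "?G b = ?G a" using e_periodic[of k a] by (simp add: P_periodic)
    ultimately show ?thesis by simp
  qed
  \<comment> \<open>The L1 errors of \<open>W\<close> and \<open>Y\<close> are added before a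
    subsequence is extracted, so that one subsequence serves both.\<close>
  have "(\<lambda>N. (LINT x|J a b. \<bar>P N W x - W x\<bar>) + (LINT x|J a b. \<bar>P N Y x - Y x\<bar>)) \<longlonglongrightarrow> 0 + 0"
    by (intro tendsto_add P_L1 W Y)
  then have L: "(\<lambda>N. LINT x|J a b. norm ((\<bar>P N W x - W x\<bar> + \<bar>P N Y x - Y x\<bar>) - 0)) \<longlonglongrightarrow> 0"
    by (simp only: Bochner_Integration.integral_add[OF bb_integrable bb_integrable, OF bb_abs bb_abs, OF bb_diff bb_diff, OF bb_P W bb_P Y, symmetric]
        real_norm_def diff_0_right abs_add_abs add_0)
  have L': "(\<lambda>N. \<integral>x. norm (\<bar>P N W x - W x\<bar> + \<bar>P N Y x - Y x\<bar>) \<partial>J a b) \<longlonglongrightarrow> 0"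
    using L by simp
  let ?u = "\<lambda>N x. \<bar>P N W x - W x\<bar> + \<bar>P N Y x - Y x\<bar>"
  have "integrable (J a b) (?u N)" for N
    by (intro bb_integrable bb_add bb_abs bb_diff bb_P W Y)
  from tendsto_L1_AE_subseq[of "J a b" ?u, OF this L']
  obtain r :: "nat \<Rightarrow> nat" where r: "AE x in J a b. (\<lambda>i. \<bar>P (r i) W x - W x\<bar> + \<bar>P (r i) Y x - Y x\<bar>) \<longlonglongrightarrow> 0"
    by blast
  have lim: "AE x in J a b. (\<lambda>i. P (r i) W x) \<longlonglongrightarrow> W x \<and> (\<lambda>i. P (r i) Y x) \<longlonglongrightarrow> Y x"
    using r
  proof eventually_elim
    case (elim x)
    show ?case by (rule conjI; rule LIMSEQ_abs_diff_bound[OF _ elim]) simp_all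
  qed
  have "compact (F ` {-C1..C1})"
    by (intro compact_continuous_image continuous_on_subset[OF Fc]) auto
  moreover have "compact (f ` {-C1..C1})"
    by (intro compact_continuous_image continuous_on_subset[OF f]) auto
  ultimately have "bounded (F ` {-C1..C1})" "bounded (f ` {-C1..C1})" by (auto intro: compact_imp_bounded)
  then obtain B1 B2 where "\<forall>y\<in>F ` {-C1..C1}. \<bar>y\<bar> \<le> B1" "\<forall>y\<in>f ` {-C1..C1}. \<bar>y\<bar> \<le> B2"
    unfolding bounded_real by blast
  then have B: "\<bar>F s\<bar> \<le> B1" "\<bar>f s\<bar> \<le> B2" if "s \<in> {-C1..C1}" for s using that by blast+
  have PW: "P N W x \<in> {-C1..C1}" for N x using P_bound[OF W C1(1), of N x] by (auto simp: abs_le_iff)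
  have "(\<lambda>i. LINT x|J a b. f (P (r i) W x) * P (r i) Y x * e k x + F (P (r i) W x) * (of_int k * w * e (- k) x))
      \<longlonglongrightarrow> (LINT x|J a b. f (W x) * Y x * e k x + F (W x) * (of_int k * w * e (- k) x))"
  proof (rule J_dominated_convergence)
    show "AE x in J a b. (\<lambda>i. f (P (r i) W x) * P (r i) Y x * e k x + F (P (r i) W x) * (of_int k * w * e (- k) x))
        \<longlonglongrightarrow> f (W x) * Y x * e k x + F (W x) * (of_int k * w * e (- k) x)"
      using lim
    proof eventually_elim
      case (elim x)
      have "isCont f (W x)" "isCont F (W x)" using f Fc by (auto simp: continuous_on_eq_continuous_at)
      then show ?case using elim by (intro tendsto_intros isCont_tendsto_compose[of "W x" f] isCont_tendsto_compose[of "W x" F]) auto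
    qed
    show "\<bar>f (P (r i) W x) * P (r i) Y x * e k x + F (P (r i) W x) * (of_int k * w * e (- k) x)\<bar>
        \<le> B2 * C2 * 2 + B1 * (\<bar>of_int k * w\<bar> * 2)" for i x
    proof -
      have 1: "\<bar>f (P (r i) W x)\<bar> \<le> B2" "\<bar>F (P (r i) W x)\<bar> \<le> B1" "\<bar>P (r i) Y x\<bar> \<le> C2"
        using B PW P_bound[OF Y C2(1)] by auto
      then have 0: "0 \<le> B1" "0 \<le> B2" by linarith+
      have "\<bar>f (P (r i) W x) * P (r i) Y x * e k x\<bar> \<le> B2 * C2 * 2"
        unfolding abs_mult using 1 0 C2 e_bound by (intro mult_mono) auto
      moreover have "\<bar>F (P (r i) W x) * (of_int k * w * e (- k) x)\<bar> \<le> B1 * (\<bar>of_int k * w\<bar> * 2)"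
        unfolding abs_mult[of "F _"] abs_mult[of "of_int k * w"] using 1 0 e_bound by (intro mult_mono) auto
      ultimately show ?thesis by linarith
    qed
  qed (auto intro!: bb_measurable bb_add bb_mult bbFf bb_P bb_e bb_const W Y)
  then have "(LINT x|J a b. f (W x) * Y x * e k x + F (W x) * (of_int k * w * e (- k) x)) = 0"
    by (simp add: zero LIMSEQ_const_iff)
  also have "(LINT x|J a b. f (W x) * Y x * e k x + F (W x) * (of_int k * w * e (- k) x))
      = ip (\<lambda>x. f (W x) * Y x) (e k) + of_int k * w * ip (\<lambda>x. F (W x)) (e (- k))"
  proof -
    have "(LINT x|J a b. f (W x) * Y x * e k x + F (W x) * (of_int k * w * e (- k) x))
      = (LINT x|J a b. f (W x) * Y x * e k x) + (LINT x|J a b. F (W x) * (of_int k * w * e (- k) x))"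
      by (intro Bochner_Integration.integral_add bb_integrable bb_mult bbFf bb_e bb_const W Y)
    moreover have "(LINT x|J a b. F (W x) * (of_int k * w * e (- k) x))
      = (LINT x|J a b. (of_int k * w) * (F (W x) * e (- k) x))"
      by (simp add: mult_ac)
    ultimately show ?thesis by (simp add: ip_def)
  qed
  finally show "of_int k * w * ip (\<lambda>x. F (W x)) (e (- k)) = - ip (\<lambda>x. f (W x) * Y x) (e k)"
    by simp
qed

lemma sd_integral_zero:
  assumes "sd g g'"
  shows "(LINT x|J a b. g' x) = 0"
proof -
  have "e 0 = (\<lambda>x. 1)" by (simp add: e_def fun_eq_iff)
  then show ?thesis using assms[unfolded sd_def, rule_format, of 0] by (simp add: ip_def)
qed

end

section \<open>Evolution in weak form on the cylinder\<close>

lemma AE_J_ex: "AE t in J l r. Q t \<Longrightarrow> l < r \<Longrightarrow> \<exists>t. l < t \<and> t < r \<and> Q t"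
proof -
  assume Q: "AE t in J l r. Q t" and lr: "l < r"
  have "emeasure (J l r) (space (J l r)) \<noteq> 0"
    using lr by (simp add: emeasure_restrict_space space_J)
  then have "ae_filter (J l r) \<noteq> bot" by (simp add: ae_filter_eq_bot_iff)
  moreover have "AE t in J l r. l < t \<and> t < r" by (rule AE_I2) (simp add: space_J)
  then have "AE t in J l r. l < t \<and> t < r \<and> Q t" using Q by eventually_elim simp
  ultimately show ?thesis by (rule eventually_happens'[rotated, rotated] | simp add: eventually_happens')+
qed

lemma prim_affine_parts:
  assumes f: "bb f" and g: "bb g"
  shows "(p + prim l r f t) * (q + prim l r g t)
      = p * q + prim l r (\<lambda>s. f s * (q + prim l r g s) + (p + prim l r f s) * g s) t"
proof -
  have "prim l r (\<lambda>s. f s * (q + prim l r g s) + (p + prim l r f s) * g s) t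
      = prim l r (\<lambda>s. (q * f s + p * g s) + (f s * prim l r g s + prim l r f s * g s)) t"
    by (simp add: algebra_simps)
  also have "\<dots> = (q * prim l r f t + p * prim l r g t) + prim l r f t * prim l r g t"
    unfolding prim_parts[OF f g]
    by (simp add: prim_add prim_cmult bb_add bb_mult bb_const f g bb_prim)
  finally show ?thesis by (simp add: algebra_simps)
qed

lemma bb_swap:
  assumes "bb (g :: real \<times> real \<Rightarrow> real)"
  shows "bb (\<lambda>z. g (snd z, fst z))"
proof -
  have "(\<lambda>z::real \<times> real. (snd z, fst z)) \<in> borel \<rightarrow>\<^sub>M borel"
    by (intro borel_measurable_continuous_onI continuous_intros)
  then have "(\<lambda>z. g (snd z, fst z)) \<in> borel_measurable borel"
    by (rule measurable_compose) (rule bb_measurable[OF assms])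
  then show ?thesis using assms unfolding bb_def by blast
qed

definition sl :: "(real \<times> real \<Rightarrow> real) \<Rightarrow> real \<Rightarrow> real \<Rightarrow> real" where
  "sl g t x = g (t, x)"

lemma bb_sl: "bb g \<Longrightarrow> bb (sl g t)"
  unfolding sl_def[abs_def] by (rule bb_slice)

context circle
begin

lemma ip_add_left: "bb f \<Longrightarrow> bb g \<Longrightarrow> bb h \<Longrightarrow> ip (\<lambda>x. f x + g x) h = ip f h + ip g h"
  unfolding ip_def distrib_right
  by (intro Bochner_Integration.integral_add bb_integrable bb_mult)

lemma ip_cmult_left: "ip (\<lambda>x. c * f x) h = c * ip f h"
  by (simp add: ip_def mult.assoc)

lemma ip_diff_left: "bb f \<Longrightarrow> bb g \<Longrightarrow> bb h \<Longrightarrow> ip (\<lambda>x. f x - g x) h = ip f h - ip g h"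
  unfolding ip_def left_diff_distrib
  by (intro Bochner_Integration.integral_diff bb_integrable bb_mult)

lemma sd_add: "sd f f' \<Longrightarrow> sd g g' \<Longrightarrow> bb f \<Longrightarrow> bb f' \<Longrightarrow> bb g \<Longrightarrow> bb g' \<Longrightarrow>
    sd (\<lambda>x. f x + g x) (\<lambda>x. f' x + g' x)"
  unfolding sd_def by (simp add: ip_add_left bb_e distrib_left)

lemma sd_cmult: "sd f f' \<Longrightarrow> sd (\<lambda>x. c * f x) (\<lambda>x. c * f' x)"
  unfolding sd_def by (simp add: ip_cmult_left mult.left_commute)

lemma sd_zero: "sd (\<lambda>x. 0) (\<lambda>x. 0)"
  unfolding sd_def by (simp add: ip_def)

lemma sd_sum:
  assumes "\<And>i. i \<in> A \<Longrightarrow> sd (f i) (f' i)" "\<And>i. i \<in> A \<Longrightarrow> bb (f i)" "\<And>i. i \<in> A \<Longrightarrow> bb (f' i)"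
  shows "sd (\<lambda>x. \<Sum>i\<in>A. f i x) (\<lambda>x. \<Sum>i\<in>A. f' i x)"
  using assms
proof (induction A rule: infinite_finite_induct)
  case (insert i F)
  then show ?case by (simp add: sd_add bb_sum)
qed (simp_all add: sd_zero)

text \<open>Polarisation: the chain rule for s^2/2 shows that \<open>h * h'\<close> has integral
  zero, and this is applied to f, g and f + g.\<close>

lemma sd_mult_integral_zero:
  assumes "sd f f'" "sd g g'" and bb: "bb f" "bb f'" "bb g" "bb g'"
  shows "ip f g' + ip g f' = 0"
proof -
  have sq: "ip h h' = 0" if "sd h h'" "bb h" "bb h'" for h h'
  proof -
    have "sd (\<lambda>x. (h x)\<^sup>2 / 2) (\<lambda>x. h x * h' x)"
      by (rule sd_chain[OF that, where F = "\<lambda>s. s\<^sup>2 / 2" and f = "\<lambda>s. s"])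
        (auto intro!: derivative_eq_intros)
    from sd_integral_zero[OF this] show ?thesis by (simp add: ip_def)
  qed
  have "ip (\<lambda>x. f x + g x) (\<lambda>x. f' x + g' x) = 0"
    by (intro sq sd_add assms bb_add)
  moreover have "ip (\<lambda>x. f x + g x) (\<lambda>x. f' x + g' x) = ip f f' + ip g g' + (ip f g' + ip g f')"
  proof -
    have "ip (\<lambda>x. f x + g x) (\<lambda>x. f' x + g' x)
        = (LINT x|J a b. (f x * f' x + g x * g' x) + (f x * g' x + g x * f' x))"
      by (simp add: ip_def algebra_simps)
    also have "\<dots> = ip f f' + ip g g' + (ip f g' + ip g f')"
      by (simp add: ip_def Bochner_Integration.integral_add bb_integrable bb_add bb_mult bb)
    finally show ?thesis .
  qed
  ultimately show ?thesis using sq assms by simp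
qed

end

locale cylinder = circle +
  fixes T :: real
  assumes T_pos: "0 < T"
begin

lemma bb_ip:
  assumes "bb g" "bb h"
  shows "bb (\<lambda>t. ip (sl g t) (sl h t))"
  using bb_integral[OF bb_mult[OF assms], of a b] by (simp add: ip_def sl_def)

lemma bb_ip_right:
  assumes "bb g" "bb h"
  shows "bb (\<lambda>t. ip (sl g t) h)"
  using bb_integral[OF bb_mult[OF assms(1) bb_snd[OF assms(2)]], of a b] by (simp add: ip_def sl_def)

lemma bb_bil:
  assumes "bb g" "bb h"
  shows "bb (\<lambda>t. bil N (sl g t) (sl h t))"
  unfolding bil_def by (intro bb_sum bb_mult bb_const bb_ip_right bb_e assms)

text \<open>\<open>evol h G S hin\<close> is the weak form of \<open>h\<^sub>t + G\<^sub>x = S\<close> with initial value \<open>hin\<close>.\<close>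
definition evol :: "(real \<times> real \<Rightarrow> real) \<Rightarrow> (real \<times> real \<Rightarrow> real) \<Rightarrow> (real \<times> real \<Rightarrow> real)
    \<Rightarrow> (real \<Rightarrow> real) \<Rightarrow> bool" where
  "evol h G S hin \<longleftrightarrow> (\<forall>k. AE t in J 0 T. ip (sl h t) (e k) = ip hin (e k)
      + prim 0 T (\<lambda>s. of_int k * w * ip (sl G s) (e (- k)) + ip (sl S s) (e k)) t)"

text \<open>The case of \<open>evol\<close> without flux: \<open>V\<close> is the weak time
  derivative of \<open>h\<close>, and \<open>hin\<close> fixes the initial value.\<close>

definition tderiv :: "(real \<times> real \<Rightarrow> real) \<Rightarrow> (real \<times> real \<Rightarrow> real) \<Rightarrow> (real \<Rightarrow> real) \<Rightarrow> bool" where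
  "tderiv h V hin \<longleftrightarrow> (\<forall>k. AE t in J 0 T. ip (sl h t) (e k) = ip hin (e k)
      + prim 0 T (\<lambda>s. ip (sl V s) (e k)) t)"

lemma tderiv_evol: "tderiv h V hin \<Longrightarrow> evol h (\<lambda>z. 0) V hin"
  unfolding tderiv_def evol_def by (simp add: ip_def sl_def)

lemma tderiv_add:
  assumes "tderiv f f' fin" "tderiv g g' gin"
    and bb: "bb f" "bb f'" "bb fin" "bb g" "bb g'" "bb gin"
  shows "tderiv (\<lambda>z. f z + g z) (\<lambda>z. f' z + g' z) (\<lambda>x. fin x + gin x)"
  unfolding tderiv_def
proof
  fix k
  have sl: "sl (\<lambda>z. h z + h' z) t = (\<lambda>x. sl h t x + sl h' t x)" for h h' t
    by (simp add: sl_def fun_eq_iff)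
  have "AE t in J 0 T. ip (sl f t) (e k) = ip fin (e k) + prim 0 T (\<lambda>s. ip (sl f' s) (e k)) t"
    "AE t in J 0 T. ip (sl g t) (e k) = ip gin (e k) + prim 0 T (\<lambda>s. ip (sl g' s) (e k)) t"
    using assms(1,2) by (auto simp: tderiv_def)
  then show "AE t in J 0 T. ip (sl (\<lambda>z. f z + g z) t) (e k) = ip (\<lambda>x. fin x + gin x) (e k)
      + prim 0 T (\<lambda>s. ip (sl (\<lambda>z. f' z + g' z) s) (e k)) t"
    by eventually_elim (simp add: sl ip_add_left bb bb_sl bb_e prim_add bb_ip_right)
qed

lemma tderiv_cmult:
  assumes "tderiv f f' fin"
  shows "tderiv (\<lambda>z. c * f z) (\<lambda>z. c * f' z) (\<lambda>x. c * fin x)"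
  unfolding tderiv_def
proof
  fix k
  have sl: "sl (\<lambda>z. c * h z) t = (\<lambda>x. c * sl h t x)" for h t
    by (simp add: sl_def fun_eq_iff)
  have "AE t in J 0 T. ip (sl f t) (e k) = ip fin (e k) + prim 0 T (\<lambda>s. ip (sl f' s) (e k)) t"
    using assms by (auto simp: tderiv_def)
  then show "AE t in J 0 T. ip (sl (\<lambda>z. c * f z) t) (e k) = ip (\<lambda>x. c * fin x) (e k)
      + prim 0 T (\<lambda>s. ip (sl (\<lambda>z. c * f' z) s) (e k)) t"
    by eventually_elim (simp add: sl ip_cmult_left prim_cmult distrib_left)
qed

lemma tderiv_zero: "tderiv (\<lambda>z. 0) (\<lambda>z. 0) (\<lambda>x. 0)"
  unfolding tderiv_def by (simp add: ip_def sl_def prim_def)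

lemma tderiv_sum:
  assumes "\<And>i. i \<in> A \<Longrightarrow> tderiv (f i) (f' i) (fin i)"
    "\<And>i. i \<in> A \<Longrightarrow> bb (f i)" "\<And>i. i \<in> A \<Longrightarrow> bb (f' i)" "\<And>i. i \<in> A \<Longrightarrow> bb (fin i)"
  shows "tderiv (\<lambda>z. \<Sum>i\<in>A. f i z) (\<lambda>z. \<Sum>i\<in>A. f' i z) (\<lambda>x. \<Sum>i\<in>A. fin i x)"
  using assms
proof (induction A rule: infinite_finite_induct)
  case (insert i F)
  then show ?case by (simp add: tderiv_add bb_sum)
qed (simp_all add: tderiv_zero)

text \<open>For each frequency the coefficients of both factors are primitives in time up to null
  sets, so their product obeys \<open>prim_affine_parts\<close>. In the weighted sum over
  frequencies \<open>sd_bil\<close> shifts the x-derivative from the flux \<open>G\<close> to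
  \<open>W\<close>. All derivatives thus fall on \<open>W\<close>, and \<open>h\<close> stays merely
  bounded.\<close>

lemma product_rule:
  assumes h: "evol h G S hin" and W: "tderiv W V Win" and Y: "AE t in J 0 T. sd (sl W t) (sl Y t)"
    and bb: "bb h" "bb G" "bb S" "bb hin" "bb W" "bb V" "bb Win" "bb Y"
  shows "AE t in J 0 T. ip (sl h t) (sl W t) = ip hin Win
      + prim 0 T (\<lambda>s. ip (sl G s) (sl Y s) + ip (sl S s) (sl W s) + ip (sl h s) (sl V s)) t"
proof -
  define \<alpha> where "\<alpha> k s = of_int k * w * ip (sl G s) (e (- k)) + ip (sl S s) (e k)" for k s
  define \<beta> where "\<beta> k s = ip (sl V s) (e k)" for k s
  have bb\<alpha>: "bb (\<alpha> k)" for k unfolding \<alpha>_def by (intro bb_add bb_mult bb_const bb_ip_right bb bb_e)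
  have bb\<beta>: "bb (\<beta> k)" for k unfolding \<beta>_def by (intro bb_ip_right bb bb_e)
  have bbk: "bb (\<lambda>t. ip (sl f t) (e k))" if "bb f" for f k by (intro bb_ip_right bb_e that)
  have hk: "AE t in J 0 T. \<forall>k. ip (sl h t) (e k) = ip hin (e k) + prim 0 T (\<alpha> k) t"
    using h by (simp add: evol_def AE_all_countable \<alpha>_def[abs_def])
  have Wk: "AE t in J 0 T. \<forall>k. ip (sl W t) (e k) = ip Win (e k) + prim 0 T (\<beta> k) t"
    using W by (simp add: tderiv_def AE_all_countable \<beta>_def[abs_def])
  let ?D = "\<lambda>N s. bil N (sl G s) (sl Y s) + bil N (sl S s) (sl W s) + bil N (sl h s) (sl V s)"
  have bbD: "bb (?D N)" for N by (intro bb_add bb_bil bb)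
  have "AE t in J 0 T. bil N (sl h t) (sl W t) = bil N hin Win + prim 0 T (?D N) t" for N
    using hk Wk
  proof eventually_elim
    case (elim t)
    have prod: "ip (sl h t) (e k) * ip (sl W t) (e k) = ip hin (e k) * ip Win (e k)
        + prim 0 T (\<lambda>s. \<alpha> k s * ip (sl W s) (e k) + ip (sl h s) (e k) * \<beta> k s) t" for k
    proof -
      have "ip (sl h t) (e k) * ip (sl W t) (e k)
          = (ip hin (e k) + prim 0 T (\<alpha> k) t) * (ip Win (e k) + prim 0 T (\<beta> k) t)"
        using elim by simp
      also have "\<dots> = ip hin (e k) * ip Win (e k) + prim 0 T (\<lambda>s. \<alpha> k s * (ip Win (e k) + prim 0 T (\<beta> k) s)
          + (ip hin (e k) + prim 0 T (\<alpha> k) s) * \<beta> k s) t"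
        by (rule prim_affine_parts) (rule bb\<alpha> bb\<beta>)+
      also have "prim 0 T (\<lambda>s. \<alpha> k s * (ip Win (e k) + prim 0 T (\<beta> k) s)
          + (ip hin (e k) + prim 0 T (\<alpha> k) s) * \<beta> k s) t
          = prim 0 T (\<lambda>s. \<alpha> k s * ip (sl W s) (e k) + ip (sl h s) (e k) * \<beta> k s) t"
      proof (rule prim_cong_AE)
        show "AE s in J 0 T. \<alpha> k s * (ip Win (e k) + prim 0 T (\<beta> k) s)
          + (ip hin (e k) + prim 0 T (\<alpha> k) s) * \<beta> k s = \<alpha> k s * ip (sl W s) (e k) + ip (sl h s) (e k) * \<beta> k s"
          using hk Wk by eventually_elim simp
      qed (intro bb_add bb_mult bb\<alpha> bb\<beta> bb_prim bbk bb bb_const)+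
      finally show ?thesis .
    qed
    have "bil N (sl h t) (sl W t) = bil N hin Win
        + (\<Sum>k\<in>freqs N. prim 0 T (\<lambda>s. gam N k * (\<alpha> k s * ip (sl W s) (e k) + ip (sl h s) (e k) * \<beta> k s)) t)"
      unfolding bil_def prod prim_cmult sum.distrib[symmetric] by (simp only: distrib_left)
    also have "(\<Sum>k\<in>freqs N. prim 0 T (\<lambda>s. gam N k * (\<alpha> k s * ip (sl W s) (e k) + ip (sl h s) (e k) * \<beta> k s)) t)
        = prim 0 T (\<lambda>s. \<Sum>k\<in>freqs N. gam N k * (\<alpha> k s * ip (sl W s) (e k) + ip (sl h s) (e k) * \<beta> k s)) t"
      by (rule prim_sum[symmetric]) (intro bb_mult bb_const bb_add bb\<alpha> bb\<beta> bbk bb)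
    also have "\<dots> = prim 0 T (?D N) t"
    proof (rule prim_cong_AE)
      show "AE s in J 0 T. (\<Sum>k\<in>freqs N. gam N k * (\<alpha> k s * ip (sl W s) (e k) + ip (sl h s) (e k) * \<beta> k s)) = ?D N s"
        using Y
      proof eventually_elim
        case (elim s)
        have "(\<Sum>k\<in>freqs N. gam N k * (\<alpha> k s * ip (sl W s) (e k) + ip (sl h s) (e k) * \<beta> k s))
            = (\<Sum>k\<in>freqs N. gam N k * ((of_int k * w * ip (sl G s) (e (- k))) * ip (sl W s) (e k)))
              + bil N (sl S s) (sl W s) + bil N (sl h s) (sl V s)"
          unfolding bil_def sum.distrib[symmetric] \<alpha>_def \<beta>_def by (simp add: algebra_simps)
        then show ?case by (simp only: sd_bil[OF elim])
      qed
    qed (intro bbD bb_sum bb_mult bb_const bb_add bb\<alpha> bb\<beta> bbk bb)+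
    finally show ?case .
  qed
  then have "AE t in J 0 T. \<forall>N. bil N (sl h t) (sl W t) = bil N hin Win + prim 0 T (?D N) t"
    by (simp add: AE_all_countable)
  then show ?thesis
  proof eventually_elim
    case (elim t)
    let ?d = "\<lambda>s. ip (sl G s) (sl Y s) + ip (sl S s) (sl W s) + ip (sl h s) (sl V s)"
    have bbd: "bb ?d" by (intro bb_add bb_ip bb)
    obtain cG cY cS cW ch cV where c: "\<And>z. \<bar>G z\<bar> \<le> cG" "\<And>z. \<bar>Y z\<bar> \<le> cY" "\<And>z. \<bar>S z\<bar> \<le> cS"
      "\<And>z. \<bar>W z\<bar> \<le> cW" "\<And>z. \<bar>h z\<bar> \<le> ch" "\<And>z. \<bar>V z\<bar> \<le> cV"
      using bb by (metis bb_bound)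
    \<comment> \<open>The bound on the bilinear means is uniform in N and s, as dominated
      convergence in time requires.\<close>
    have bound: "\<bar>?D N s\<bar> \<le> cG * cY * (b - a) + cS * cW * (b - a) + ch * cV * (b - a)" for N s
    proof -
      have "\<bar>bil N (sl G s) (sl Y s)\<bar> \<le> cG * cY * (b - a)" "\<bar>bil N (sl S s) (sl W s)\<bar> \<le> cS * cW * (b - a)"
        "\<bar>bil N (sl h s) (sl V s)\<bar> \<le> ch * cV * (b - a)"
        by (intro bil_bound bb_sl bb; simp add: sl_def c)+
      then show ?thesis by linarith
    qed
    have "(\<lambda>N. prim 0 T (?D N) t) \<longlonglongrightarrow> prim 0 T ?d t"
      unfolding prim_def
    proof (rule J_dominated_convergence)
      show "AE x in J 0 T. (\<lambda>n. indicator {..<t} x * ?D n x) \<longlonglongrightarrow> indicator {..<t} x * ?d x"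
        by (intro AE_I2 tendsto_intros bil_tendsto bb_sl bb)
      show "\<bar>indicator {..<t} s * ?D N s\<bar> \<le> cG * cY * (b - a) + cS * cW * (b - a) + ch * cV * (b - a)" for N s
        using bound[of N s] by (subst mult.commute) (rule abs_mult_le, auto simp: indicator_def)
    qed (intro bb_measurable bb_cut bbd bbD)+
    then have "(\<lambda>N. bil N hin Win + prim 0 T (?D N) t) \<longlonglongrightarrow> ip hin Win + prim 0 T ?d t"
      by (intro tendsto_intros bil_tendsto bb)
    moreover have "(\<lambda>N. bil N (sl h t) (sl W t)) \<longlonglongrightarrow> ip (sl h t) (sl W t)"
      by (intro bil_tendsto bb_sl bb)
    ultimately show ?case using elim by (simp add: LIMSEQ_unique)
  qed
qed

text \<open>The constants \<open>c k\<close> have to be recognised as the Fourier coefficients of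
  one bounded function. At a single time \<open>t0\<close> at which all of the countably many
  identities hold, \<open>W\<close> minus the time integral of \<open>V\<close> up to
  \<open>t0\<close> is such a function.\<close>

lemma tderiv_trace:
  assumes W: "bb W" and V: "bb V"
    and "\<And>k. \<exists>c. AE t in J 0 T. ip (sl W t) (e k) = c + prim 0 T (\<lambda>s. ip (sl V s) (e k)) t"
  shows "\<exists>Win. bb Win \<and> tderiv W V Win"
proof -
  obtain c where c: "\<And>k. AE t in J 0 T. ip (sl W t) (e k) = c k + prim 0 T (\<lambda>s. ip (sl V s) (e k)) t"
    using assms(3) by metis
  then have "AE t in J 0 T. \<forall>k. ip (sl W t) (e k) = c k + prim 0 T (\<lambda>s. ip (sl V s) (e k)) t"
    by (simp add: AE_all_countable)
  from AE_J_ex[OF this T_pos] obtain t0 where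
    t0: "\<And>k. ip (sl W t0) (e k) = c k + prim 0 T (\<lambda>s. ip (sl V s) (e k)) t0" by blast
  define I where "I x = prim 0 T (\<lambda>s. V (s, x)) t0" for x
  have bbI: "bb I"
  proof -
    have "bb (\<lambda>z. indicator {..<t0} (snd z) * V (snd z, fst z))"
      by (intro bb_mult bb_snd bb_indicator bb_swap V) auto
    from bb_integral[OF this, of 0 T] show ?thesis by (simp add: I_def[abs_def] prim_def)
  qed
  have ipI: "ip I (e k) = prim 0 T (\<lambda>s. ip (sl V s) (e k)) t0" for k
  proof -
    have bbg: "bb (\<lambda>z. indicator {..<t0} (fst z) * V z * e k (snd z))"
      by (intro bb_mult bb_fst bb_snd bb_indicator V bb_e) auto
    have "ip I (e k) = (LINT x|J a b. LINT s|J 0 T. indicator {..<t0} s * V (s, x) * e k x)"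
      by (simp add: ip_def I_def prim_def)
    also have "\<dots> = (LINT s|J 0 T. LINT x|J a b. indicator {..<t0} s * V (s, x) * e k x)"
      using bb_Fubini[OF bbg, of a b 0 T] by simp
    also have "\<dots> = prim 0 T (\<lambda>s. ip (sl V s) (e k)) t0"
      by (simp add: prim_def ip_def sl_def mult.assoc)
    finally show ?thesis .
  qed
  have "ip (\<lambda>x. sl W t0 x - I x) (e k) = c k" for k
    using t0[of k] ipI[of k] by (simp add: ip_diff_left bb_sl W bbI bb_e)
  then have "tderiv W V (\<lambda>x. sl W t0 x - I x)"
    unfolding tderiv_def using c by simp
  moreover have "bb (\<lambda>x. sl W t0 x - I x)" by (intro bb_diff bb_sl W bbI)
  ultimately show ?thesis by blast
qed

text \<open>The equality is split into two inequalities, for the coefficient and for its negative,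
  so that \<open>weak_upper_bound\<close> identifies the initial value along with the
  evolution.\<close>

lemma weak_imp_evol:
  assumes bb: "bb h" "bb G" "bb S"
    and weak: "\<And>\<theta> \<theta>' s k. smooth1 \<theta> \<Longrightarrow> bb \<theta> \<Longrightarrow> (\<And>x. (\<theta> has_real_derivative \<theta>' x) (at x)) \<Longrightarrow> bb \<theta>' \<Longrightarrow>
      s < T \<Longrightarrow> (\<And>t. t \<ge> s \<Longrightarrow> \<theta> t = 0) \<Longrightarrow>
      (LINT t|J 0 T. ip (sl h t) (e k) * \<theta>' t
        + (of_int k * w * ip (sl G t) (e (- k)) + ip (sl S t) (e k)) * \<theta> t) + ip hin (e k) * \<theta> 0 = 0"
  shows "evol h G S hin"
  unfolding evol_def
proof
  fix k
  let ?A = "\<lambda>t. ip (sl h t) (e k)"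
  let ?B = "\<lambda>t. of_int k * w * ip (sl G t) (e (- k)) + ip (sl S t) (e k)"
  have A: "bb ?A" and B: "bb ?B" by (intro bb_add bb_mult bb_const bb_ip_right bb bb_e)+
  have "AE t in J 0 T. ?A t \<le> ip hin (e k) + prim 0 T ?B t"
    by (rule weak_upper_bound[OF A B T_pos]) (use weak in force)
  moreover have "AE t in J 0 T. - ?A t \<le> - ip hin (e k) + prim 0 T (\<lambda>s. - ?B s) t"
  proof (rule weak_upper_bound[OF bb_minus[OF A] bb_minus[OF B] T_pos])
    fix \<theta> \<theta>' s
    assume *: "smooth1 \<theta>" "bb \<theta>" "\<And>x. (\<theta> has_real_derivative \<theta>' x) (at x)" "bb \<theta>'"
      "s < T" "\<And>t. t \<ge> s \<Longrightarrow> \<theta> t = 0"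
    have "(LINT t|J 0 T. - ?A t * \<theta>' t + - ?B t * \<theta> t) = (LINT t|J 0 T. - (?A t * \<theta>' t + ?B t * \<theta> t))"
      by (simp add: algebra_simps)
    also have "\<dots> = - (LINT t|J 0 T. ?A t * \<theta>' t + ?B t * \<theta> t)"
      by (rule Bochner_Integration.integral_minus)
    finally show "0 \<le> (LINT t|J 0 T. - ?A t * \<theta>' t + - ?B t * \<theta> t) + - ip hin (e k) * \<theta> 0"
      using weak[OF *, of k] by simp
  qed
  ultimately show "AE t in J 0 T. ?A t = ip hin (e k) + prim 0 T ?B t"
  proof eventually_elim
    case (elim t)
    have "prim 0 T (\<lambda>s. - ?B s) t = - prim 0 T ?B t"
      using prim_cmult[of 0 T "-1" ?B t] by simp
    then show ?case using elim by linarith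
  qed
qed

end

lemma deriv_zero_outside:
  assumes D: "\<And>x. (\<theta> has_real_derivative \<theta>' x) (at x)"
    and z: "\<And>t. t \<le> r \<or> s \<le> t \<Longrightarrow> \<theta> t = (0::real)" and t: "t < r \<or> s < t"
  shows "\<theta>' t = 0"
proof -
  have "((\<lambda>x. 0) has_real_derivative 0) (at t)" by simp
  then have "(\<theta> has_real_derivative 0) (at t)"
    by (rule has_field_derivative_transform_within_open[of _ _ _ "{..<r} \<union> {s<..}"]) (use t z in auto)
  then show ?thesis using D DERIV_unique by blast
qed

section \<open>Borel representatives and iterated integrals\<close>

lemma measurable_lebesgue_on: "g \<in> borel_measurable borel \<Longrightarrow> g \<in> borel_measurable (lebesgue_on S)"
  by (intro measurable_restrict_space1 measurable_completion) simp

lemma AE_lebesgue_on_iff: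
  assumes "S \<in> sets borel"
  shows "(AE z in lebesgue_on S. Q z) \<longleftrightarrow> (AE z in lborel. z \<in> S \<longrightarrow> Q z)"
proof -
  have "S \<inter> space lebesgue \<in> sets lebesgue" using assms by simp
  then show ?thesis by (subst AE_restrict_space_iff) (simp_all add: AE_completion_iff)
qed

lemma AE_lebesgue_on_J: "(AE x in lebesgue_on {l<..<r}. Q x) \<longleftrightarrow> (AE x in J l r. Q x)"
  by (simp add: AE_lebesgue_on_iff AE_J_iff)

lemma integral_lebesgue_on:
  fixes g :: "'a::euclidean_space \<Rightarrow> real"
  assumes "S \<in> sets borel" "g \<in> borel_measurable borel"
  shows "(LINT z|lebesgue_on S. g z) = (LINT z|lborel. indicator S z * g z)"
proof -
  have "(LINT z|lebesgue_on S. g z) = (LINT z|lebesgue. indicator S z *\<^sub>R g z)"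
    using assms(1) by (intro integral_restrict_space) simp
  also have "\<dots> = (LINT z|lborel. indicator S z *\<^sub>R g z)"
    using assms by (intro integral_completion borel_measurable_scaleR borel_measurable_indicator) auto
  finally show ?thesis by simp
qed

lemma integral_lebesgue_on_J:
  "g \<in> borel_measurable borel \<Longrightarrow> (LINT x|lebesgue_on {l<..<r}. g x) = (LINT x|J l r. g x :: real)"
  by (subst integral_lebesgue_on) (simp_all add: J_integral_lborel)

text \<open>A Borel function equal almost everywhere exists since Lebesgue measure is a completion;
  clamping it at the essential bound makes it bounded everywhere and changes it only on a null
  subset of \<open>S\<close>.\<close>

lemma Linf_representative:
  fixes g :: "'a::euclidean_space \<Rightarrow> real"
  assumes S: "S \<in> sets borel" and g: "Linf (lebesgue_on S) g"
  obtains g' where "bb g'" "AE z in lebesgue_on S. g z = g' z"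
proof -
  obtain C where C: "AE z in lebesgue_on S. \<bar>g z\<bar> \<le> C" and gm: "g \<in> borel_measurable (lebesgue_on S)"
    using g unfolding Linf_def by auto
  have "(\<lambda>z. indicator S z *\<^sub>R g z) \<in> borel_measurable lebesgue"
    using S gm by (subst borel_measurable_restrict_space_iff[symmetric]) auto
  from completion_ex_borel_measurable_real[OF this[unfolded real_scaleR_def]]
  obtain g1 where g1: "g1 \<in> borel_measurable lborel" "AE z in lborel. indicator S z * g z = g1 z" by auto
  define g' where "g' z = max (- \<bar>C\<bar>) (min \<bar>C\<bar> (g1 z))" for z
  have "bb g'"
  proof (rule bbI[of _ "\<bar>C\<bar>"])
    have [measurable]: "g1 \<in> borel_measurable borel" using g1(1) by simp
    show "g' \<in> borel_measurable borel" unfolding g'_def by measurable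
  qed (auto simp: g'_def)
  moreover have "AE z in lebesgue_on S. g z = g' z"
    using C g1(2) unfolding AE_lebesgue_on_iff[OF S]
    by eventually_elim (auto simp: g'_def)
  ultimately show ?thesis by (rule that)
qed

lemma continuous_imp_bb_cut:
  fixes A :: "real \<Rightarrow> real"
  assumes "continuous_on UNIV A"
  shows "bb (\<lambda>t. indicator {l<..<r} t * A t)"
proof -
  have "bounded (A ` {l..r})"
    by (intro compact_imp_bounded compact_continuous_image continuous_on_subset[OF assms]) auto
  then obtain B where B: "\<forall>y\<in>A ` {l..r}. \<bar>y\<bar> \<le> B" unfolding bounded_real by blast
  have [measurable]: "A \<in> borel_measurable borel" by (rule borel_measurable_continuous_onI[OF assms])
  show ?thesis
    by (rule bbI[of _ "\<bar>B\<bar>"]) (use B in \<open>auto simp: indicator_def intro: order_trans[OF _ abs_ge_self]\<close>)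
qed

lemma bb_lipschitz_prim:
  assumes "bb g" "l \<le> t" "t \<le> r" "\<And>x. \<bar>g x\<bar> \<le> C"
  shows "\<bar>prim l r g t\<bar> \<le> C * (t - l)"
  unfolding prim_J[OF assms(3)] using assms by (intro J_integral_bound bb_measurable) auto

context cylinder
begin

lemma cyl_borel: "{0<..<T} \<times> {a<..<b} \<in> sets (borel :: (real \<times> real) measure)"
  by (intro borel_open open_Times) auto

lemma AE_cyl_iterated:
  assumes "AE z in cyl T a b. Q z"
  shows "AE t in J 0 T. AE x in J a b. Q (t, x)"
proof -
  have "AE z in lborel \<Otimes>\<^sub>M lborel. z \<in> {0<..<T} \<times> {a<..<b} \<longrightarrow> Q z"
    using assms unfolding AE_lebesgue_on_iff[OF cyl_borel] lborel_prod .
  from lborel_pair.AE_pair[OF this]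
  have "AE t in lborel. AE x in lborel. (t, x) \<in> {0<..<T} \<times> {a<..<b} \<longrightarrow> Q (t, x)" .
  then show ?thesis unfolding AE_J_iff
    by eventually_elim (auto elim!: eventually_mono)
qed

lemma cyl_integral:
  assumes g: "bb g"
  shows "(LINT z|cyl T a b. g z) = (LINT t|J 0 T. LINT x|J a b. g (t, x))"
proof -
  let ?S = "{0<..<T} \<times> {a<..<b}"
  obtain C where C: "\<And>z. \<bar>g z\<bar> \<le> C" "C \<ge> 0" using bb_bound[OF g] by metis
  have gm: "g \<in> borel_measurable borel" by (rule bb_measurable[OF g])
  have fin: "emeasure (lborel :: (real \<times> real) measure) ?S < \<infinity>"
    by (intro emeasure_bounded_finite bounded_Times) auto
  have int: "integrable lborel (\<lambda>z. indicator ?S z * g z)"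
    by (rule integrableI_bounded_set[where A = ?S and B = C])
      (use cyl_borel gm fin C in \<open>auto simp: indicator_def\<close>)
  have "(LINT z|cyl T a b. g z) = (LINT z|lborel. indicator ?S z * g z)"
    by (rule integral_lebesgue_on[OF cyl_borel gm])
  also have "\<dots> = (LINT t|lborel. LINT x|lborel. indicator ?S (t, x) * g (t, x))"
    unfolding lborel_prod[symmetric]
    by (rule lborel_pair.integral_fst'[symmetric]) (simp add: lborel_prod int)
  also have "\<dots> = (LINT t|lborel. indicator {0<..<T} t * (LINT x|lborel. indicator {a<..<b} x * g (t, x)))"
    by (simp add: indicator_times mult.assoc)
  finally show ?thesis by (simp add: J_integral_lborel)
qed

text \<open>\<open>A\<close> and \<open>B\<close> may be unbounded on the line, so both are cut off
  to the cylinder before Fubini; inside, the cut-offs change nothing.\<close>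

lemma cyl_integral_prod:
  assumes v: "bb v" and A: "continuous_on UNIV A" and B: "continuous_on UNIV B"
  shows "(LINT z|cyl T a b. v z * (A (fst z) * B (snd z))) = (LINT t|J 0 T. ip (sl v t) B * A t)"
proof -
  let ?A = "\<lambda>t. indicator {0<..<T} t * A t" and ?B = "\<lambda>x. indicator {a<..<b} x * B x"
  have bb: "bb (\<lambda>z. v z * (?A (fst z) * ?B (snd z)))"
    by (intro bb_mult[OF v] bb_mult[OF bb_fst bb_snd] continuous_imp_bb_cut A B)
  have "(LINT z|cyl T a b. v z * (A (fst z) * B (snd z))) = (LINT z|cyl T a b. v z * (?A (fst z) * ?B (snd z)))"
    by (rule Bochner_Integration.integral_cong) (auto simp: space_restrict_space)
  also have "\<dots> = (LINT t|J 0 T. LINT x|J a b. v (t, x) * (?A t * ?B x))"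
    using cyl_integral[OF bb] by simp
  also have "\<dots> = (LINT t|J 0 T. ip (sl v t) B * A t)"
  proof (rule Bochner_Integration.integral_cong[OF refl])
    fix t assume "t \<in> space (J 0 T)"
    have "(LINT x|J a b. v (t, x) * (?A t * ?B x)) = (LINT x|J a b. (sl v t x * B x) * A t)"
      by (rule Bochner_Integration.integral_cong) (use \<open>t \<in> _\<close> in \<open>auto simp: space_J sl_def\<close>)
    then show "(LINT x|J a b. v (t, x) * (?A t * ?B x)) = ip (sl v t) B * A t"
      by (simp add: ip_def)
  qed
  finally show ?thesis .
qed

definition rep :: "(real \<times> real \<Rightarrow> real) \<Rightarrow> (real \<times> real \<Rightarrow> real) \<Rightarrow> bool" where
  "rep g g' \<longleftrightarrow> bb g' \<and> (AE z in cyl T a b. g z = g' z)"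

lemma rep_exists: "Linf (cyl T a b) g \<Longrightarrow> \<exists>g'. rep g g'"
  using Linf_representative[OF cyl_borel, of g] unfolding rep_def by metis

lemma rep_slice: "rep g g' \<Longrightarrow> AE t in J 0 T. AE x in J a b. g (t, x) = sl g' t x"
  unfolding rep_def sl_def using AE_cyl_iterated by blast

lemma cyl_integral_rep:
  assumes "Linf (cyl T a b) v" "rep v v'" "continuous_on UNIV A" "continuous_on UNIV B"
  shows "(LINT z|cyl T a b. v z * (A (fst z) * B (snd z))) = (LINT t|J 0 T. ip (sl v' t) B * A t)"
proof -
  have [measurable]: "v \<in> borel_measurable (cyl T a b)" using assms(1) by (simp add: Linf_def)
  have bb': "bb v'" using assms(2) by (simp add: rep_def)
  have [measurable]: "v' \<in> borel_measurable (cyl T a b)"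
    by (rule measurable_lebesgue_on[OF bb_measurable[OF bb']])
  have [measurable]: "(\<lambda>z::real \<times> real. A (fst z) * B (snd z)) \<in> borel_measurable (cyl T a b)"
    by (intro measurable_lebesgue_on borel_measurable_continuous_onI continuous_intros
        continuous_on_compose2[OF assms(3)] continuous_on_compose2[OF assms(4)]) auto
  have "(LINT z|cyl T a b. v z * (A (fst z) * B (snd z))) = (LINT z|cyl T a b. v' z * (A (fst z) * B (snd z)))"
    by (rule integral_cong_AE) (use assms(2) in \<open>auto simp: rep_def elim!: eventually_mono\<close>)
  then show ?thesis using cyl_integral_prod[OF bb' assms(3,4)] by simp
qed

lemma circ_integral_rep:
  assumes "Linf (circ a b) g" "bb g'" "AE x in J a b. g x = g' x" "continuous_on UNIV \<phi>"
  shows "(LINT x|circ a b. g x * \<phi> x) = ip g' \<phi>"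
proof -
  have [measurable]: "g \<in> borel_measurable (circ a b)" using assms(1) by (simp add: Linf_def)
  have gm: "g' \<in> borel_measurable borel" "\<phi> \<in> borel_measurable borel"
    using bb_measurable[OF assms(2)] borel_measurable_continuous_onI[OF assms(4)] by auto
  note [measurable] = gm[THEN measurable_lebesgue_on[of _ "{a<..<b}"]]
  have "(LINT x|circ a b. g x * \<phi> x) = (LINT x|circ a b. g' x * \<phi> x)"
    by (rule integral_cong_AE) (use assms(3) in \<open>auto simp: AE_lebesgue_on_J elim!: eventually_mono\<close>)
  then show ?thesis using gm by (simp add: integral_lebesgue_on_J ip_def)
  qed

section \<open>Product test functions\<close>

lemma minus_one_power_cancel: "(-1) ^ n * x = (-1) ^ Suc n * y \<Longrightarrow> x = - (y :: real)"
  by (cases "even n") auto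

definition pf :: "(real \<Rightarrow> real) \<Rightarrow> (real \<Rightarrow> real) \<Rightarrow> real \<times> real \<Rightarrow> real" where
  "pf \<theta> \<psi> z = \<theta> (fst z) * \<psi> (snd z)"

lemma dt_pf: "smooth1 \<theta> \<Longrightarrow> dt (pf \<theta> \<psi>) = pf (deriv \<theta>) \<psi>"
  unfolding dt_def pf_def
  by (auto intro!: ext DERIV_imp_deriv derivative_eq_intros smooth1_deriv)

lemma dx_pf: "smooth1 \<psi> \<Longrightarrow> dx (pf \<theta> \<psi>) = pf \<theta> (deriv \<psi>)"
  unfolding dx_def pf_def
  by (auto intro!: ext DERIV_imp_deriv derivative_eq_intros smooth1_deriv)

lemma dx_funpow_pf: "smooth1 \<psi> \<Longrightarrow> (dx ^^ j) (pf \<theta> \<psi>) = pf \<theta> ((deriv ^^ j) \<psi>)"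
  by (induction j) (simp_all add: dx_pf smooth1_funpow)

lemma dt_funpow_pf: "smooth1 \<theta> \<Longrightarrow> (dt ^^ i) (pf \<theta> \<psi>) = pf ((deriv ^^ i) \<theta>) \<psi>"
  by (induction i) (simp_all add: dt_pf smooth1_funpow)

lemma smooth2_pf:
  assumes "smooth1 \<theta>" "smooth1 \<psi>"
  shows "smooth2 (pf \<theta> \<psi>)"
  unfolding smooth2_def
proof (intro exI[of _ "\<lambda>i j. pf ((deriv ^^ i) \<theta>) ((deriv ^^ j) \<psi>)"] conjI allI)
  fix i j t x
  show "continuous_on UNIV (pf ((deriv ^^ i) \<theta>) ((deriv ^^ j) \<psi>))"
    unfolding pf_def[abs_def]
    by (intro continuous_intros continuous_on_compose2[OF smooth1_continuous_on[OF smooth1_funpow]] assms) auto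
  show "((\<lambda>s. pf ((deriv ^^ i) \<theta>) ((deriv ^^ j) \<psi>) (s, x)) has_real_derivative
      pf ((deriv ^^ Suc i) \<theta>) ((deriv ^^ j) \<psi>) (t, x)) (at t)"
    unfolding pf_def fst_conv snd_conv
    by (rule DERIV_cmult_right) (rule smooth1_derivs[OF assms(1)])
  show "((\<lambda>y. pf ((deriv ^^ i) \<theta>) ((deriv ^^ j) \<psi>) (t, y)) has_real_derivative
      pf ((deriv ^^ i) \<theta>) ((deriv ^^ Suc j) \<psi>) (t, x)) (at x)"
    unfolding pf_def fst_conv snd_conv
    by (rule DERIV_cmult) (rule smooth1_derivs[OF assms(2)])
qed (simp_all)

definition circ_test :: "(real \<Rightarrow> real) \<Rightarrow> bool" where
  "circ_test \<psi> \<longleftrightarrow> smooth1 \<psi> \<and> (\<forall>x. \<psi> (x + (b - a)) = \<psi> x)"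

lemma circ_test_e: "circ_test (e k)"
  using e_smooth e_periodic by (simp add: circ_test_def)

lemma circ_test_deriv_e: "circ_test (deriv (e k))"
  using e_smooth e_periodic by (simp add: circ_test_def deriv_e smooth1_cmult)

lemma circ_test_1: "circ_test (\<lambda>x. 1)"
  by (simp add: circ_test_def smooth1_const)

lemma test_init_pf:
  "smooth1 \<theta> \<Longrightarrow> circ_test \<psi> \<Longrightarrow> s < T \<Longrightarrow> (\<And>t. t \<ge> s \<Longrightarrow> \<theta> t = 0) \<Longrightarrow> test_init T a b (pf \<theta> \<psi>)"
  unfolding test_init_def circ_test_def using smooth2_pf by (auto simp: pf_def)

lemma test_cyl_pf:
  assumes "smooth1 \<theta>" "circ_test \<psi>" "0 < r" "s < T" "\<And>t. t \<le> r \<or> t \<ge> s \<Longrightarrow> \<theta> t = 0"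
  shows "test_cyl T a b (pf \<theta> \<psi>)"
  unfolding test_cyl_def using test_init_pf[OF assms(1,2,4)] assms(3,5) by (auto simp: pf_def)

text \<open>Time and space derivatives act on separate factors of a product test, which turns the
  identity on the cylinder into one between time integrals of spatial coefficients.\<close>

lemma wderiv_cyl_pf:
  assumes wd: "wderiv_cyl T a b i j v g" and rep: "rep v v'" "rep g g'"
    and \<theta>: "smooth1 \<theta>" "0 < r" "s < T" "\<And>t. t \<le> r \<or> t \<ge> s \<Longrightarrow> \<theta> t = 0" and \<psi>: "circ_test \<psi>"
  shows "(LINT t|J 0 T. ip (sl v' t) ((deriv ^^ j) \<psi>) * (deriv ^^ i) \<theta> t)
      = (-1) ^ (i + j) * (LINT t|J 0 T. ip (sl g' t) \<psi> * \<theta> t)"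
proof -
  have s\<psi>: "smooth1 \<psi>" using \<psi> by (simp add: circ_test_def)
  have L: "Linf (cyl T a b) v" "Linf (cyl T a b) g" using wd by (simp_all add: wderiv_cyl_def)
  have "(LINT z|cyl T a b. v z * (dt ^^ i) ((dx ^^ j) (pf \<theta> \<psi>)) z)
      = (-1) ^ (i + j) * (LINT z|cyl T a b. g z * pf \<theta> \<psi> z)"
    using wd test_cyl_pf[OF \<theta>(1) \<psi> \<theta>(2-4)] by (auto simp: wderiv_cyl_def)
  then show ?thesis
    using cyl_integral_rep[OF L(1) rep(1), of "(deriv ^^ i) \<theta>" "(deriv ^^ j) \<psi>"]
      cyl_integral_rep[OF L(2) rep(2), of \<theta> \<psi>]
    by (simp add: dx_funpow_pf dt_funpow_pf s\<psi> \<theta>(1) pf_def smooth1_continuous_on smooth1_funpow)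
qed

lemma bump_test:
  assumes "0 < c" "c < d" "d < T"
  shows "smooth1 (bump c d n)" "\<And>t. t \<le> c \<or> t \<ge> d \<Longrightarrow> bump c d n t = 0"
  using smooth1_bump bump_zero by auto

text \<open>\<open>D\<close> and \<open>D'\<close> are given as weak derivatives of
  \<open>v\<close>, not of each other. Differentiating the spatial test function once more relates
  them, and arbitrary time bumps localise the relation to almost every time, simultaneously for the
  countably many frequencies.\<close>

lemma wderiv_space:
  assumes D: "wderiv_cyl T a b p i v D" "wderiv_cyl T a b p (Suc i) v D'"
    and rep: "rep v v'" "rep D E" "rep D' E'"
  shows "AE t in J 0 T. sd (sl E t) (sl E' t)"
proof -
  have bb: "bb E" "bb E'" using rep by (auto simp: rep_def)
  have "AE t in J 0 T. of_int k * w * ip (sl E t) (e (- k)) + ip (sl E' t) (e k) = 0" for k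
  proof (rule zero_AE[OF _ T_pos])
    fix c d n assume cd: "0 < c" "c < d" "d < T"
    let ?\<theta> = "bump c d n"
    have d: "ip (sl E t) (deriv (e k)) = of_int k * w * ip (sl E t) (e (- k))" for t
      by (simp add: deriv_e ip_def mult_ac)
    have "(-1) ^ (p + i) * (LINT t|J 0 T. ip (sl E t) (deriv (e k)) * ?\<theta> t)
        = (LINT t|J 0 T. ip (sl v' t) ((deriv ^^ i) (deriv (e k))) * (deriv ^^ p) ?\<theta> t)"
      by (rule wderiv_cyl_pf[OF D(1) rep(1,2) bump_test(1)[OF cd] cd(1,3) _ circ_test_deriv_e, symmetric])
        (rule bump_test(2)[OF cd])
    also have "\<dots> = (LINT t|J 0 T. ip (sl v' t) ((deriv ^^ Suc i) (e k)) * (deriv ^^ p) ?\<theta> t)"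
      by (simp only: deriv_funpow_Suc)
    also have "\<dots> = (-1) ^ (p + Suc i) * (LINT t|J 0 T. ip (sl E' t) (e k) * ?\<theta> t)"
      by (rule wderiv_cyl_pf[OF D(2) rep(1,3) bump_test(1)[OF cd] cd(1,3) _ circ_test_e])
        (rule bump_test(2)[OF cd])
    finally have *: "(LINT t|J 0 T. ip (sl E t) (deriv (e k)) * ?\<theta> t) = - (LINT t|J 0 T. ip (sl E' t) (e k) * ?\<theta> t)"
      by (intro minus_one_power_cancel[of "p + i"]) (simp only: add_Suc_right)
    have "(LINT t|J 0 T. (of_int k * w * ip (sl E t) (e (- k)) + ip (sl E' t) (e k)) * ?\<theta> t)
        = (LINT t|J 0 T. of_int k * w * ip (sl E t) (e (- k)) * ?\<theta> t) + (LINT t|J 0 T. ip (sl E' t) (e k) * ?\<theta> t)"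
      unfolding distrib_right
      by (intro Bochner_Integration.integral_add bb_integrable bb_mult bb_const bb_ip_right bb bb_e bb_bump)
    then show "(LINT t|J 0 T. (of_int k * w * ip (sl E t) (e (- k)) + ip (sl E' t) (e k)) * ?\<theta> t) = 0"
      using * by (simp add: d)
  qed (intro bb_add bb_mult bb_const bb_ip_right bb bb_e)
  then have "AE t in J 0 T. \<forall>k. of_int k * w * ip (sl E t) (e (- k)) + ip (sl E' t) (e k) = 0"
    by (simp add: AE_all_countable)
  then show ?thesis by eventually_elim (simp add: sd_def eq_neg_iff_add_eq_0)
qed

text \<open>As in \<open>wderiv_space\<close>, with the extra derivative on the time factor of the
  test; du Bois-Reymond's lemma then gives the integrated form.\<close>

lemma wderiv_time:
  assumes D: "wderiv_cyl T a b p i v D" "wderiv_cyl T a b (Suc p) i v D'"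
    and rep: "rep v v'" "rep D E" "rep D' E'"
  shows "\<exists>c. AE t in J 0 T. ip (sl E t) (e k) = c + prim 0 T (\<lambda>s. ip (sl E' s) (e k)) t"
proof -
  have bb: "bb E" "bb E'" using rep by (auto simp: rep_def)
  show ?thesis
  proof (rule weak_derivative_imp_prim[OF bb_ip_right[OF bb(1) bb_e] bb_ip_right[OF bb(2) bb_e] T_pos])
    fix \<theta> \<theta>' r s
    assume \<theta>: "smooth1 \<theta>" "\<And>x. (\<theta> has_real_derivative \<theta>' x) (at x)" "0 < r" "s < T"
      and z: "\<And>t. t \<le> r \<or> s \<le> t \<Longrightarrow> \<theta> t = 0"
    have \<theta>': "\<theta>' = deriv \<theta>" using \<theta>(2) by (auto intro: DERIV_imp_deriv[symmetric])
    \<comment> \<open>\<open>deriv_zero_outside\<close> covers only points strictly outside the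
      support interval; moving its ends halfway towards 0 and T restores closed conditions.\<close>
    have z': "\<theta>' t = 0" if "t \<le> r / 2 \<or> (s + T) / 2 \<le> t" for t
      by (rule deriv_zero_outside[OF \<theta>(2) z]) (use that \<theta>(3,4) in auto)
    have "(-1) ^ (p + i) * (LINT t|J 0 T. ip (sl E t) (e k) * \<theta>' t)
        = (LINT t|J 0 T. ip (sl v' t) ((deriv ^^ i) (e k)) * (deriv ^^ p) \<theta>' t)"
    proof (rule wderiv_cyl_pf[OF D(1) rep(1,2) _ _ _ _ circ_test_e, symmetric])
      show "smooth1 \<theta>'" unfolding \<theta>' by (rule smooth1_deriv_smooth1[OF \<theta>(1)])
      show "0 < r / 2" "(s + T) / 2 < T" using \<theta>(3,4) by auto
    qed (rule z')
    also have "\<dots> = (LINT t|J 0 T. ip (sl v' t) ((deriv ^^ i) (e k)) * (deriv ^^ Suc p) \<theta> t)"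
      by (simp only: deriv_funpow_Suc \<theta>')
    also have "\<dots> = (-1) ^ (Suc p + i) * (LINT t|J 0 T. ip (sl E' t) (e k) * \<theta> t)"
      by (rule wderiv_cyl_pf[OF D(2) rep(1,3) \<theta>(1,3,4) z circ_test_e])
    finally show "(LINT t|J 0 T. ip (sl E t) (e k) * \<theta>' t) = - (LINT t|J 0 T. ip (sl E' t) (e k) * \<theta> t)"
      by (intro minus_one_power_cancel[of "p + i"]) (simp only: add_Suc)
  qed
qed

lemma wderiv_trace:
  assumes D: "wderiv_cyl T a b p i v D" "wderiv_cyl T a b (Suc p) i v D'"
    and rep: "rep v v'" "rep D E" "rep D' E'"
  shows "\<exists>Ein. bb Ein \<and> tderiv E E' Ein"
  using wderiv_time[OF D rep] rep by (intro tderiv_trace) (auto simp: rep_def)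

text \<open>Only \<open>v\<close> itself has a representative continuous up to time 0, not its
  derivatives. Hence all x-derivatives are put on the test function: up to sign, the coefficient of
  \<open>D\<close> is the integral of \<open>v\<close> against the i-th derivative of
  \<open>e k\<close>. Along times tending to 0 the integrated form gives the constant
  \<open>c\<close>, the other form the coefficient of the i-th derivative of
  \<open>u0\<close>.\<close>

lemma wderiv_initial:
  assumes D: "wderiv_cyl T a b 0 i v D" "wderiv_cyl T a b 1 i v D'"
    and rep: "rep v v'" "rep D E" "rep D' E'"
    and u0: "wderiv_circ a b i u0 g0" and tr: "initial_trace T a b v u0"
    and g0': "bb g0'" "AE x in J a b. g0 x = g0' x"
  shows "tderiv E E' g0'"
  unfolding tderiv_def
proof
  fix k
  have bb: "bb v'" "bb E" "bb E'" using rep by (auto simp: rep_def)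
  have D': "wderiv_cyl T a b (Suc 0) i v D'" using D(2) by simp
  obtain c where c: "AE t in J 0 T. ip (sl E t) (e k) = c + prim 0 T (\<lambda>s. ip (sl E' s) (e k)) t"
    using wderiv_time[OF D(1) D' rep] by blast
  let ?\<psi> = "(deriv ^^ i) (e k)"
  have s\<psi>: "smooth1 ?\<psi>" by (rule smooth1_funpow[OF e_smooth])
  \<comment> \<open>The derivative of \<open>e k\<close> is cut off to the interval so that it falls
    under \<open>bb\<close>; integrals over the interval do not change.\<close>
  let ?B = "\<lambda>x. indicator {a<..<b} x * ?\<psi> x"
  have bbB: "bb ?B" by (rule continuous_imp_bb_cut[OF smooth1_continuous_on[OF s\<psi>]])
  have ipB: "ip h ?\<psi> = ip h ?B" for h
    unfolding ip_def by (rule Bochner_Integration.integral_cong) (auto simp: space_J)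
  have eqB: "(\<lambda>t. ip (sl v' t) ?\<psi>) = (\<lambda>t. ip (sl v' t) ?B)" by (rule ext) (rule ipB)
  have bb\<psi>: "bb (\<lambda>t. ip (sl v' t) ?\<psi>)"
    by (rule ssubst[OF eqB]) (rule bb_ip_right[OF bb(1) bbB])
  have Eu: "AE t in J 0 T. ip (sl E t) (e k) - (-1) ^ i * ip (sl v' t) ?\<psi> = 0"
  proof (rule zero_AE[OF _ T_pos])
    show "bb (\<lambda>t. ip (sl E t) (e k) - (-1) ^ i * ip (sl v' t) ?\<psi>)"
      by (intro bb_diff bb_mult bb_const bb\<psi> bb_ip_right bb bb_e)
    fix c d n assume cd: "0 < c" "c < d" "d < T"
    have "(LINT t|J 0 T. ip (sl v' t) ?\<psi> * (deriv ^^ 0) (bump c d n) t)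
        = (-1) ^ (0 + i) * (LINT t|J 0 T. ip (sl E t) (e k) * bump c d n t)"
      by (rule wderiv_cyl_pf[OF D(1) rep(1,2) bump_test(1)[OF cd] cd(1,3) _ circ_test_e])
        (rule bump_test(2)[OF cd])
    then have *: "(-1) ^ i * (LINT t|J 0 T. ip (sl v' t) ?\<psi> * bump c d n t)
        = (LINT t|J 0 T. ip (sl E t) (e k) * bump c d n t)"
      by (simp add: power_mult_distrib[symmetric] mult.assoc[symmetric] power_add[symmetric] flip: mult_2)
    have "(LINT t|J 0 T. (ip (sl E t) (e k) - (-1) ^ i * ip (sl v' t) ?\<psi>) * bump c d n t)
        = (LINT t|J 0 T. ip (sl E t) (e k) * bump c d n t)
          - (LINT t|J 0 T. (-1) ^ i * ip (sl v' t) ?\<psi> * bump c d n t)"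
      unfolding left_diff_distrib
      by (intro Bochner_Integration.integral_diff bb_integrable bb_mult bb_const bb\<psi> bb_ip_right bb bb_e bb_bump)
    then show "(LINT t|J 0 T. (ip (sl E t) (e k) - (-1) ^ i * ip (sl v' t) ?\<psi>) * bump c d n t) = 0"
      using * by (simp add: mult.assoc)
  qed
  obtain vc where vc: "continuous_on ({0..<T} \<times> {a<..<b}) vc" "AE z in cyl T a b. vc z = v z"
    "AE x in circ a b. vc (0, x) = u0 x"
    using tr unfolding initial_trace_def by blast
  have "AE z in cyl T a b. vc z = v' z"
    using vc(2) rep(1) unfolding rep_def by (auto elim: eventually_elim2)
  then have vv: "AE t in J 0 T. AE x in J a b. vc (t, x) = v' (t, x)" by (rule AE_cyl_iterated)
  \<comment> \<open>A time at which the integrated form, the form with derivatives on the test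
    function, and agreement with the continuous representative all hold. Almost every time is good,
    so good times accumulate at 0.\<close>
  define good where "good t \<longleftrightarrow> ip (sl E t) (e k) = c + prim 0 T (\<lambda>s. ip (sl E' s) (e k)) t
      \<and> ip (sl E t) (e k) = (-1) ^ i * ip (sl v' t) ?B \<and> (AE x in J a b. vc (t, x) = v' (t, x))" for t
  have good: "AE t in J 0 T. good t"
    using c Eu vv unfolding good_def by eventually_elim (simp add: ipB)
  have "\<forall>n. \<exists>t. 0 < t \<and> t < min T (1 / real (Suc n)) \<and> good t"
  proof
    fix n
    have "AE t in J 0 (min T (1 / real (Suc n))). good t"
      using good unfolding AE_J_iff[where l = 0] by eventually_elim auto
    then show "\<exists>t. 0 < t \<and> t < min T (1 / real (Suc n)) \<and> good t"
      by (rule AE_J_ex) (use T_pos in simp)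
  qed
  from choice[OF this]
  obtain t where t': "\<forall>n. 0 < t n \<and> t n < min T (1 / real (Suc n)) \<and> good (t n)" by (rule exE)
  then have tg: "0 < t n \<and> t n < min T (1 / real (Suc n)) \<and> good (t n)" for n by (rule spec)
  have t: "0 < t n" "t n < min T (1 / real (Suc n))"
    "ip (sl E (t n)) (e k) = c + prim 0 T (\<lambda>s. ip (sl E' s) (e k)) (t n)"
    "ip (sl E (t n)) (e k) = (-1) ^ i * ip (sl v' (t n)) ?B"
    "AE x in J a b. vc (t n, x) = v' (t n, x)" for n
    using tg[of n] unfolding good_def by blast+
  have tT: "t n < T" "t n < 1 / real (Suc n)" for n using t(2)[of n] by auto
  have t0: "t \<longlonglongrightarrow> 0"
  proof (rule LIMSEQ_abs_diff_bound)
    show "\<bar>t n - 0\<bar> \<le> 1 / real (Suc n)" for n using t(1)[of n] tT(2)[of n] by simp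
    show "(\<lambda>n. 1 / real (Suc n)) \<longlonglongrightarrow> 0" by (rule LIMSEQ_Suc) (rule lim_1_over_n)
  qed
  have lim1: "(\<lambda>n. ip (sl E (t n)) (e k)) \<longlonglongrightarrow> c"
  proof -
    have bbp: "bb (\<lambda>s. ip (sl E' s) (e k))" by (intro bb_ip_right bb bb_e)
    obtain B where B: "\<And>s. \<bar>ip (sl E' s) (e k)\<bar> \<le> B" using bb_bound[OF bbp] by metis
    show ?thesis
    proof (rule LIMSEQ_abs_diff_bound)
      show "\<bar>ip (sl E (t n)) (e k) - c\<bar> \<le> B * t n" for n
        using bb_lipschitz_prim[OF bbp, of 0 "t n" T B] t(1,3)[of n] tT(1)[of n] B by simp
      show "(\<lambda>n. B * t n) \<longlonglongrightarrow> 0" by (rule tendsto_mult_right_zero[OF t0])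
    qed
  qed
  obtain C where C: "\<And>z. \<bar>v' z\<bar> \<le> C" "C \<ge> 0" using bb_bound[OF bb(1)] by metis
  have Linf0: "Linf (circ a b) u0" "Linf (circ a b) g0" using u0 by (simp_all add: wderiv_circ_def)
  obtain u0' where u0': "bb u0'" "AE x in circ a b. u0 x = u0' x"
    by (rule Linf_representative[OF _ Linf0(1)]) auto
  obtain CB where CB: "\<And>x. \<bar>?B x\<bar> \<le> CB" "CB \<ge> 0" using bb_bound[OF bbB] by metis
  have "(\<lambda>n. ip (sl v' (t n)) ?B) \<longlonglongrightarrow> ip u0' ?B"
    unfolding ip_def
  proof (rule J_dominated_convergence[where C = "C * CB"])
    have "AE x in J a b. \<forall>n. vc (t n, x) = v' (t n, x)" using t(5) by (simp add: AE_all_countable)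
    moreover have "AE x in J a b. vc (0, x) = u0' x"
      using vc(3) u0'(2) unfolding AE_lebesgue_on_J by eventually_elim simp
    moreover have "AE x in J a b. a < x \<and> x < b" by (rule AE_I2) (simp add: space_J)
    ultimately show "AE x in J a b. (\<lambda>n. sl v' (t n) x * ?B x) \<longlonglongrightarrow> u0' x * ?B x"
    proof eventually_elim
      case (elim x)
      have "(\<lambda>n. vc (t n, x)) \<longlonglongrightarrow> vc (0, x)"
        using tendsto_Pair[OF t0 tendsto_const[of x]]
        by (rule continuous_on_tendsto_compose[OF vc(1)])
          (use t(1) tT(1) T_pos elim in \<open>auto simp: less_imp_le\<close>)
      then show ?case using elim by (intro tendsto_mult tendsto_const) (simp add: sl_def)
    qed
    show "\<bar>sl v' (t n) x * ?B x\<bar> \<le> C * CB" for n x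
    proof -
      have "\<bar>sl v' (t n) x\<bar> * \<bar>?B x\<bar> \<le> C * CB"
        unfolding sl_def by (intro mult_mono C CB abs_ge_zero)
      then show ?thesis by (simp only: abs_mult)
    qed
  qed (intro bb_measurable bb_mult bb_sl bb bbB u0')+
  then have lim2: "(\<lambda>n. ip (sl E (t n)) (e k)) \<longlonglongrightarrow> (-1) ^ i * ip u0' ?B"
    unfolding t(4) by (rule tendsto_mult_left)
  have "(LINT x|circ a b. u0 x * ?\<psi> x) = (-1) ^ i * (LINT x|circ a b. g0 x * e k x)"
    using u0 circ_test_e[of k] by (simp add: wderiv_circ_def test_circ_def circ_test_def)
  then have "ip u0' ?\<psi> = (-1) ^ i * ip g0' (e k)"
    using circ_integral_rep[OF Linf0(1) u0'(1) u0'(2)[unfolded AE_lebesgue_on_J] smooth1_continuous_on[OF s\<psi>]]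
      circ_integral_rep[OF Linf0(2) g0' smooth1_continuous_on[OF e_smooth, of _ k]] by simp
  then have "(-1) ^ i * ip u0' ?B = ip g0' (e k)"
    unfolding ipB[symmetric] by (simp add: mult.assoc[symmetric] flip: power_add mult_2)
  then have "c = ip g0' (e k)" using LIMSEQ_unique[OF lim1 lim2] by simp
  then show "AE t in J 0 T. ip (sl E t) (e k) = ip g0' (e k) + prim 0 T (\<lambda>s. ip (sl E' s) (e k)) t"
    using c by simp
qed

end

section \<open>Regularity of the flux\<close>

text \<open>The primitives of \<open>C - g\<close> and \<open>C + g\<close> are nondecreasing, as
  their integrands are nonnegative.\<close>

lemma prim_lipschitz:
  assumes g: "bb g" and C: "\<And>x. \<bar>g x\<bar> \<le> C" and st: "l \<le> s" "s \<le> t" "t \<le> r"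
  shows "\<bar>prim l r g t - prim l r g s\<bar> \<le> C * (t - s)"
proof -
  have const: "prim l r (\<lambda>x. C) u = C * (u - l)" if "l \<le> u" "u \<le> r" for u
  proof -
    have "((\<lambda>x. C * x) has_real_derivative C) (at x)" for x by (auto intro!: derivative_eq_intros)
    from prim_FTC[OF that this continuous_on_const refl] show ?thesis by (simp add: algebra_simps)
  qed
  have mono: "prim l r h s \<le> prim l r h t" if "bb h" "\<And>x. 0 \<le> h x" for h
    unfolding prim_def
    by (rule integral_mono[OF bb_integrable[OF bb_cut] bb_integrable[OF bb_cut]])
      (use that st in \<open>auto simp: indicator_def\<close>)
  have "prim l r (\<lambda>x. C - g x) s \<le> prim l r (\<lambda>x. C - g x) t"
    by (rule mono) (use C in \<open>auto intro!: bb_diff bb_const g simp: abs_le_iff\<close>)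
  moreover have "prim l r (\<lambda>x. C + g x) s \<le> prim l r (\<lambda>x. C + g x) t"
  proof (rule mono)
    show "0 \<le> C + g x" for x using C[of x] by (auto simp: abs_le_iff)
  qed (intro bb_add bb_const g)
  ultimately show ?thesis
    using const[of s] const[of t] st
    by (simp add: prim_add prim_diff bb_const g abs_le_iff algebra_simps)
qed

lemma AE_eq_imp_eq_on:
  assumes c: "continuous_on UNIV F" "continuous_on UNIV G" and ae: "AE x in J l r. F x = (G x :: real)"
    and x: "l < x" "x < r"
  shows "F x = G x"
proof (rule ccontr)
  assume ne: "F x \<noteq> G x"
  have "open {y. F y \<noteq> G y}" by (rule open_Collect_neq[OF c])
  then have "open ({y. F y \<noteq> G y} \<inter> {l<..<r})" by auto
  then obtain d where d: "d > 0" "ball x d \<subseteq> {y. F y \<noteq> G y} \<inter> {l<..<r}"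
    using ne x openE[of "{y. F y \<noteq> G y} \<inter> {l<..<r}" x] by auto
  have *: "{x - d<..<x + d} \<subseteq> {y. F y \<noteq> G y} \<inter> {l<..<r}"
    using d(2) by (simp add: ball_eq_greaterThanLessThan)
  have "AE y in J (x - d) (x + d). F y = G y"
    using ae * unfolding AE_J_iff by (auto elim!: eventually_mono)
  from AE_J_ex[OF this] d(1) obtain y where "x - d < y" "y < x + d" "F y = G y" by auto
  then show False using * by auto
qed

lemma lebesgue_integral_compact_support:
  fixes v v' \<theta> :: "real \<Rightarrow> real"
  assumes v: "Linf (lebesgue_on {-R..R}) v" "bb v'" "AE x in lebesgue_on {-R..R}. v x = v' x"
    and \<theta>: "continuous_on UNIV \<theta>" "\<And>x. x \<le> - R \<or> R \<le> x \<Longrightarrow> \<theta> x = 0"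
  shows "(LINT x|lebesgue. v x * \<theta> x) = (LINT x|J (-R) R. v' x * \<theta> x)"
proof -
  have [measurable]: "v \<in> borel_measurable (lebesgue_on {-R..R})" using v(1) by (simp add: Linf_def)
  have m: "v' \<in> borel_measurable borel" "\<theta> \<in> borel_measurable borel"
    using bb_measurable[OF v(2)] borel_measurable_continuous_onI[OF \<theta>(1)] by auto
  note [measurable] = m[THEN measurable_lebesgue_on[of _ "{-R..R}"]]
  have "(LINT x|lebesgue. v x * \<theta> x) = (LINT x|lebesgue. indicator {-R..R} x *\<^sub>R (v x * \<theta> x))"
  proof (rule Bochner_Integration.integral_cong[OF refl])
    fix x show "v x * \<theta> x = indicator {-R..R} x *\<^sub>R (v x * \<theta> x)"
      using \<theta>(2)[of x] by (cases "- R < x \<and> x < R") (auto simp: indicator_def)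
  qed
  also have "\<dots> = (LINT x|lebesgue_on {-R..R}. v x * \<theta> x)"
    by (rule integral_restrict_space[symmetric]) simp
  also have "\<dots> = (LINT x|lebesgue_on {-R..R}. v' x * \<theta> x)"
    by (rule integral_cong_AE) (use v(3) in \<open>auto elim!: eventually_mono\<close>)
  also have "\<dots> = (LINT x|lborel. indicator {-R..R} x * (v' x * \<theta> x))"
    using m by (intro integral_lebesgue_on) auto
  also have "\<dots> = (LINT x|lborel. indicator {-R<..<R} x * (v' x * \<theta> x))"
  proof (rule Bochner_Integration.integral_cong[OF refl])
    fix x show "indicator {-R..R} x * (v' x * \<theta> x) = indicator {-R<..<R} x * (v' x * \<theta> x)"
      using \<theta>(2)[of x] by (cases "- R < x \<and> x < R") (auto simp: indicator_def)
  qed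
  finally show ?thesis by (simp add: J_integral_lborel)
qed

text \<open>Du Bois-Reymond's lemma is applied twice: to f with weak derivative \<open>g1\<close>,
  and to \<open>g1\<close> with weak derivative \<open>f2\<close>. The latter relation results from
  testing f with second derivatives. The representatives of f and \<open>g1\<close> are local, but
  the Lipschitz constant comes from the global bound on \<open>f2'\<close> and is the same for every
  R.\<close>

lemma second_weak_derivative_local:
  assumes f: "continuous_on UNIV f" and w1: "wderiv_line 1 f g1" and w2: "wderiv_line 2 f f2"
    and f2': "bb f2'" "AE x in lebesgue. f2 x = f2' x" "\<And>x. \<bar>f2' x\<bar> \<le> C" and R: "R > 0"
  shows "\<exists>p. (\<forall>s t. \<bar>p s - p t\<bar> \<le> C * \<bar>s - t\<bar>) \<and>
      (\<forall>x. - R < x \<longrightarrow> x < R \<longrightarrow> (f has_real_derivative p x) (at x))"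
proof -
  have L: "Linf (lebesgue_on {-R..R}) f" "Linf (lebesgue_on {-R..R}) g1" "Linf (lebesgue_on {-R..R}) f2"
    using w1 w2 by (auto simp: wderiv_line_def Linf_loc_def)
  obtain g where g: "bb g" "AE x in lebesgue_on {-R..R}. g1 x = g x"
    by (rule Linf_representative[OF _ L(2)]) auto
  let ?f = "\<lambda>x. indicator {-R<..<R} x * f x"
  have bf: "bb ?f" by (rule continuous_imp_bb_cut[OF f])
  have fR: "AE x in lebesgue_on {-R..R}. f x = ?f x"
    using AE_lborel_singleton[of R] AE_lborel_singleton[of "-R"]
    by (subst AE_lebesgue_on_iff) (auto simp: indicator_def elim: eventually_elim2)
  have f2R: "AE x in lebesgue_on {-R..R}. f2 x = f2' x"
    using f2'(2) by (subst AE_lebesgue_on_iff) (auto simp: AE_completion_iff elim!: eventually_mono)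
  have test: "test_line \<theta>" if "smooth1 \<theta>" "- R < r" "s < R" "\<And>t. t \<le> r \<or> s \<le> t \<Longrightarrow> \<theta> t = 0" for \<theta> r s
    unfolding test_line_def using that by (auto intro!: exI[of _ R] that(4))
  have 1: "\<exists>c. AE x in J (-R) R. ?f x = c + prim (-R) R g x"
  proof (rule weak_derivative_imp_prim[OF bf g(1)])
    fix \<theta> \<theta>' r s
    assume \<theta>: "smooth1 \<theta>" "\<And>x. (\<theta> has_real_derivative \<theta>' x) (at x)" "- R < r" "s < R"
      and z: "\<And>t. t \<le> r \<or> s \<le> t \<Longrightarrow> \<theta> t = 0"
    have \<theta>': "\<theta>' = deriv \<theta>" using \<theta>(2) by (auto intro: DERIV_imp_deriv[symmetric])
    have "\<theta>' t = 0" if "t \<le> - R \<or> R \<le> t" for t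
      by (rule deriv_zero_outside[OF \<theta>(2) z]) (use that \<theta>(3,4) in auto)
    then have "(LINT x|lebesgue. f x * \<theta>' x) = (LINT x|J (-R) R. ?f x * \<theta>' x)"
      by (intro lebesgue_integral_compact_support L bf fR)
        (auto simp: \<theta>' intro!: smooth1_continuous_on smooth1_deriv_smooth1 \<theta>(1))
    moreover have "(LINT x|lebesgue. g1 x * \<theta> x) = (LINT x|J (-R) R. g x * \<theta> x)"
      by (intro lebesgue_integral_compact_support L g smooth1_continuous_on \<theta>(1) z) (use \<theta>(3,4) in auto)
    moreover have "(LINT x|lebesgue. f x * \<theta>' x) = - (LINT x|lebesgue. g1 x * \<theta> x)"
      using w1 test[OF \<theta>(1,3,4) z] by (auto simp: wderiv_line_def \<theta>')
    ultimately show "(LINT x|J (-R) R. ?f x * \<theta>' x) = - (LINT x|J (-R) R. g x * \<theta> x)" by simp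
  qed (use R in simp)
  have 2: "\<exists>c. AE x in J (-R) R. g x = c + prim (-R) R f2' x"
  proof (rule weak_derivative_imp_prim[OF g(1) f2'(1)])
    fix \<theta> \<theta>' r s
    assume \<theta>: "smooth1 \<theta>" "\<And>x. (\<theta> has_real_derivative \<theta>' x) (at x)" "- R < r" "s < R"
      and z: "\<And>t. t \<le> r \<or> s \<le> t \<Longrightarrow> \<theta> t = 0"
    have \<theta>': "\<theta>' = deriv \<theta>" using \<theta>(2) by (auto intro: DERIV_imp_deriv[symmetric])
    have s\<theta>': "smooth1 \<theta>'" unfolding \<theta>' by (rule smooth1_deriv_smooth1[OF \<theta>(1)])
    have z': "\<theta>' t = 0" if "t \<le> (r - R) / 2 \<or> (s + R) / 2 \<le> t" for t
      by (rule deriv_zero_outside[OF \<theta>(2) z]) (use that \<theta>(3,4) in auto)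
    have "(LINT x|lebesgue. g1 x * \<theta>' x) = (LINT x|J (-R) R. g x * \<theta>' x)"
      by (intro lebesgue_integral_compact_support L g smooth1_continuous_on s\<theta>' z') (use \<theta>(3,4) in auto)
    moreover have "(LINT x|lebesgue. f2 x * \<theta> x) = (LINT x|J (-R) R. f2' x * \<theta> x)"
      by (intro lebesgue_integral_compact_support L f2' f2R smooth1_continuous_on \<theta>(1) z) (use \<theta>(3,4) in auto)
    moreover have "(LINT x|lebesgue. f x * deriv \<theta>' x) = - (LINT x|lebesgue. g1 x * \<theta>' x)"
    proof -
      have "test_line \<theta>'" by (rule test[OF s\<theta>', where r = "(r - R) / 2" and s = "(s + R) / 2"]) (use z' \<theta>(3,4) in auto)
      then show ?thesis using w1 by (auto simp: wderiv_line_def)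
    qed
    moreover have "(LINT x|lebesgue. f x * deriv \<theta>' x) = (LINT x|lebesgue. f2 x * \<theta> x)"
      using w2 test[OF \<theta>(1,3,4) z] by (auto simp: wderiv_line_def \<theta>' numeral_2_eq_2)
    ultimately show "(LINT x|J (-R) R. g x * \<theta>' x) = - (LINT x|J (-R) R. f2' x * \<theta> x)" by simp
  qed (use R in simp)
  obtain c1 c2 where c1: "AE x in J (-R) R. ?f x = c1 + prim (-R) R g x"
    and c2: "AE x in J (-R) R. g x = c2 + prim (-R) R f2' x" using 1 2 by blast
  \<comment> \<open>Clamping to [-R, R] extends the formula for the derivative to a function
    \<open>p\<close> that is Lipschitz on the whole line.\<close>
  define cl where "cl x = max (-R) (min R x)" for x
  define p where "p x = c2 + prim (-R) R f2' (cl x)" for x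
  have clR: "- R \<le> cl x" "cl x \<le> R" for x using R by (auto simp: cl_def)
  have cl_id: "cl x = x" if "-R \<le> x" "x \<le> R" for x using that by (auto simp: cl_def)
  have C0: "C \<ge> 0" using f2'(3)[of 0] by linarith
  have lip1: "\<bar>p s - p t\<bar> \<le> C * \<bar>s - t\<bar>" if "s \<le> t" for s t
  proof -
    have "cl s \<le> cl t" "cl t - cl s \<le> t - s" using that by (auto simp: cl_def)
    have "\<bar>prim (-R) R f2' (cl t) - prim (-R) R f2' (cl s)\<bar> \<le> C * (cl t - cl s)"
      by (rule prim_lipschitz[OF f2'(1,3) clR(1) \<open>cl s \<le> cl t\<close> clR(2)])
    also have "\<dots> \<le> C * (t - s)" using C0 \<open>cl t - cl s \<le> t - s\<close> by (rule mult_left_mono[rotated])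
    finally show ?thesis using that by (simp add: p_def abs_minus_commute)
  qed
  have lip: "\<bar>p s - p t\<bar> \<le> C * \<bar>s - t\<bar>" for s t
    using lip1[of s t] lip1[of t s] by (cases "s \<le> t") (auto simp: abs_minus_commute)
  have "C-lipschitz_on UNIV p"
    by (rule lipschitz_onI) (use lip C0 in \<open>auto simp: dist_real_def\<close>)
  then have pc: "continuous_on UNIV p" by (rule lipschitz_on_continuous_on)
  then have "isCont p x" for x by (simp add: continuous_on_eq_continuous_at)
  then obtain P where "\<And>x. (P has_vector_derivative p x) (at x)"
    using einterval_antiderivative[of "-\<infinity>" "\<infinity>" p] by auto
  then have P: "(P has_real_derivative p x) (at x)" for x
    by (simp add: has_real_derivative_iff_has_vector_derivative)
  have Pc: "continuous_on UNIV P" using P by (meson DERIV_isCont continuous_at_imp_continuous_on)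
  have inside: "AE x in J (-R) R. - R < x \<and> x < R" by (rule AE_I2) (simp add: space_J)
  have "AE x in J (-R) R. g x = p x"
    using c2 inside by eventually_elim (auto simp: p_def cl_id)
  moreover have bcut: "bb (\<lambda>x. indicator {-R<..<R} x * p x)" by (rule continuous_imp_bb_cut[OF pc])
  ultimately have gp: "prim (-R) R g x = prim (-R) R (\<lambda>x. indicator {-R<..<R} x * p x) x" for x
    using inside by (intro prim_cong_AE g(1)) (auto elim: eventually_elim2)
  have "AE x in J (-R) R. f x = c1 + (P x - P (-R))"
    using c1 inside
  proof eventually_elim
    case (elim x)
    have "P x = P (-R) + prim (-R) R (\<lambda>x. indicator {-R<..<R} x * p x) x"
      using elim by (intro prim_FTC[OF _ _ P pc]) auto
    then show ?case using elim by (simp add: gp)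
  qed
  \<comment> \<open>Continuous functions that agree almost everywhere agree everywhere inside the
    interval; here continuity of f turns the weak statement into a classical one.\<close>
  then have eq: "f x = c1 + (P x - P (-R))" if "-R < x" "x < R" for x
    using that by (intro AE_eq_imp_eq_on[OF f]) (auto intro!: continuous_intros Pc)
  have "(f has_real_derivative p x) (at x)" if "-R < x" "x < R" for x
  proof -
    have "((\<lambda>x. c1 + (P x - P (-R))) has_real_derivative p x) (at x)"
      by (rule derivative_eq_intros P refl | simp)+
    then show ?thesis
      by (rule has_field_derivative_transform_within_open[of _ _ _ "{-R<..<R}"]) (use that eq in auto)
  qed
  then show ?thesis using lip by blast
qed

text \<open>Each local derivative coincides with \<open>deriv f\<close> on its interval; to compare
  two points s and t, R is taken larger than both absolute values.\<close>

lemma flux_derivative_lipschitz: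
  assumes "Winf_loc 2 f" "continuous_on UNIV f" "wderiv_line 2 f f2" "Linf lebesgue f2"
  shows "\<exists>C\<ge>0. (\<forall>s. (f has_real_derivative deriv f s) (at s)) \<and> (\<forall>s t. \<bar>deriv f s - deriv f t\<bar> \<le> C * \<bar>s - t\<bar>)"
proof -
  obtain g1 where g1: "wderiv_line 1 f g1" using assms(1) unfolding Winf_loc_def by (metis one_le_numeral)
  have "Linf (lebesgue_on UNIV) f2" using assms(4) by (simp add: lebesgue_on_UNIV_eq)
  then obtain f2' where f2': "bb f2'" "AE x in lebesgue_on UNIV. f2 x = f2' x"
    by (rule Linf_representative[rotated]) auto
  then have ae: "AE x in lebesgue. f2 x = f2' x" by (simp add: AE_lebesgue_on_iff AE_completion_iff)
  obtain C where C: "C \<ge> 0" "\<And>x. \<bar>f2' x\<bar> \<le> C" using bb_bound[OF f2'(1)] by metis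
  have loc: "\<exists>p. (\<forall>s t. \<bar>p s - p t\<bar> \<le> C * \<bar>s - t\<bar>) \<and>
      (\<forall>x. - R < x \<longrightarrow> x < R \<longrightarrow> (f has_real_derivative p x) (at x))" if "R > 0" for R
    by (rule second_weak_derivative_local[OF assms(2) g1 assms(3) f2'(1) ae C(2) that])
  have "(f has_real_derivative deriv f s) (at s) \<and> \<bar>deriv f s - deriv f t\<bar> \<le> C * \<bar>s - t\<bar>" for s t
  proof -
    obtain p where p: "\<And>s t. \<bar>p s - p t\<bar> \<le> C * \<bar>s - t\<bar>"
      "\<And>x. - (\<bar>s\<bar> + \<bar>t\<bar> + 1) < x \<Longrightarrow> x < \<bar>s\<bar> + \<bar>t\<bar> + 1 \<Longrightarrow> (f has_real_derivative p x) (at x)"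
      using loc[of "\<bar>s\<bar> + \<bar>t\<bar> + 1"] by force
    have "(f has_real_derivative p s) (at s)" "(f has_real_derivative p t) (at t)"
      by (rule p(2); linarith)+
    then show ?thesis using p(1)[of s t] by (auto simp: DERIV_imp_deriv)
  qed
  then show ?thesis using C(1) by blast
qed

section \<open>Entropy solutions tested with product functions\<close>

context cylinder
begin

definition xint :: "(real \<times> real \<Rightarrow> real) \<Rightarrow> real \<Rightarrow> real" where
  "xint F t = (LINT x|J a b. F (t, x))"

definition pint :: "(real \<times> real \<Rightarrow> real) \<Rightarrow> real \<Rightarrow> real" where
  "pint F t = prim 0 T (xint F) t"

lemma bb_xint: "bb F \<Longrightarrow> bb (xint F)"
  unfolding xint_def[abs_def] by (rule bb_integral)

lemma xint_add: "bb F \<Longrightarrow> bb G \<Longrightarrow> xint (\<lambda>z. F z + G z) t = xint F t + xint G t"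
  unfolding xint_def by (intro Bochner_Integration.integral_add bb_integrable bb_slice)

lemma xint_diff: "bb F \<Longrightarrow> bb G \<Longrightarrow> xint (\<lambda>z. F z - G z) t = xint F t - xint G t"
  unfolding xint_def by (intro Bochner_Integration.integral_diff bb_integrable bb_slice)

lemma xint_cmult: "xint (\<lambda>z. c * F z) t = c * xint F t"
  by (simp add: xint_def)

lemma xint_sum: "(\<And>i. i \<in> A \<Longrightarrow> bb (F i)) \<Longrightarrow> xint (\<lambda>z. \<Sum>i\<in>A. F i z) t = (\<Sum>i\<in>A. xint (F i) t)"
  unfolding xint_def by (intro Bochner_Integration.integral_sum bb_integrable bb_slice)

lemma pint_add: "bb F \<Longrightarrow> bb G \<Longrightarrow> pint (\<lambda>z. F z + G z) t = pint F t + pint G t"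
  unfolding pint_def ext[OF xint_add] by (intro prim_add bb_xint)

lemma pint_diff: "bb F \<Longrightarrow> bb G \<Longrightarrow> pint (\<lambda>z. F z - G z) t = pint F t - pint G t"
  unfolding pint_def ext[OF xint_diff] by (intro prim_diff bb_xint)

lemma pint_cmult: "pint (\<lambda>z. c * F z) t = c * pint F t"
  using prim_cmult[of 0 T c "xint F" t] by (simp add: pint_def xint_cmult[abs_def])

lemma pint_sum:
  assumes "\<And>i. i \<in> A \<Longrightarrow> bb (F i)"
  shows "pint (\<lambda>z. \<Sum>i\<in>A. F i z) t = (\<Sum>i\<in>A. pint (F i) t)"
proof -
  have "xint (\<lambda>z. \<Sum>i\<in>A. F i z) = (\<lambda>t. \<Sum>i\<in>A. xint (F i) t)"
    by (rule ext) (rule xint_sum[OF assms])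
  then show ?thesis unfolding pint_def by (simp only:) (intro prim_sum bb_xint assms)
qed

lemma xint_mono_AE:
  "bb F \<Longrightarrow> bb G \<Longrightarrow> AE x in J a b. F (t, x) \<le> G (t, x) \<Longrightarrow> xint F t \<le> xint G t"
  unfolding xint_def by (intro integral_mono_AE bb_integrable bb_slice)

lemma pint_mono_AE:
  assumes "bb F" "bb G" "AE t in J 0 T. AE x in J a b. F (t, x) \<le> G (t, x)"
  shows "pint F t \<le> pint G t"
  unfolding pint_def
proof (rule prim_mono_AE[OF bb_xint[OF assms(1)] bb_xint[OF assms(2)]])
  show "AE s in J 0 T. xint F s \<le> xint G s"
    using assms(3) by eventually_elim (rule xint_mono_AE[OF assms(1,2)])
qed

lemma pint_zero_AE:
  assumes "bb F" "AE t in J 0 T. xint F t = 0"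
  shows "pint F t = 0"
proof -
  have "pint F t = prim 0 T (\<lambda>s. 0) t"
    unfolding pint_def by (rule prim_cong_AE[OF bb_xint[OF assms(1)] bb_const assms(2)])
  then show ?thesis by (simp add: prim_def)
qed

lemma xint_ip: "xint (\<lambda>z. F z * G z) t = ip (sl F t) (sl G t)"
  by (simp add: xint_def ip_def sl_def)

lemma product_rule_xint:
  assumes h: "evol h G S hin" and W: "tderiv W V Win" and Y: "AE t in J 0 T. sd (sl W t) (sl Y t)"
    and bb: "bb h" "bb G" "bb S" "bb hin" "bb W" "bb V" "bb Win" "bb Y"
  shows "AE t in J 0 T. xint (\<lambda>z. h z * W z) t = (LINT x|J a b. hin x * Win x)
      + pint (\<lambda>z. G z * Y z + S z * W z + h z * V z) t"
proof -
  have "xint (\<lambda>z. G z * Y z + S z * W z + h z * V z)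
      = (\<lambda>s. ip (sl G s) (sl Y s) + ip (sl S s) (sl W s) + ip (sl h s) (sl V s))"
    by (rule ext) (simp add: xint_add bb_add bb_mult bb xint_ip)
  then show ?thesis using product_rule[OF h W Y bb] by (simp add: pint_def xint_ip ip_def)
qed

lemma rep_bb: "rep g g' \<Longrightarrow> bb g'"
  by (simp add: rep_def)

lemma rep_add: "rep f f' \<Longrightarrow> rep g g' \<Longrightarrow> rep (\<lambda>z. f z + g z) (\<lambda>z. f' z + g' z)"
  unfolding rep_def
proof (elim conjE, intro conjI bb_add)
  assume "AE z in cyl T a b. f z = f' z" "AE z in cyl T a b. g z = g' z"
  then show "AE z in cyl T a b. f z + g z = f' z + g' z" by eventually_elim simp
qed

lemma rep_cmult: "rep g g' \<Longrightarrow> rep (\<lambda>z. c * g z) (\<lambda>z. c * g' z)"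
  unfolding rep_def
proof (elim conjE, intro conjI bb_mult bb_const)
  assume "AE z in cyl T a b. g z = g' z"
  then show "AE z in cyl T a b. c * g z = c * g' z" by eventually_elim simp
qed

lemma rep_compose:
  assumes "rep g g'" "continuous_on UNIV f"
  shows "rep (\<lambda>z. f (g z)) (\<lambda>z. f (g' z))"
  unfolding rep_def
proof
  show "bb (\<lambda>z. f (g' z))" by (rule bb_continuous_compose[OF assms(2) rep_bb[OF assms(1)]])
  have "AE z in cyl T a b. g z = g' z" using assms(1) by (simp add: rep_def)
  then show "AE z in cyl T a b. f (g z) = f (g' z)" by eventually_elim simp
qed

lemma bb_pf: "bb \<theta> \<Longrightarrow> bb \<psi> \<Longrightarrow> bb (pf \<theta> \<psi>)"
  unfolding pf_def[abs_def] by (intro bb_mult bb_fst bb_snd)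

lemma cyl_integral_cong:
  assumes "F \<in> borel_measurable (cyl T a b)" "bb F'" "AE z in cyl T a b. F z = F' z"
  shows "(LINT z|cyl T a b. F z) = (LINT t|J 0 T. xint F' t)"
proof -
  have "(LINT z|cyl T a b. F z) = (LINT z|cyl T a b. F' z)"
    by (rule integral_cong_AE[OF assms(1) measurable_lebesgue_on[OF bb_measurable[OF assms(2)]] assms(3)])
  then show ?thesis by (simp add: cyl_integral[OF assms(2)] xint_def)
qed

lemma xint_pf: "xint (\<lambda>z. h z * pf \<theta> \<psi> z) t = ip (sl h t) \<psi> * \<theta> t"
proof -
  have "xint (\<lambda>z. h z * pf \<theta> \<psi> z) t = (LINT x|J a b. (sl h t x * \<psi> x) * \<theta> t)"
    by (simp add: xint_def pf_def sl_def mult_ac)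
  then show ?thesis by (simp add: ip_def)
qed

text \<open>Testing with products of a time function and \<open>e k\<close>, the formula
  \<open>deriv_e\<close> turns the flux term into \<open>of_int k * w\<close> times the coefficient
  at \<open>e (- k)\<close>, which is the form demanded by \<open>evol\<close>.\<close>

lemma evol_of_weak:
  assumes m: "h \<in> borel_measurable (cyl T a b)" "G \<in> borel_measurable (cyl T a b)" "S \<in> borel_measurable (cyl T a b)"
    and rep: "rep h h'" "rep G G'" "rep S S'"
    and g0: "Linf (circ a b) g0" "bb g0'" "AE x in J a b. g0 x = g0' x"
    and weak: "\<And>\<phi>. test_init T a b \<phi> \<Longrightarrow>
      (LINT z|cyl T a b. h z * dt \<phi> z + G z * dx \<phi> z + S z * \<phi> z) + (LINT x|circ a b. g0 x * \<phi> (0, x)) = 0"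
  shows "evol h' G' S' g0'"
proof -
  note bb = rep[THEN rep_bb]
  show ?thesis
  proof (rule weak_imp_evol[OF bb])
    fix \<theta> \<theta>' s k
    assume \<theta>: "smooth1 \<theta>" "bb \<theta>" "\<And>x. (\<theta> has_real_derivative \<theta>' x) (at x)" "bb \<theta>'"
      "s < T" "\<And>t. t \<ge> s \<Longrightarrow> \<theta> t = 0"
    have \<theta>': "deriv \<theta> = \<theta>'" using \<theta>(3) by (auto intro: DERIV_imp_deriv)
    let ?e' = "\<lambda>x. of_int k * w * e (- k) x"
    have bbe': "bb ?e'" by (intro bb_mult bb_const bb_e)
    have pb: "bb (pf \<theta>' (e k))" "bb (pf \<theta> ?e')" "bb (pf \<theta> (e k))"
      by (intro bb_pf \<theta> bb_e bbe')+
    note [measurable] = pb[THEN bb_measurable, THEN measurable_lebesgue_on[of _ "{0<..<T} \<times> {a<..<b}"]] m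
    let ?F = "\<lambda>z. h z * pf \<theta>' (e k) z + G z * pf \<theta> ?e' z + S z * pf \<theta> (e k) z"
    let ?F' = "\<lambda>z. h' z * pf \<theta>' (e k) z + G' z * pf \<theta> ?e' z + S' z * pf \<theta> (e k) z"
    have "(LINT z|cyl T a b. ?F z) = (LINT t|J 0 T. xint ?F' t)"
    proof (rule cyl_integral_cong)
      have "AE z in cyl T a b. h z = h' z" "AE z in cyl T a b. G z = G' z" "AE z in cyl T a b. S z = S' z"
        using rep by (auto simp: rep_def)
      then show "AE z in cyl T a b. ?F z = ?F' z" by eventually_elim simp
      show "bb ?F'" by (intro bb_add bb_mult bb pb)
    qed measurable
    also have "\<dots> = (LINT t|J 0 T. ip (sl h' t) (e k) * \<theta>' t
        + (of_int k * w * ip (sl G' t) (e (- k)) + ip (sl S' t) (e k)) * \<theta> t)"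
    proof (rule Bochner_Integration.integral_cong[OF refl])
      fix t
      have "xint ?F' t = ip (sl h' t) (e k) * \<theta>' t + ip (sl G' t) ?e' * \<theta> t + ip (sl S' t) (e k) * \<theta> t"
        by (simp add: xint_add bb_add bb_mult bb pb xint_pf)
      also have "ip (sl G' t) ?e' = of_int k * w * ip (sl G' t) (e (- k))"
        by (simp add: ip_def mult_ac)
      finally show "xint ?F' t = ip (sl h' t) (e k) * \<theta>' t
        + (of_int k * w * ip (sl G' t) (e (- k)) + ip (sl S' t) (e k)) * \<theta> t"
        by (simp add: distrib_right)
    qed
    finally have 1: "(LINT z|cyl T a b. ?F z) = (LINT t|J 0 T. ip (sl h' t) (e k) * \<theta>' t
        + (of_int k * w * ip (sl G' t) (e (- k)) + ip (sl S' t) (e k)) * \<theta> t)" .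
    have 2: "(LINT x|circ a b. g0 x * pf \<theta> (e k) (0, x)) = ip g0' (e k) * \<theta> 0"
    proof -
      have "(LINT x|circ a b. g0 x * pf \<theta> (e k) (0, x)) = (LINT x|circ a b. (g0 x * e k x) * \<theta> 0)"
        by (simp add: pf_def mult_ac)
      then show ?thesis
        using circ_integral_rep[OF g0 smooth1_continuous_on[OF e_smooth[of k]]] by simp
    qed
    have "test_init T a b (pf \<theta> (e k))"
      by (rule test_init_pf[OF \<theta>(1) circ_test_e \<theta>(5,6)])
    from weak[OF this] show "(LINT t|J 0 T. ip (sl h' t) (e k) * \<theta>' t
        + (of_int k * w * ip (sl G' t) (e (- k)) + ip (sl S' t) (e k)) * \<theta> t) + ip g0' (e k) * \<theta> 0 = 0"
      unfolding dt_pf[OF \<theta>(1)] dx_pf[OF e_smooth] deriv_e \<theta>' 1 2 .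
  qed
qed

lemma rep_energy:
  assumes "\<And>j. j < m \<Longrightarrow> rep (q j) (q' j)" "m \<ge> 2"
  shows "AE z in cyl T a b. energy m \<tau> (\<lambda>j. q j z) = energy m \<tau> (\<lambda>j. q' j z)
      \<and> energy_source m (\<lambda>j. q j z) = energy_source m (\<lambda>j. q' j z)"
proof -
  have "AE z in cyl T a b. \<forall>j\<in>{..<m}. q j z = q' j z"
    using assms(1) by (intro AE_finite_allI) (auto simp: rep_def)
  then show ?thesis
  proof eventually_elim
    case (elim z)
    have "energy m \<tau> (\<lambda>j. q j z) = energy m \<tau> (\<lambda>j. q' j z)"
      unfolding energy_def using elim assms(2) by (auto intro!: arg_cong2[of _ _ _ _ "(+)"] sum.cong)
    moreover have "m div 2 < m" using assms(2) by simp
    then have "energy_source m (\<lambda>j. q j z) = energy_source m (\<lambda>j. q' j z)"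
      using elim unfolding energy_source_def by simp
    ultimately show ?case by simp
  qed
qed

lemma bb_energy:
  fixes q :: "nat \<Rightarrow> 'a::topological_space \<Rightarrow> real"
  shows "(\<And>j. j < m \<Longrightarrow> bb (q j)) \<Longrightarrow> m \<ge> 2 \<Longrightarrow> bb (\<lambda>z. energy m \<tau> (\<lambda>j. q j z))"
  unfolding energy_def by (intro bb_add bb_mult bb_const bb_power2 bb_sum) auto

lemma bb_energy_source: "(\<And>j. j < m \<Longrightarrow> bb (q j)) \<Longrightarrow> m \<ge> 2 \<Longrightarrow> bb (\<lambda>z. energy_source m (\<lambda>j. q j z))"
  unfolding energy_source_def by (intro bb_minus bb_power2) auto

text \<open>Tests that are constant in x turn the entropy inequality into a weak inequality in time
  for the total energy; \<open>weak_upper_bound\<close> makes it hold at almost every time,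
  including the initial energy.\<close>

lemma entropy_energy:
  assumes ent: "entropy_solution f \<Phi> m T a b \<tau> qin q" and m: "m \<ge> 2"
    and rep: "\<And>j. j < m \<Longrightarrow> rep (q j) (q' j)"
    and qin: "\<And>j. j < m \<Longrightarrow> Linf (circ a b) (qin j)" "\<And>j. j < m \<Longrightarrow> bb (qin' j)"
      "\<And>j. j < m \<Longrightarrow> AE x in J a b. qin j x = qin' j x"
  shows "AE t in J 0 T. xint (\<lambda>z. energy m \<tau> (\<lambda>j. q' j z)) t
      \<le> (LINT x|J a b. energy m \<tau> (\<lambda>j. qin' j x)) + pint (\<lambda>z. energy_source m (\<lambda>j. q' j z)) t"
proof -
  let ?E = "\<lambda>z. energy m \<tau> (\<lambda>j. q j z)" and ?E' = "\<lambda>z. energy m \<tau> (\<lambda>j. q' j z)"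
  let ?S = "\<lambda>z. energy_source m (\<lambda>j. q j z)" and ?S' = "\<lambda>z. energy_source m (\<lambda>j. q' j z)"
  have bbq: "bb (q' j)" if "j < m" for j using rep[OF that] by (rule rep_bb)
  have bbE: "bb ?E'" by (rule bb_energy[OF bbq m])
  have bbS: "bb ?S'" by (rule bb_energy_source[OF bbq m])
  have qm: "q j \<in> borel_measurable (cyl T a b)" if "j < m" for j
    using ent that by (simp add: entropy_solution_def Linf_def)
  have Em [measurable]: "?E \<in> borel_measurable (cyl T a b)"
    unfolding energy_def using qm m
    by (intro borel_measurable_add borel_measurable_times borel_measurable_const borel_measurable_power borel_measurable_sum) auto
  have Sm [measurable]: "?S \<in> borel_measurable (cyl T a b)"
    unfolding energy_source_def using qm m
    by (intro borel_measurable_uminus borel_measurable_power) auto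
  have "AE t in J 0 T. xint ?E' t \<le> (LINT x|J a b. energy m \<tau> (\<lambda>j. qin' j x)) + prim 0 T (xint ?S') t"
  proof (rule weak_upper_bound[OF bb_xint[OF bbE] bb_xint[OF bbS] T_pos])
    fix \<theta> \<theta>' s
    assume \<theta>: "smooth1 \<theta>" "bb \<theta>" "\<And>x. (\<theta> has_real_derivative \<theta>' x) (at x)" "bb \<theta>'"
      "\<And>t. \<theta> t \<ge> 0" "s < T" "\<And>t. t \<ge> s \<Longrightarrow> \<theta> t = 0"
    have \<theta>': "deriv \<theta> = \<theta>'" using \<theta>(3) by (auto intro: DERIV_imp_deriv)
    let ?p = "pf \<theta> (\<lambda>x. 1)"
    have dtp: "dt ?p = pf \<theta>' (\<lambda>x. 1)" using dt_pf[OF \<theta>(1)] by (simp add: \<theta>')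
    have dxp: "dx ?p = (\<lambda>z. 0)"
      using dx_pf[OF smooth1_const, of \<theta> 1] by (simp add: pf_def[abs_def])
    have pb: "bb (pf \<theta>' (\<lambda>x. 1))" "bb ?p" by (intro bb_pf \<theta> bb_const)+
    note [measurable] = pb[THEN bb_measurable, THEN measurable_lebesgue_on[of _ "{0<..<T} \<times> {a<..<b}"]]
    have "test_init T a b ?p" by (rule test_init_pf[OF \<theta>(1) circ_test_1 \<theta>(6,7)])
    moreover have "\<forall>t\<ge>0. \<forall>x. ?p (t, x) \<ge> 0" using \<theta>(5) by (simp add: pf_def)
    ultimately have "0 \<le> (LINT z|cyl T a b. ?E z * dt ?p z + energy_flux \<Phi> m (\<lambda>j. q j z) * dx ?p z + ?S z * ?p z)
        + (LINT x|circ a b. energy m \<tau> (\<lambda>j. qin j x) * ?p (0, x))"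
      using ent by (simp add: entropy_solution_def)
    then have ineq: "0 \<le> (LINT z|cyl T a b. ?E z * pf \<theta>' (\<lambda>x. 1) z + ?S z * ?p z)
        + (LINT x|circ a b. energy m \<tau> (\<lambda>j. qin j x) * ?p (0, x))"
      by (simp add: dtp dxp)
    have "(LINT z|cyl T a b. ?E z * pf \<theta>' (\<lambda>x. 1) z + ?S z * ?p z)
        = (LINT t|J 0 T. xint (\<lambda>z. ?E' z * pf \<theta>' (\<lambda>x. 1) z + ?S' z * ?p z) t)"
    proof (rule cyl_integral_cong)
      show "AE z in cyl T a b. ?E z * pf \<theta>' (\<lambda>x. 1) z + ?S z * ?p z = ?E' z * pf \<theta>' (\<lambda>x. 1) z + ?S' z * ?p z"
      proof -
        have "AE z in cyl T a b. ?E z = ?E' z \<and> ?S z = ?S' z"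
          by (rule rep_energy[OF _ m]) (rule rep)
        then show ?thesis by eventually_elim simp
      qed
      show "bb (\<lambda>z. ?E' z * pf \<theta>' (\<lambda>x. 1) z + ?S' z * ?p z)" by (intro bb_add bb_mult bbE bbS pb)
    qed measurable
    also have "\<dots> = (LINT t|J 0 T. xint ?E' t * \<theta>' t + xint ?S' t * \<theta> t)"
      by (rule Bochner_Integration.integral_cong)
        (simp_all add: xint_add bb_mult bbE bbS pb xint_pf, simp add: ip_def sl_def xint_def)
    finally have 1: "(LINT z|cyl T a b. ?E z * pf \<theta>' (\<lambda>x. 1) z + ?S z * ?p z)
        = (LINT t|J 0 T. xint ?E' t * \<theta>' t + xint ?S' t * \<theta> t)" .
    have 2: "(LINT x|circ a b. energy m \<tau> (\<lambda>j. qin j x) * ?p (0, x))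
        = (LINT x|J a b. energy m \<tau> (\<lambda>j. qin' j x)) * \<theta> 0"
    proof -
      have qinm: "qin j \<in> borel_measurable (circ a b)" if "j < m" for j
        using qin(1)[OF that] by (simp add: Linf_def)
      have bbin: "bb (\<lambda>x. energy m \<tau> (\<lambda>j. qin' j x))" by (rule bb_energy[OF qin(2) m])
      have "AE x in circ a b. \<forall>j\<in>{..<m}. qin j x = qin' j x"
        using qin(3) by (intro AE_finite_allI) (auto simp: AE_lebesgue_on_J)
      then have "AE x in circ a b. energy m \<tau> (\<lambda>j. qin j x) = energy m \<tau> (\<lambda>j. qin' j x)"
        by eventually_elim (use m in \<open>auto simp: energy_def intro!: arg_cong2[of _ _ _ _ "(+)"] sum.cong\<close>)
      moreover have "(\<lambda>x. energy m \<tau> (\<lambda>j. qin j x)) \<in> borel_measurable (circ a b)"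
        unfolding energy_def using qinm m
        by (intro borel_measurable_add borel_measurable_times borel_measurable_const borel_measurable_power borel_measurable_sum) auto
      ultimately have "(LINT x|circ a b. energy m \<tau> (\<lambda>j. qin j x)) = (LINT x|circ a b. energy m \<tau> (\<lambda>j. qin' j x))"
        by (intro integral_cong_AE measurable_lebesgue_on[OF bb_measurable[OF bbin]])
      then show ?thesis by (simp add: pf_def integral_lebesgue_on_J[OF bb_measurable[OF bbin]])
    qed
    show "0 \<le> (LINT t|J 0 T. xint ?E' t * \<theta>' t + xint ?S' t * \<theta> t)
        + (LINT x|J a b. energy m \<tau> (\<lambda>j. qin' j x)) * \<theta> 0"
      using ineq unfolding 1 2 .
  qed
  then show ?thesis by (simp add: pint_def)
qed

lemma entropy_evol:
  assumes ent: "entropy_solution f \<Phi> m T a b \<tau> qin q" and m: "m \<ge> 2" and f: "continuous_on UNIV f"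
    and rep: "\<And>j. j < m \<Longrightarrow> rep (q j) (q' j)"
    and qin: "\<And>j. j < m \<Longrightarrow> Linf (circ a b) (qin j)" "\<And>j. j < m \<Longrightarrow> bb (qin' j)"
      "\<And>j. j < m \<Longrightarrow> AE x in J a b. qin j x = qin' j x"
  shows "evol (q' 0) (\<lambda>z. f (q' 0 z) + sigma0 m * q' (m - 1) z) (\<lambda>z. 0) (qin' 0)"
    and "j \<in> {1..m - 1} \<Longrightarrow> evol (\<lambda>z. \<tau> * q' j z) (\<lambda>z. sgn_eq m j * q' (m - j - 1) z)
      (\<lambda>z. sgn_eq m j * q' (m - j) z) (\<lambda>x. \<tau> * qin' j x)"
proof -
  have qm: "q j \<in> borel_measurable (cyl T a b)" if "j < m" for j
    using ent that by (simp add: entropy_solution_def Linf_def)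
  have [measurable]: "f \<in> borel_measurable borel" by (rule borel_measurable_continuous_onI[OF f])
  have weak: "weak_sol_system f m T a b \<tau> qin q" using ent by (simp add: entropy_solution_def)
  have ix: "0 < m" "m - 1 < m" using m by auto
  note [measurable] = qm[OF ix(1)] qm[OF ix(2)]
  show "evol (q' 0) (\<lambda>z. f (q' 0 z) + sigma0 m * q' (m - 1) z) (\<lambda>z. 0) (qin' 0)"
  proof (rule evol_of_weak[where h = "q 0" and G = "\<lambda>z. f (q 0 z) + sigma0 m * q (m - 1) z" and S = "\<lambda>z. 0"])
    show "rep (\<lambda>z. f (q 0 z) + sigma0 m * q (m - 1) z) (\<lambda>z. f (q' 0 z) + sigma0 m * q' (m - 1) z)"
      by (rule rep_add[OF rep_compose[OF rep[OF ix(1)] f] rep_cmult[OF rep[OF ix(2)]]])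
    show "rep (\<lambda>z. 0) (\<lambda>z. 0)" by (simp add: rep_def bb_const)
    show "(\<lambda>z. f (q 0 z) + sigma0 m * q (m - 1) z) \<in> borel_measurable (cyl T a b)"
      by measurable
    fix \<phi> assume "test_init T a b \<phi>"
    then have "(LINT z|cyl T a b. q 0 z * dt \<phi> z + f (q 0 z) * dx \<phi> z + sigma0 m * q (m - 1) z * dx \<phi> z)
          + (LINT x|circ a b. qin 0 x * \<phi> (0, x)) = 0"
      using weak by (simp add: weak_sol_system_def)
    then show "(LINT z|cyl T a b. q 0 z * dt \<phi> z + (f (q 0 z) + sigma0 m * q (m - 1) z) * dx \<phi> z + 0 * \<phi> z)
          + (LINT x|circ a b. qin 0 x * \<phi> (0, x)) = 0"
      by (simp add: distrib_right add.assoc)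
  qed (use rep qin ix in auto)
  assume j: "j \<in> {1..m - 1}"
  then have jx: "j < m" "m - j - 1 < m" "m - j < m" by auto
  note [measurable] = qm[OF jx(1)] qm[OF jx(2)] qm[OF jx(3)]
  show "evol (\<lambda>z. \<tau> * q' j z) (\<lambda>z. sgn_eq m j * q' (m - j - 1) z)
      (\<lambda>z. sgn_eq m j * q' (m - j) z) (\<lambda>x. \<tau> * qin' j x)"
  proof (rule evol_of_weak[where h = "\<lambda>z. \<tau> * q j z" and G = "\<lambda>z. sgn_eq m j * q (m - j - 1) z"
      and S = "\<lambda>z. sgn_eq m j * q (m - j) z" and ?g0.0 = "\<lambda>x. \<tau> * qin j x"])
    show "Linf (circ a b) (\<lambda>x. \<tau> * qin j x)"
    proof -
      obtain C where C: "AE x in circ a b. \<bar>qin j x\<bar> \<le> C" and [measurable]: "qin j \<in> borel_measurable (circ a b)"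
        using qin(1)[OF jx(1)] by (auto simp: Linf_def)
      have "AE x in circ a b. \<bar>\<tau> * qin j x\<bar> \<le> \<bar>\<tau>\<bar> * C"
        using C by eventually_elim (simp add: abs_mult mult_left_mono)
      then show ?thesis by (auto simp: Linf_def)
    qed
    show "(\<lambda>z. sgn_eq m j * q (m - j - 1) z) \<in> borel_measurable (cyl T a b)" by measurable
    show "rep (\<lambda>z. sgn_eq m j * q (m - j - 1) z) (\<lambda>z. sgn_eq m j * q' (m - j - 1) z)"
      by (rule rep_cmult[OF rep[OF jx(2)]])
    show "AE x in J a b. \<tau> * qin j x = \<tau> * qin' j x"
      using qin(3)[OF jx(1)] by eventually_elim simp
    fix \<phi> assume "test_init T a b \<phi>"
    then have "(LINT z|cyl T a b. \<tau> * q j z * dt \<phi> z + sgn_eq m j * q (m - j - 1) z * dx \<phi> z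
        + sgn_eq m j * q (m - j) z * \<phi> z) + \<tau> * (LINT x|circ a b. qin j x * \<phi> (0, x)) = 0"
      using weak j by (simp add: weak_sol_system_def)
    then show "(LINT z|cyl T a b. \<tau> * q j z * dt \<phi> z + sgn_eq m j * q (m - j - 1) z * dx \<phi> z
        + sgn_eq m j * q (m - j) z * \<phi> z) + (LINT x|circ a b. \<tau> * qin j x * \<phi> (0, x)) = 0"
      by (simp add: mult.assoc)
  qed (auto intro!: rep_cmult rep jx bb_mult bb_const qin)
qed

end

section \<open>The relative energy\<close>

definition tw :: "real \<Rightarrow> nat \<Rightarrow> real" where
  "tw \<tau> j = (if j = 0 then 1 else \<tau>)"

lemma energy_weighted:
  assumes "m \<ge> 2"
  shows "energy m \<tau> x = (\<Sum>j<m. tw \<tau> j / 2 * (x j)\<^sup>2)"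
proof -
  have "{..<m} = insert 0 {1..m - 1}" using assms by auto
  then show ?thesis by (simp add: energy_def tw_def sum_distrib_left)
qed

section \<open>Sign structure of flux and source\<close>

lemma sgn_eq_0: "m \<ge> 2 \<Longrightarrow> sgn_eq m 0 = sigma0 m"
  by (simp add: sgn_eq_def)

lemma sgn_eq_square: "sgn_eq m j * sgn_eq m j = 1"
  by (auto simp: sgn_eq_def sigma0_def minus_one_power_iff)

text \<open>The linear flux couples j with m - 1 - j; equality of the two signs means that its
  matrix is symmetric, which is what makes the quadratic energy compatible with it.\<close>

lemma sgn_eq_reflect:
  assumes "even m" "j < m"
  shows "sgn_eq m (m - Suc j) = sgn_eq m j"
proof -
  obtain n where n: "m = 2 * n" using assms(1) by (auto elim: evenE)
  then have "m div 2 = n" by simp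
  then show ?thesis using assms(2) n
    unfolding sgn_eq_def sigma0_def minus_one_power_iff by (auto; presburger)
qed

text \<open>The source couples j with m - j, and opposite signs mean that such a pair does not
  change the energy. The reflection fixes only m/2, where the sign is -1 and energy is
  dissipated.\<close>

lemma sgn_eq_opposite:
  assumes "even m" "1 \<le> j" "j < m" "j \<noteq> m div 2"
  shows "sgn_eq m (m - j) = - sgn_eq m j"
proof -
  obtain n where n: "m = 2 * n" using assms(1) by (auto elim: evenE)
  then have "m div 2 = n" by simp
  then show ?thesis using assms(2-4) n
    unfolding sgn_eq_def sigma0_def minus_one_power_iff by (auto; presburger)
qed

lemma sgn_eq_middle:
  assumes "even m" "m \<ge> 2"
  shows "sgn_eq m (m div 2) = - 1"
proof -
  obtain n where n: "m = 2 * n" using assms(1) by (auto elim: evenE)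
  then have "m div 2 = n" by simp
  then show ?thesis using assms(2) n
    unfolding sgn_eq_def sigma0_def minus_one_power_iff by (auto; presburger)
qed

lemma sum_sgn_reflect:
  assumes "even m"
  shows "(\<Sum>j<m. sgn_eq m j * x (m - 1 - j) * y j) = (\<Sum>j<m. sgn_eq m j * x j * y (m - 1 - j))"
proof -
  have "(\<Sum>j<m. sgn_eq m j * x (m - 1 - j) * y j)
      = (\<Sum>j<m. sgn_eq m (m - Suc j) * x (m - 1 - (m - Suc j)) * y (m - Suc j))"
    by (rule sum.nat_diff_reindex[symmetric])
  also have "\<dots> = (\<Sum>j<m. sgn_eq m j * x j * y (m - 1 - j))"
    by (rule sum.cong) (auto simp: sgn_eq_reflect[OF assms])
  finally show ?thesis .
qed

text \<open>Polarised energy balance of the source: the reflection of j to m - j cancels all pairs,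
  and only the damped component remains.\<close>

lemma sum_sgn_opposite:
  fixes x y :: "nat \<Rightarrow> real"
  assumes "even m" "m \<ge> 2"
  shows "(\<Sum>j=1..m - 1. sgn_eq m j * (x (m - j) * y j + x j * y (m - j))) = - 2 * x (m div 2) * y (m div 2)"
proof -
  have rev: "(\<Sum>j=1..m - 1. g j) = (\<Sum>j=1..m - 1. g (m - j))" for g :: "nat \<Rightarrow> real"
    by (rule sum.reindex_bij_witness[of _ "\<lambda>j. m - j" "\<lambda>j. m - j"]) auto
  have "(\<Sum>j=1..m - 1. sgn_eq m j * (x (m - j) * y j + x j * y (m - j)))
      = (\<Sum>j=1..m - 1. sgn_eq m j * x (m - j) * y j) + (\<Sum>j=1..m - 1. sgn_eq m j * x j * y (m - j))"
    by (simp add: sum.distrib[symmetric] distrib_left mult.assoc)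
  also have "(\<Sum>j=1..m - 1. sgn_eq m j * x (m - j) * y j)
      = (\<Sum>j=1..m - 1. sgn_eq m (m - j) * x (m - (m - j)) * y (m - j))"
    by (rule rev)
  also have "\<dots> = (\<Sum>j=1..m - 1. sgn_eq m (m - j) * x j * y (m - j))"
    by (rule sum.cong) auto
  also have "\<dots> + (\<Sum>j=1..m - 1. sgn_eq m j * x j * y (m - j))
      = (\<Sum>j=1..m - 1. (sgn_eq m (m - j) + sgn_eq m j) * (x j * y (m - j)))"
    by (simp add: sum.distrib[symmetric] distrib_right mult.assoc)
  also have "\<dots> = (\<Sum>j=1..m - 1. if j = m div 2 then - 2 * x j * y (m - j) else 0)"
  proof (rule sum.cong[OF refl])
    fix j assume j: "j \<in> {1..m - 1}"
    show "(sgn_eq m (m - j) + sgn_eq m j) * (x j * y (m - j)) = (if j = m div 2 then - 2 * x j * y (m - j) else 0)"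
    proof (cases "j = m div 2")
      case True
      then have "m - j = m div 2" using assms(1) by auto
      then show ?thesis using True sgn_eq_middle[OF assms] by simp
    next
      case False
      moreover have "1 \<le> j" "j < m" using j assms(2) by auto
      ultimately show ?thesis using sgn_eq_opposite[OF assms(1)] by simp
    qed
  qed
  also have "\<dots> = - 2 * x (m div 2) * y (m - m div 2)"
    using assms(2) by (subst sum.delta) auto
  also have "m - m div 2 = m div 2" using assms(1) by auto
  finally show ?thesis .
qed

section \<open>Residuals and the algebra of the relative energy\<close>

definition resid :: "nat \<Rightarrow> real \<Rightarrow> real \<Rightarrow> (nat \<Rightarrow> real) \<Rightarrow> (nat \<Rightarrow> real) \<Rightarrow> (nat \<Rightarrow> real) \<Rightarrow> nat \<Rightarrow> real" where
  "resid m \<tau> f' W Wt Wx j = tw \<tau> j * Wt j + sgn_eq m j * Wx (m - 1 - j)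
      + (if j = 0 then f' * Wx 0 else - (sgn_eq m j * W (m - j)))"

definition flux_j :: "nat \<Rightarrow> real \<Rightarrow> (nat \<Rightarrow> real) \<Rightarrow> nat \<Rightarrow> real" where
  "flux_j m fq q j = sgn_eq m j * q (m - 1 - j) + (if j = 0 then fq else 0)"

definition source_j :: "nat \<Rightarrow> (nat \<Rightarrow> real) \<Rightarrow> nat \<Rightarrow> real" where
  "source_j m q j = (if j = 0 then 0 else sgn_eq m j * q (m - j))"

text \<open>The density of the time derivative of the energy of q - W after expansion of the square:
  the source of the energy of q, minus the product rule for the mixed terms, plus the time
  derivative of the energy of W. The x-derivative of the flux has been moved to W.\<close>

definition rate :: "nat \<Rightarrow> real \<Rightarrow> real \<Rightarrow> (nat \<Rightarrow> real) \<Rightarrow> (nat \<Rightarrow> real) \<Rightarrow> (nat \<Rightarrow> real) \<Rightarrow> (nat \<Rightarrow> real) \<Rightarrow> real" where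
  "rate m \<tau> fq q W Wt Wx = energy_source m q
      - (\<Sum>j<m. flux_j m fq q j * Wx j + source_j m q j * W j + tw \<tau> j * q j * Wt j)
      + (\<Sum>j<m. tw \<tau> j * W j * Wt j)"

text \<open>The source terms combine to the square of the difference of the damped components, the
  other terms regroup into residuals of W. The numbers \<open>f'\<close> and \<open>fW\<close>
  cancel on the right; they are inserted so that the nonlinear flux enters through a first-order
  Taylor remainder. The last bracket is an x-derivative once W is a function and \<open>fW\<close>
  is f at \<open>W 0\<close>.\<close>

lemma rate_identity:
  fixes q W Wt Wx :: "nat \<Rightarrow> real"
  assumes m: "even m" "m \<ge> 2"
  defines "h \<equiv> m div 2"
  shows "rate m \<tau> fq q W Wt Wx = - (q h - W h)\<^sup>2 - (\<Sum>j<m. (q j - W j) * resid m \<tau> f' W Wt Wx j)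
      - (fq - fW - f' * (q 0 - W 0)) * Wx 0 - (fW * Wx 0 + (\<Sum>j<m. sgn_eq m j * W j * Wx (m - 1 - j)))"
proof -
  let ?s = "sgn_eq m"
  have split: "(\<Sum>j<m. g j) = g 0 + (\<Sum>j=1..m - 1. g j)" for g :: "nat \<Rightarrow> real"
  proof -
    have "{..<m} = insert 0 {1..m - 1}" using m by auto
    then show ?thesis by simp
  qed
  have flux: "(\<Sum>j<m. flux_j m fq q j * Wx j) = fq * Wx 0 + (\<Sum>j<m. ?s j * q j * Wx (m - 1 - j))"
  proof -
    have "(\<Sum>j<m. flux_j m fq q j * Wx j) = (\<Sum>j<m. ?s j * q (m - 1 - j) * Wx j + (if j = 0 then fq * Wx 0 else 0))"
      by (rule sum.cong) (auto simp: flux_j_def algebra_simps)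
    also have "\<dots> = (\<Sum>j<m. ?s j * q (m - 1 - j) * Wx j) + fq * Wx 0"
      using m by (simp add: sum.distrib sum.delta)
    finally show ?thesis by (simp only: sum_sgn_reflect[OF m(1)] add.commute)
  qed
  have src: "(\<Sum>j<m. source_j m q j * W j) = (\<Sum>j=1..m - 1. ?s j * q (m - j) * W j)"
    unfolding split by (auto simp: source_j_def intro!: sum.cong)
  have res: "(\<Sum>j<m. (q j - W j) * resid m \<tau> f' W Wt Wx j)
      = (\<Sum>j<m. tw \<tau> j * q j * Wt j) - (\<Sum>j<m. tw \<tau> j * W j * Wt j)
        + (\<Sum>j<m. ?s j * q j * Wx (m - 1 - j)) - (\<Sum>j<m. ?s j * W j * Wx (m - 1 - j))
        + (q 0 - W 0) * f' * Wx 0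
        - (\<Sum>j=1..m - 1. ?s j * q j * W (m - j)) + (\<Sum>j=1..m - 1. ?s j * W j * W (m - j))"
  proof -
    have "(\<Sum>j<m. (q j - W j) * resid m \<tau> f' W Wt Wx j)
        = (\<Sum>j<m. (tw \<tau> j * q j * Wt j - tw \<tau> j * W j * Wt j
            + (?s j * q j * Wx (m - 1 - j) - ?s j * W j * Wx (m - 1 - j)))
          + (q j - W j) * (if j = 0 then f' * Wx 0 else - (?s j * W (m - j))))"
      by (rule sum.cong) (auto simp: resid_def algebra_simps)
    also have "\<dots> = ((\<Sum>j<m. tw \<tau> j * q j * Wt j) - (\<Sum>j<m. tw \<tau> j * W j * Wt j)
        + ((\<Sum>j<m. ?s j * q j * Wx (m - 1 - j)) - (\<Sum>j<m. ?s j * W j * Wx (m - 1 - j))))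
        + (\<Sum>j<m. (q j - W j) * (if j = 0 then f' * Wx 0 else - (?s j * W (m - j))))"
      by (simp only: sum.distrib sum_subtractf)
    also have "(\<Sum>j<m. (q j - W j) * (if j = 0 then f' * Wx 0 else - (?s j * W (m - j))))
        = (q 0 - W 0) * f' * Wx 0 + (\<Sum>j=1..m - 1. ?s j * W j * W (m - j) - ?s j * q j * W (m - j))"
      unfolding split by (auto simp: algebra_simps intro!: sum.cong)
    finally show ?thesis by (simp add: sum_subtractf)
  qed
  have U: "(\<Sum>j=1..m - 1. ?s j * q (m - j) * W j) + (\<Sum>j=1..m - 1. ?s j * q j * W (m - j)) = - 2 * q h * W h"
    using sum_sgn_opposite[OF m, of q W] by (simp add: sum.distrib distrib_left mult.assoc h_def)
  have V: "(\<Sum>j=1..m - 1. ?s j * W j * W (m - j)) = - (W h)\<^sup>2"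
  proof -
    have "(\<Sum>j=1..m - 1. ?s j * (W (m - j) * W j + W j * W (m - j))) = 2 * (\<Sum>j=1..m - 1. ?s j * W j * W (m - j))"
      by (simp add: sum_distrib_left mult_ac)
    then show ?thesis using sum_sgn_opposite[OF m, of W W] by (simp add: power2_eq_square h_def)
  qed
  have "rate m \<tau> fq q W Wt Wx = - (q h)\<^sup>2 - (fq * Wx 0 + (\<Sum>j<m. ?s j * q j * Wx (m - 1 - j))
      + (\<Sum>j=1..m - 1. ?s j * q (m - j) * W j) + (\<Sum>j<m. tw \<tau> j * q j * Wt j)) + (\<Sum>j<m. tw \<tau> j * W j * Wt j)"
    unfolding rate_def energy_source_def sum.distrib flux src h_def ..
  then show ?thesis
    unfolding res using U V by (simp add: power2_eq_square algebra_simps)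
qed

text \<open>The mean value theorem already gives the quadratic order; the constant is C rather than
  the C/2 of an integral remainder.\<close>

lemma lipschitz_derivative_remainder:
  fixes f :: "real \<Rightarrow> real"
  assumes D: "\<And>s. (f has_real_derivative f' s) (at s)" and L: "\<And>s t. \<bar>f' s - f' t\<bar> \<le> C * \<bar>s - t\<bar>"
  shows "\<bar>f x - f y - f' y * (x - y)\<bar> \<le> C * (x - y)\<^sup>2"
proof (cases "x = y")
  case False
  obtain z where z: "f x - f y = (x - y) * f' z" "\<bar>z - y\<bar> \<le> \<bar>x - y\<bar>"
  proof (cases "x < y")
    case True
    obtain z where "x < z" "z < y" "f y - f x = (y - x) * f' z" using MVT2[OF True D] by blast
    then show ?thesis by (intro that[of z]) (auto simp: algebra_simps)
  next
    case False
    then have "y < x" using \<open>x \<noteq> y\<close> by simp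
    obtain z where "y < z" "z < x" "f x - f y = (x - y) * f' z" using MVT2[OF \<open>y < x\<close> D] by blast
    then show ?thesis by (intro that[of z]) auto
  qed
  have C: "C \<ge> 0" using L[of 1 0] by simp
  have "\<bar>f x - f y - f' y * (x - y)\<bar> = \<bar>x - y\<bar> * \<bar>f' z - f' y\<bar>"
    unfolding z(1) abs_mult[symmetric] by (simp add: algebra_simps)
  also have "\<dots> \<le> \<bar>x - y\<bar> * (C * \<bar>x - y\<bar>)"
    using L[of z y] z(2) C by (intro mult_left_mono order_trans[OF L[of z y]]) auto
  also have "\<dots> = C * (x - y)\<^sup>2" by (simp add: power2_eq_square mult_ac flip: abs_mult)
  finally show ?thesis .
qed simp

text \<open>Young's inequality with a weight for each kind of component: 1 for component 0 and
  \<tau> for the undamped ones, both absorbed by the energy, and the dissipated square for component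
  m/2. Each component leaves at most \<kappa>^2 \<tau>^2 / 2, whence the factor m.\<close>

lemma rate_bound:
  fixes q W Wt Wx :: "nat \<Rightarrow> real"
  assumes m: "even m" "m \<ge> 2" and \<tau>: "0 < \<tau>" "\<tau> \<le> 1"
    and rel: "\<bar>fq - fW - f' * (q 0 - W 0)\<bar> \<le> C * (q 0 - W 0)\<^sup>2" and C: "0 \<le> C" and \<kappa>: "\<bar>Wx 0\<bar> \<le> \<kappa>"
    and R: "\<And>j. j < m \<Longrightarrow> \<bar>resid m \<tau> f' W Wt Wx j\<bar> \<le> (if j = 0 \<or> j = m div 2 then \<kappa> * \<tau> else \<kappa> * \<tau>\<^sup>2)"
  shows "rate m \<tau> fq q W Wt Wx + (fW * Wx 0 + (\<Sum>j<m. sgn_eq m j * W j * Wx (m - 1 - j)))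
      \<le> (1 + 2 * C * \<kappa>) * energy m \<tau> (\<lambda>j. q j - W j) + real m * \<kappa>\<^sup>2 * \<tau>\<^sup>2 / 2"
proof -
  let ?h = "m div 2" and ?d = "\<lambda>j. q j - W j" and ?r = "resid m \<tau> f' W Wt Wx"
  have h: "?h \<noteq> 0" "?h < m" using m by auto
  have \<kappa>0: "0 \<le> \<kappa>" using \<kappa> by linarith
  have each: "- (?d j * ?r j) \<le> tw \<tau> j / 2 * (?d j)\<^sup>2 + \<kappa>\<^sup>2 * \<tau>\<^sup>2 / 2 + (if j = ?h then (?d j)\<^sup>2 else 0)" if j: "j < m" for j
  proof -
    have *: "- (x * y) \<le> c / 2 * x\<^sup>2 + M\<^sup>2 / (2 * c)" if "\<bar>y\<bar> \<le> M" "c > 0" for x y c M :: real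
    proof -
      have "0 \<le> (c * x + y)\<^sup>2" by simp
      then have "- (2 * c * (x * y)) \<le> c\<^sup>2 * x\<^sup>2 + y\<^sup>2" by (simp add: power2_sum power_mult_distrib)
      also have "y\<^sup>2 \<le> M\<^sup>2" using that(1) by (simp add: abs_le_square_iff[symmetric])
      finally have "- (2 * c * (x * y)) \<le> c\<^sup>2 * x\<^sup>2 + M\<^sup>2" by simp
      then have "- (2 * c * (x * y)) / (2 * c) \<le> (c\<^sup>2 * x\<^sup>2 + M\<^sup>2) / (2 * c)"
        using that(2) by (intro divide_right_mono) auto
      then show ?thesis using that(2) by (simp add: add_divide_distrib power2_eq_square)
    qed
    consider "j = 0" | "j = ?h" | "j \<noteq> 0" "j \<noteq> ?h" by blast
    then show ?thesis
    proof cases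
      case 1
      then have "\<bar>?r j\<bar> \<le> \<kappa> * \<tau>" using R[OF j] by simp
      from *[OF this, of 1 "?d j"] show ?thesis using 1 h by (simp add: tw_def power_mult_distrib)
    next
      case 2
      then have "\<bar>?r j\<bar> \<le> \<kappa> * \<tau>" using R[OF j] by simp
      \<comment> \<open>The weight 2 uses up exactly the square \<open>(?d j)\<^sup>2\<close>
        supplied by the damping in \<open>rate_identity\<close>.\<close>
      from *[OF this, of 2 "?d j"] have "- (?d j * ?r j) \<le> (?d j)\<^sup>2 + \<kappa>\<^sup>2 * \<tau>\<^sup>2 / 4" by (simp add: power_mult_distrib)
      moreover have "0 \<le> tw \<tau> j / 2 * (?d j)\<^sup>2" using \<tau> by (simp add: tw_def)
      moreover have "\<kappa>\<^sup>2 * \<tau>\<^sup>2 / 4 \<le> \<kappa>\<^sup>2 * \<tau>\<^sup>2 / 2" by simp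
      ultimately have "- (?d j * ?r j) \<le> tw \<tau> j / 2 * (?d j)\<^sup>2 + \<kappa>\<^sup>2 * \<tau>\<^sup>2 / 2 + (?d j)\<^sup>2" by linarith
      then show ?thesis using 2 by simp
    next
      case 3
      then have "\<bar>?r j\<bar> \<le> \<kappa> * \<tau>\<^sup>2" using R[OF j] by simp
      from *[OF this \<tau>(1), of "?d j"]
      have "- (?d j * ?r j) \<le> \<tau> / 2 * (?d j)\<^sup>2 + (\<kappa> * \<tau>\<^sup>2)\<^sup>2 / (2 * \<tau>)" .
      also have "(\<kappa> * \<tau>\<^sup>2)\<^sup>2 / (2 * \<tau>) = \<kappa>\<^sup>2 * \<tau>\<^sup>2 / 2 * \<tau>"
        using \<tau> by (simp add: power2_eq_square)
      also have "\<dots> \<le> \<kappa>\<^sup>2 * \<tau>\<^sup>2 / 2" using \<tau> by (intro mult_left_le) auto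
      finally show ?thesis using 3 by (simp add: tw_def)
    qed
  qed
  have "- (\<Sum>j<m. ?d j * ?r j) = (\<Sum>j<m. - (?d j * ?r j))" by (simp add: sum_negf)
  also have "\<dots> \<le> (\<Sum>j<m. tw \<tau> j / 2 * (?d j)\<^sup>2 + \<kappa>\<^sup>2 * \<tau>\<^sup>2 / 2 + (if j = ?h then (?d j)\<^sup>2 else 0))"
    by (rule sum_mono) (use each in auto)
  also have "\<dots> = energy m \<tau> ?d + real m * \<kappa>\<^sup>2 * \<tau>\<^sup>2 / 2 + (?d ?h)\<^sup>2"
    using h by (simp add: sum.distrib sum.delta energy_weighted[OF m(2)])
  finally have 1: "- (\<Sum>j<m. ?d j * ?r j) \<le> energy m \<tau> ?d + real m * \<kappa>\<^sup>2 * \<tau>\<^sup>2 / 2 + (?d ?h)\<^sup>2" .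
  have "- ((fq - fW - f' * (q 0 - W 0)) * Wx 0) \<le> \<bar>(fq - fW - f' * (q 0 - W 0)) * Wx 0\<bar>" by linarith
  also have "\<dots> \<le> C * (?d 0)\<^sup>2 * \<kappa>" unfolding abs_mult using rel \<kappa> C by (intro mult_mono) auto
  also have "\<dots> \<le> 2 * C * \<kappa> * energy m \<tau> ?d"
  proof -
    have "(?d 0)\<^sup>2 \<le> 2 * energy m \<tau> ?d"
      using \<tau> by (simp add: energy_def sum_nonneg)
    from mult_left_mono[OF this, of "C * \<kappa>"] show ?thesis using C \<kappa>0 by (simp add: mult_ac)
  qed
  finally have 2: "- ((fq - fW - f' * (q 0 - W 0)) * Wx 0) \<le> 2 * C * \<kappa> * energy m \<tau> ?d" .
  show ?thesis
    using rate_identity[OF m, of \<tau> fq q W Wt Wx f' fW] 1 2 by (simp add: algebra_simps)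
qed

context cylinder
begin

text \<open>The energy of q - W is expanded into the energy of q, mixed terms and the energy of W.
  The first is bounded by the entropy inequality; the others are computed by the product rule,
  applied also to W with itself. Residuals and data errors then feed Gronwall's inequality.\<close>

lemma relative_energy_estimate:
  fixes q W Wt Wx :: "nat \<Rightarrow> real \<times> real \<Rightarrow> real" and qin Win :: "nat \<Rightarrow> real \<Rightarrow> real"
  assumes m: "even m" "m \<ge> 2" and \<tau>: "0 < \<tau>" "\<tau> \<le> 1"
    and D: "\<And>s. (f has_real_derivative f' s) (at s)" and L: "\<And>s t. \<bar>f' s - f' t\<bar> \<le> C * \<bar>s - t\<bar>" and C: "0 \<le> C"
    and bb: "\<And>j. j < m \<Longrightarrow> bb (q j)" "\<And>j. j < m \<Longrightarrow> bb (W j)" "\<And>j. j < m \<Longrightarrow> bb (Wt j)" "\<And>j. j < m \<Longrightarrow> bb (Wx j)"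
      "\<And>j. j < m \<Longrightarrow> bb (qin j)" "\<And>j. j < m \<Longrightarrow> bb (Win j)"
    and ev: "\<And>j. j < m \<Longrightarrow> evol (\<lambda>z. tw \<tau> j * q j z) (\<lambda>z. flux_j m (f (q 0 z)) (\<lambda>i. q i z) j)
        (\<lambda>z. source_j m (\<lambda>i. q i z) j) (\<lambda>x. tw \<tau> j * qin j x)"
    and en: "AE t in J 0 T. xint (\<lambda>z. energy m \<tau> (\<lambda>j. q j z)) t
        \<le> (LINT x|J a b. energy m \<tau> (\<lambda>j. qin j x)) + pint (\<lambda>z. energy_source m (\<lambda>j. q j z)) t"
    and td: "\<And>j. j < m \<Longrightarrow> tderiv (W j) (Wt j) (Win j)"
    and sdW: "\<And>j. j < m \<Longrightarrow> AE t in J 0 T. sd (sl (W j) t) (sl (Wx j) t)"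
    and R: "AE t in J 0 T. AE x in J a b. \<bar>Wx 0 (t, x)\<bar> \<le> \<kappa> \<and>
        (\<forall>j<m. \<bar>resid m \<tau> (f' (W 0 (t, x))) (\<lambda>i. W i (t, x)) (\<lambda>i. Wt i (t, x)) (\<lambda>i. Wx i (t, x)) j\<bar>
          \<le> (if j = 0 \<or> j = m div 2 then \<kappa> * \<tau> else \<kappa> * \<tau>\<^sup>2))"
    and init: "\<And>j x. j < m \<Longrightarrow> \<bar>qin j x - Win j x\<bar> \<le> \<kappa> * \<tau>"
  defines "K \<equiv> 1 + 2 * C * \<kappa>"
  shows "AE t in J 0 T. xint (\<lambda>z. energy m \<tau> (\<lambda>j. q j z - W j z)) t
      \<le> real m * \<kappa>\<^sup>2 / 2 * (b - a) * (1 + T) * (1 + K * T * exp (K * T)) * \<tau>\<^sup>2"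
proof -
  let ?\<epsilon> = "\<lambda>z. energy m \<tau> (\<lambda>j. q j z - W j z)"
  let ?\<epsilon>in = "\<lambda>x. energy m \<tau> (\<lambda>j. qin j x - Win j x)"
  let ?rate = "\<lambda>z. rate m \<tau> (f (q 0 z)) (\<lambda>j. q j z) (\<lambda>j. W j z) (\<lambda>j. Wt j z) (\<lambda>j. Wx j z)"
  let ?z = "\<lambda>z. f (W 0 z) * Wx 0 z + (\<Sum>j<m. sgn_eq m j * W j z * Wx (m - 1 - j) z)"
  let ?F = "\<lambda>j z. flux_j m (f (q 0 z)) (\<lambda>i. q i z) j" and ?S = "\<lambda>j z. source_j m (\<lambda>i. q i z) j"
  let ?c = "\<lambda>j z. ?F j z * Wx j z + ?S j z * W j z + tw \<tau> j * q j z * Wt j z"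
  have fc: "continuous_on UNIV f" using D by (meson DERIV_isCont continuous_at_imp_continuous_on)
  have m0: "0 < m" using m by simp
  have bbf: "bb (\<lambda>z. f (q 0 z))" "bb (\<lambda>z. f (W 0 z))"
    by (rule bb_continuous_compose[OF fc], rule bb, rule m0)+
  have bbF: "bb (?F j)" if "j < m" for j
    using that unfolding flux_j_def by (cases "j = 0") (auto intro!: bb_add bb_mult bb_const bb bbf)
  have bbS: "bb (?S j)" if "j < m" for j
    using that unfolding source_j_def by (cases "j = 0") (auto intro!: bb_mult bb_const bb)
  have bbc: "bb (?c j)" if "j < m" for j
    using that by (intro bb_add bb_mult bb_const bb bbF bbS)
  have bb\<epsilon>: "bb ?\<epsilon>" by (rule bb_energy[OF _ m(2)]) (intro bb_diff bb)
  have bb\<epsilon>in: "bb ?\<epsilon>in" by (rule bb_energy[OF _ m(2)]) (intro bb_diff bb)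
  have bbEq: "bb (\<lambda>z. energy m \<tau> (\<lambda>j. q j z))" by (rule bb_energy[OF _ m(2)]) (intro bb)
  have bbsrc: "bb (\<lambda>z. energy_source m (\<lambda>j. q j z))" by (rule bb_energy_source[OF _ m(2)]) (intro bb)
  have bbrate: "bb ?rate"
    unfolding rate_def by (intro bb_add bb_diff bb_sum bb_mult bb_const bbsrc bb bbF bbS) auto
  have bbz1: "bb (\<lambda>z. f (W 0 z) * Wx 0 z)" by (intro bb_mult bbf bb m0)
  have bbz3: "bb (\<lambda>z. sgn_eq m j * W j z * Wx (m - 1 - j) z)" if "j < m" for j
    using that by (intro bb_mult bb_const bb) auto
  have bbz: "bb ?z" by (intro bb_add bbz1 bb_sum bbz3) auto
  have expand: "energy m \<tau> (\<lambda>j. x j - y j)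
      = energy m \<tau> x - (\<Sum>j<m. tw \<tau> j * x j * y j) + (\<Sum>j<m. tw \<tau> j / 2 * (y j * y j))" for x y
  proof -
    have "energy m \<tau> (\<lambda>j. x j - y j) = (\<Sum>j<m. tw \<tau> j / 2 * (x j)\<^sup>2 - tw \<tau> j * x j * y j + tw \<tau> j / 2 * (y j * y j))"
      unfolding energy_weighted[OF m(2)] by (rule sum.cong) (auto simp: power2_eq_square field_simps)
    then show ?thesis unfolding energy_weighted[OF m(2)] by (simp only: sum.distrib sum_subtractf)
  qed
  have cross: "AE t in J 0 T. \<forall>j\<in>{..<m}. xint (\<lambda>z. tw \<tau> j * q j z * W j z) t
      = (LINT x|J a b. tw \<tau> j * qin j x * Win j x) + pint (?c j) t"
  proof (rule AE_finite_allI)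
    fix j assume "j \<in> {..<m}"
    then have j: "j < m" by simp
    show "AE t in J 0 T. xint (\<lambda>z. tw \<tau> j * q j z * W j z) t
      = (LINT x|J a b. tw \<tau> j * qin j x * Win j x) + pint (?c j) t"
      by (rule product_rule_xint[OF ev[OF j] td[OF j] sdW[OF j]]) (intro bb_mult bb_const bb bbF bbS j)+
  qed simp
  have self: "AE t in J 0 T. \<forall>j\<in>{..<m}. xint (\<lambda>z. W j z * W j z) t
      = (LINT x|J a b. Win j x * Win j x) + pint (\<lambda>z. 2 * (W j z * Wt j z)) t"
  proof (rule AE_finite_allI)
    fix j assume "j \<in> {..<m}"
    then have j: "j < m" by simp
    have "AE t in J 0 T. xint (\<lambda>z. W j z * W j z) t
      = (LINT x|J a b. Win j x * Win j x) + pint (\<lambda>z. 0 * Wx j z + Wt j z * W j z + W j z * Wt j z) t"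
      by (rule product_rule_xint[OF tderiv_evol[OF td[OF j]] td[OF j] sdW[OF j]]) (intro bb_const bb j)+
    moreover have "(\<lambda>z. 0 * Wx j z + Wt j z * W j z + W j z * Wt j z) = (\<lambda>z. 2 * (W j z * Wt j z))"
      by (rule ext) simp
    ultimately show "AE t in J 0 T. xint (\<lambda>z. W j z * W j z) t
      = (LINT x|J a b. Win j x * Win j x) + pint (\<lambda>z. 2 * (W j z * Wt j z)) t" by simp
  qed simp
  \<comment> \<open>The bracket left over in \<open>rate_identity\<close> integrates to zero:
    \<open>f (W 0) * Wx 0\<close> is the x-derivative of a primitive of f at \<open>W 0\<close>, and
    in the bilinear part the terms j and m - 1 - j cancel by symmetry of the signs and partial
    integration.\<close>
  have xz: "AE t in J 0 T. xint ?z t = 0"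
  proof -
    have "AE t in J 0 T. \<forall>j\<in>{..<m}. sd (sl (W j) t) (sl (Wx j) t)"
      by (rule AE_finite_allI) (use sdW in auto)
    then show ?thesis
    proof eventually_elim
      case (elim t)
      have sdj: "sd (sl (W j) t) (sl (Wx j) t)" if "j < m" for j using elim that by simp
      have bsl: "bb (sl (W j) t)" "bb (sl (Wx j) t)" if "j < m" for j using that by (auto intro: bb_sl bb)
      have "isCont f x" for x using fc by (simp add: continuous_on_eq_continuous_at)
      then obtain Q where "\<And>x. (Q has_vector_derivative f x) (at x)"
        using einterval_antiderivative[of "-\<infinity>" "\<infinity>" f] by auto
      then have Q: "(Q has_real_derivative f x) (at x)" for x
        by (simp add: has_real_derivative_iff_has_vector_derivative)
      have "sd (\<lambda>x. Q (sl (W 0) t x)) (\<lambda>x. f (sl (W 0) t x) * sl (Wx 0) t x)"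
        by (rule sd_chain[OF sdj bsl Q fc]) (rule m0)+
      from sd_integral_zero[OF this] have 1: "xint (\<lambda>z. f (W 0 z) * Wx 0 z) t = 0"
        by (simp add: xint_def sl_def)
      let ?p = "\<lambda>j. ip (sl (W j) t) (sl (Wx (m - 1 - j)) t)"
      have "(\<Sum>j<m. sgn_eq m j * ?p j) = (\<Sum>j<m. sgn_eq m (m - Suc j) * ?p (m - Suc j))"
        by (rule sum.nat_diff_reindex[symmetric])
      also have "\<dots> = (\<Sum>j<m. sgn_eq m j * ip (sl (W (m - 1 - j)) t) (sl (Wx j) t))"
        by (rule sum.cong) (auto simp: sgn_eq_reflect[OF m(1)])
      also have "\<dots> = (\<Sum>j<m. - (sgn_eq m j * ?p j))"
      proof (rule sum.cong[OF refl])
        fix j assume "j \<in> {..<m}"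
        then have j: "j < m" "m - 1 - j < m" by auto
        have "?p j + ip (sl (W (m - 1 - j)) t) (sl (Wx j) t) = 0"
          by (rule sd_mult_integral_zero[OF sdj[OF j(1)] sdj[OF j(2)]]) (intro bsl j)+
        then have "ip (sl (W (m - 1 - j)) t) (sl (Wx j) t) = - ?p j" by linarith
        then show "sgn_eq m j * ip (sl (W (m - 1 - j)) t) (sl (Wx j) t) = - (sgn_eq m j * ?p j)" by simp
      qed
      finally have 3: "(\<Sum>j<m. sgn_eq m j * ?p j) = 0" by (simp add: sum_negf)
      have "xint ?z t = xint (\<lambda>z. f (W 0 z) * Wx 0 z) t + (\<Sum>j<m. xint (\<lambda>z. sgn_eq m j * W j z * Wx (m - 1 - j) z) t)"
      proof -
        have "xint ?z t = xint (\<lambda>z. f (W 0 z) * Wx 0 z) t + xint (\<lambda>z. \<Sum>j<m. sgn_eq m j * W j z * Wx (m - 1 - j) z) t"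
          by (rule xint_add[OF bbz1 bb_sum]) (simp only: lessThan_iff bbz3)
        also have "xint (\<lambda>z. \<Sum>j<m. sgn_eq m j * W j z * Wx (m - 1 - j) z) t
            = (\<Sum>j<m. xint (\<lambda>z. sgn_eq m j * W j z * Wx (m - 1 - j) z) t)"
          by (rule xint_sum) (simp only: lessThan_iff bbz3)
        finally show ?thesis .
      qed
      also have "(\<Sum>j<m. xint (\<lambda>z. sgn_eq m j * W j z * Wx (m - 1 - j) z) t) = (\<Sum>j<m. sgn_eq m j * ?p j)"
        by (rule sum.cong) (auto simp: mult.assoc xint_cmult xint_ip)
      finally show ?case using 1 3 by simp
    qed
  qed
  have pz: "pint ?z t = 0" for t by (rule pint_zero_AE[OF bbz xz])
  let ?k = "real m * \<kappa>\<^sup>2 * \<tau>\<^sup>2 / 2"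
  have key: "pint ?rate t \<le> K * pint ?\<epsilon> t + ?k * (b - a) * T" for t
  proof -
    have "pint ?rate t = pint (\<lambda>z. ?rate z + ?z z) t"
      unfolding pint_add[OF bbrate bbz] pz by simp
    also have "\<dots> \<le> pint (\<lambda>z. K * ?\<epsilon> z + ?k) t"
    proof (rule pint_mono_AE)
      show "AE t in J 0 T. AE x in J a b. ?rate (t, x) + ?z (t, x) \<le> K * ?\<epsilon> (t, x) + ?k"
        using R
      proof eventually_elim
        case (elim t)
        then show ?case
        proof eventually_elim
          case (elim x)
          show ?case unfolding K_def
            by (rule rate_bound[OF m \<tau> lipschitz_derivative_remainder[OF D L] C]) (use elim in auto)
        qed
      qed
    qed (intro bb_add bb_mult bb_const bbrate bbz bb\<epsilon>)+
    also have "\<dots> = K * pint ?\<epsilon> t + pint (\<lambda>z. ?k) t"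
      by (simp add: pint_add pint_cmult bb_mult bb_const bb\<epsilon>)
    also have "pint (\<lambda>z. ?k) t \<le> ?k * (b - a) * T"
    proof -
      have x: "xint (\<lambda>z. ?k) = (\<lambda>s. ?k * (b - a))"
        using a_less_b by (auto simp: xint_def space_J measure_J)
      have "pint (\<lambda>z. ?k) t \<le> prim 0 T (\<lambda>s. ?k * (b - a)) T"
        unfolding pint_def x prim_def
        by (rule integral_mono[OF bb_integrable[OF bb_cut[OF bb_const]] bb_integrable[OF bb_cut[OF bb_const]]])
          (use a_less_b in \<open>auto simp: indicator_def space_J\<close>)
      also have "\<dots> = ?k * (b - a) * T"
        unfolding prim_end using T_pos by (simp add: space_J measure_J)
      finally show ?thesis .
    qed
    finally show ?thesis by simp
  qed
  \<comment> \<open>The initial data contribute at the same order as the residuals: each component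
    is off by at most \<kappa> \<tau>, and all weights are at most 1.\<close>
  have init': "(LINT x|J a b. ?\<epsilon>in x) \<le> ?k * (b - a)"
  proof -
    have "?\<epsilon>in x \<le> ?k" for x
    proof -
      have "?\<epsilon>in x \<le> (\<Sum>j<m. (\<kappa> * \<tau>)\<^sup>2 / 2)"
        unfolding energy_weighted[OF m(2)]
      proof (rule sum_mono)
        fix j assume "j \<in> {..<m}"
        then have "(qin j x - Win j x)\<^sup>2 \<le> (\<kappa> * \<tau>)\<^sup>2"
          using init[of j x] by (simp add: abs_le_square_iff[symmetric])
        moreover have "tw \<tau> j / 2 \<le> 1 / 2" using \<tau> by (auto simp: tw_def)
        ultimately have "tw \<tau> j / 2 * (qin j x - Win j x)\<^sup>2 \<le> 1 / 2 * (\<kappa> * \<tau>)\<^sup>2"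
          by (intro mult_mono) auto
        then show "tw \<tau> j / 2 * (qin j x - Win j x)\<^sup>2 \<le> (\<kappa> * \<tau>)\<^sup>2 / 2" by simp
      qed
      then show ?thesis by (simp add: power_mult_distrib)
    qed
    then have "(LINT x|J a b. ?\<epsilon>in x) \<le> (LINT x|J a b. ?k)"
      by (intro integral_mono bb_integrable bb\<epsilon>in bb_const)
    also have "(LINT x|J a b. ?k) = ?k * (b - a)"
      using a_less_b by (simp add: space_J measure_J)
    finally show ?thesis .
  qed
  have bbq: "bb (\<lambda>z. tw \<tau> j * q j z * W j z)" if "j < m" for j using that by (intro bb_mult bb_const bb)
  have bbW: "bb (\<lambda>z. tw \<tau> j / 2 * (W j z * W j z))" if "j < m" for j using that by (intro bb_mult bb_const bb)
  have bbWt: "bb (\<lambda>z. tw \<tau> j / 2 * (2 * (W j z * Wt j z)))" if "j < m" for j using that by (intro bb_mult bb_const bb)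
  have main: "AE t in J 0 T. xint ?\<epsilon> t \<le> (LINT x|J a b. ?\<epsilon>in x) + pint ?rate t"
    using en cross self
  proof eventually_elim
    case (elim t)
    have A: "xint ?\<epsilon> t = xint (\<lambda>z. energy m \<tau> (\<lambda>j. q j z)) t - (\<Sum>j<m. xint (\<lambda>z. tw \<tau> j * q j z * W j z) t)
        + (\<Sum>j<m. tw \<tau> j / 2 * xint (\<lambda>z. W j z * W j z) t)"
    proof -
      have "xint ?\<epsilon> t = xint (\<lambda>z. energy m \<tau> (\<lambda>j. q j z) - (\<Sum>j<m. tw \<tau> j * q j z * W j z)
          + (\<Sum>j<m. tw \<tau> j / 2 * (W j z * W j z))) t"
        by (simp only: expand)
      also have "\<dots> = xint (\<lambda>z. energy m \<tau> (\<lambda>j. q j z)) t - xint (\<lambda>z. \<Sum>j<m. tw \<tau> j * q j z * W j z) t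
          + xint (\<lambda>z. \<Sum>j<m. tw \<tau> j / 2 * (W j z * W j z)) t"
        by (subst xint_add, (intro bb_diff bb_sum bbEq bbq bbW; simp)+, subst xint_diff) (auto intro!: bb_sum bbEq bbq)
      also have "xint (\<lambda>z. \<Sum>j<m. tw \<tau> j * q j z * W j z) t = (\<Sum>j<m. xint (\<lambda>z. tw \<tau> j * q j z * W j z) t)"
        by (rule xint_sum) (simp add: bbq)
      also have "xint (\<lambda>z. \<Sum>j<m. tw \<tau> j / 2 * (W j z * W j z)) t = (\<Sum>j<m. tw \<tau> j / 2 * xint (\<lambda>z. W j z * W j z) t)"
        by (subst xint_sum) (simp_all only: bbW lessThan_iff xint_cmult)
      finally show ?thesis .
    qed
    have B: "(LINT x|J a b. ?\<epsilon>in x) = (LINT x|J a b. energy m \<tau> (\<lambda>j. qin j x))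
        - (\<Sum>j<m. LINT x|J a b. tw \<tau> j * qin j x * Win j x) + (\<Sum>j<m. tw \<tau> j / 2 * (LINT x|J a b. Win j x * Win j x))"
    proof -
      have b1: "bb (\<lambda>x. energy m \<tau> (\<lambda>j. qin j x))" by (rule bb_energy[OF _ m(2)]) (intro bb)
      have b2: "bb (\<lambda>x. tw \<tau> j * qin j x * Win j x)" if "j < m" for j using that by (intro bb_mult bb_const bb)
      have b3: "bb (\<lambda>x. tw \<tau> j / 2 * (Win j x * Win j x))" if "j < m" for j using that by (intro bb_mult bb_const bb)
      have "(LINT x|J a b. ?\<epsilon>in x) = (LINT x|J a b. energy m \<tau> (\<lambda>j. qin j x) - (\<Sum>j<m. tw \<tau> j * qin j x * Win j x)
          + (\<Sum>j<m. tw \<tau> j / 2 * (Win j x * Win j x)))"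
        by (simp only: expand)
      also have "\<dots> = (LINT x|J a b. energy m \<tau> (\<lambda>j. qin j x) - (\<Sum>j<m. tw \<tau> j * qin j x * Win j x))
          + (LINT x|J a b. (\<Sum>j<m. tw \<tau> j / 2 * (Win j x * Win j x)))"
        by (intro Bochner_Integration.integral_add bb_integrable bb_diff bb_sum b1 b2 b3) auto
      also have "(LINT x|J a b. energy m \<tau> (\<lambda>j. qin j x) - (\<Sum>j<m. tw \<tau> j * qin j x * Win j x))
          = (LINT x|J a b. energy m \<tau> (\<lambda>j. qin j x)) - (LINT x|J a b. (\<Sum>j<m. tw \<tau> j * qin j x * Win j x))"
        by (intro Bochner_Integration.integral_diff bb_integrable bb_sum b1 b2) auto
      also have "(LINT x|J a b. (\<Sum>j<m. tw \<tau> j * qin j x * Win j x)) = (\<Sum>j<m. LINT x|J a b. tw \<tau> j * qin j x * Win j x)"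
        by (intro Bochner_Integration.integral_sum bb_integrable b2) auto
      also have "(LINT x|J a b. (\<Sum>j<m. tw \<tau> j / 2 * (Win j x * Win j x))) = (\<Sum>j<m. LINT x|J a b. tw \<tau> j / 2 * (Win j x * Win j x))"
        by (intro Bochner_Integration.integral_sum bb_integrable b3) auto
      also have "\<dots> = (\<Sum>j<m. tw \<tau> j / 2 * (LINT x|J a b. Win j x * Win j x))"
        by (simp only: integral_mult_right_zero)
      finally show ?thesis .
    qed
    have Cr: "pint ?rate t = pint (\<lambda>z. energy_source m (\<lambda>j. q j z)) t - (\<Sum>j<m. pint (?c j) t)
        + (\<Sum>j<m. tw \<tau> j / 2 * pint (\<lambda>z. 2 * (W j z * Wt j z)) t)"
    proof -
      have "?rate = (\<lambda>z. energy_source m (\<lambda>j. q j z) - (\<Sum>j<m. ?c j z) + (\<Sum>j<m. tw \<tau> j / 2 * (2 * (W j z * Wt j z))))"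
        by (rule ext) (simp add: rate_def mult.assoc)
      then have "pint ?rate t = pint (\<lambda>z. energy_source m (\<lambda>j. q j z) - (\<Sum>j<m. ?c j z)
          + (\<Sum>j<m. tw \<tau> j / 2 * (2 * (W j z * Wt j z)))) t" by (simp only:)
      also have "\<dots> = pint (\<lambda>z. energy_source m (\<lambda>j. q j z) - (\<Sum>j<m. ?c j z)) t
          + pint (\<lambda>z. \<Sum>j<m. tw \<tau> j / 2 * (2 * (W j z * Wt j z))) t"
        by (rule pint_add; intro bb_diff bb_sum bbsrc) (simp_all only: lessThan_iff bbc bbWt)
      also have "pint (\<lambda>z. energy_source m (\<lambda>j. q j z) - (\<Sum>j<m. ?c j z)) t
          = pint (\<lambda>z. energy_source m (\<lambda>j. q j z)) t - pint (\<lambda>z. \<Sum>j<m. ?c j z) t"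
        by (rule pint_diff; intro bb_sum bbsrc) (simp_all only: lessThan_iff bbc)
      also have "pint (\<lambda>z. \<Sum>j<m. ?c j z) t = (\<Sum>j<m. pint (?c j) t)"
        by (rule pint_sum) (simp_all only: lessThan_iff bbc)
      also have "pint (\<lambda>z. \<Sum>j<m. tw \<tau> j / 2 * (2 * (W j z * Wt j z))) t
          = (\<Sum>j<m. pint (\<lambda>z. tw \<tau> j / 2 * (2 * (W j z * Wt j z))) t)"
        by (rule pint_sum) (simp_all only: lessThan_iff bbWt)
      also have "\<dots> = (\<Sum>j<m. tw \<tau> j / 2 * pint (\<lambda>z. 2 * (W j z * Wt j z)) t)"
        by (simp only: pint_cmult)
      finally show ?thesis .
    qed
    have X: "(\<Sum>j<m. xint (\<lambda>z. tw \<tau> j * q j z * W j z) t)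
        = (\<Sum>j<m. LINT x|J a b. tw \<tau> j * qin j x * Win j x) + (\<Sum>j<m. pint (?c j) t)"
      unfolding sum.distrib[symmetric] by (rule sum.cong[OF refl]) (use elim(2) in blast)
    have Y: "(\<Sum>j<m. tw \<tau> j / 2 * xint (\<lambda>z. W j z * W j z) t)
        = (\<Sum>j<m. tw \<tau> j / 2 * (LINT x|J a b. Win j x * Win j x)) + (\<Sum>j<m. tw \<tau> j / 2 * pint (\<lambda>z. 2 * (W j z * Wt j z)) t)"
      unfolding sum.distrib[symmetric] distrib_left[symmetric]
    proof (rule sum.cong[OF refl])
      fix j assume "j \<in> {..<m}"
      with elim(3) have "xint (\<lambda>z. W j z * W j z) t
          = (LINT x|J a b. Win j x * Win j x) + pint (\<lambda>z. 2 * (W j z * Wt j z)) t" by blast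
      then show "tw \<tau> j / 2 * xint (\<lambda>z. W j z * W j z) t
          = tw \<tau> j / 2 * ((LINT x|J a b. Win j x * Win j x) + pint (\<lambda>z. 2 * (W j z * Wt j z)) t)" by (simp only:)
    qed
    show ?case using elim(1) A B Cr X Y by linarith
  qed
  have \<kappa>0: "0 \<le> \<kappa>"
  proof -
    have "0 \<le> \<kappa> * \<tau>" using init[OF m0, of 0] by linarith
    then show ?thesis using \<tau>(1) by (simp add: zero_le_mult_iff)
  qed
  have K0: "0 \<le> K" using C \<kappa>0 by (simp add: K_def)
  have k0: "0 \<le> ?k" by simp
  \<comment> \<open>The factor 1 + T collects the initial energy and the residuals accumulated over
    the time interval.\<close>
  have "AE t in J 0 T. xint ?\<epsilon> t \<le> ?k * (b - a) * (1 + T) + K * prim 0 T (xint ?\<epsilon>) t"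
    using main
  proof eventually_elim
    case (elim t)
    have "xint ?\<epsilon> t \<le> ?k * (b - a) + (K * pint ?\<epsilon> t + ?k * (b - a) * T)"
      using elim init' key[of t] by linarith
    moreover have "?k * (b - a) * (1 + T) = ?k * (b - a) + ?k * (b - a) * T"
      by (simp only: distrib_left mult_1_right)
    ultimately show ?case unfolding pint_def by linarith
  qed
  then have "AE t in J 0 T. xint ?\<epsilon> t \<le> ?k * (b - a) * (1 + T) * (1 + K * (T - 0) * exp (K * (T - 0)))"
    using T_pos a_less_b k0 K0 by (intro gronwall_AE bb_xint bb\<epsilon>) auto
  then show ?thesis by (rule eventually_mono) (simp add: mult_ac)
qed

end

section \<open>The corrector\<close>

text \<open>The equations passed when the recursion for the k-th correction is unrolled towards the
  middle. The set is empty for k = m/2 - 1 and for k = m/2, where the recursion starts with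
  zero.\<close>

definition corr_set :: "nat \<Rightarrow> nat \<Rightarrow> nat set" where
  "corr_set m k = (if k < m div 2 then {k<..<m div 2} else {m div 2<..k})"

text \<open>
  Applied to \<open>X i = \<partial>\<^sub>t \<partial>\<^sub>x\<^sup>i u\<close>, \<open>corr m X k\<close> is the first-order correction of the \<open>k\<close>-th component. It
  solves the recursion that makes the residuals of all undamped equations \<open>O(\<tau>\<^sup>2)\<close>; starting it
  with zero at \<open>k = m/2\<close>, and terminating it there from below, keeps all indices at most \<open>m - 2\<close>.
\<close>
definition corr :: "nat \<Rightarrow> (nat \<Rightarrow> real) \<Rightarrow> nat \<Rightarrow> real" where
  "corr m X k = (\<Sum>l\<in>corr_set m k. (if k < m div 2 then - sgn_eq m (m - l) else sgn_eq m (m - l)) * X (m + k - 2 * l))"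

lemma finite_corr_set: "finite (corr_set m k)"
  by (simp add: corr_set_def)

text \<open>Below the middle l > k, from the middle on l >= m/2 + 1; in both cases the index is at
  most m - 2. This leaves room for one further derivative, in x or in t, within the regularity of
  u.\<close>

lemma corr_index: "even m \<Longrightarrow> k < m \<Longrightarrow> l \<in> corr_set m k \<Longrightarrow> m + k - 2 * l + 2 \<le> m"
  by (auto simp: corr_set_def split: if_splits elim!: evenE)

lemma corr_bound:
  assumes m: "even m" "k < m" and X: "\<And>i. i + 2 \<le> m \<Longrightarrow> \<bar>X i\<bar> \<le> B" and B: "0 \<le> B"
  shows "\<bar>corr m X k\<bar> \<le> real m * B"
proof -
  have "\<bar>corr m X k\<bar> \<le> (\<Sum>l\<in>corr_set m k. B)"
    unfolding corr_def
  proof (rule order_trans[OF sum_abs sum_mono])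
    fix l assume l: "l \<in> corr_set m k"
    have "\<bar>if k < m div 2 then - sgn_eq m (m - l) else sgn_eq m (m - l)\<bar> = 1"
      by (auto simp: sgn_eq_def sigma0_def abs_mult power_abs)
    then show "\<bar>(if k < m div 2 then - sgn_eq m (m - l) else sgn_eq m (m - l)) * X (m + k - 2 * l)\<bar> \<le> B"
      using X[OF corr_index[OF m l]] by (simp add: abs_mult del: abs_if)
  qed
  also have "\<dots> = real (card (corr_set m k)) * B" by simp
  also have "\<dots> \<le> real m * B"
  proof -
    have "corr_set m k \<subseteq> {1..m}" using m(2) by (auto simp: corr_set_def split: if_splits)
    then have "card (corr_set m k) \<le> card {1..m}" by (intro card_mono) auto
    then show ?thesis using B by (intro mult_right_mono) auto
  qed
  finally show ?thesis .
qed

text \<open>An x-derivative is an index shift of X. It compensates the step from k to k - 1 in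
  \<open>m + k - 2 * l\<close>, so the two sums have equal terms over index sets that differ only in
  l = k.\<close>

lemma corr_step:
  assumes m: "even m" "m \<ge> 2" and k: "1 \<le> k" "k < m" "k \<noteq> m div 2"
  shows "corr m (\<lambda>i. X (Suc i)) (k - 1) - corr m X k = - sgn_eq m (m - k) * X (m - k)"
proof -
  obtain n where n: "m = 2 * n" using m(1) by (auto elim: evenE)
  then have h: "m div 2 = n" by simp
  have mk: "m + k - 2 * k = m - k" by simp
  show ?thesis
  proof (cases "k < n")
    case True
    have S: "corr_set m (k - 1) = insert k (corr_set m k)" "k \<notin> corr_set m k"
      using True k by (auto simp: corr_set_def h)
    have "corr m (\<lambda>i. X (Suc i)) (k - 1) = (\<Sum>l\<in>corr_set m (k - 1). - sgn_eq m (m - l) * X (m + k - 2 * l))"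
      unfolding corr_def
    proof (rule sum.cong[OF refl])
      fix l assume "l \<in> corr_set m (k - 1)"
      then have "l < n" using True by (auto simp: corr_set_def h split: if_splits)
      then have idx: "Suc (m + (k - 1) - 2 * l) = m + k - 2 * l" using n k by simp
      have "k - 1 < m div 2" using True h by simp
      then show "(if k - 1 < m div 2 then - sgn_eq m (m - l) else sgn_eq m (m - l)) * X (Suc (m + (k - 1) - 2 * l))
          = - sgn_eq m (m - l) * X (m + k - 2 * l)" by (simp only: idx if_True)
    qed
    also have "\<dots> = - sgn_eq m (m - k) * X (m - k) + corr m X k"
      unfolding S(1) using S(2) finite_corr_set True by (simp add: corr_def h mk)
    finally show ?thesis by simp
  next
    case False
    then have kn: "k > n" using k h by simp
    have S: "corr_set m k = insert k (corr_set m (k - 1))" "k \<notin> corr_set m (k - 1)"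
      using kn by (auto simp: corr_set_def h)
    have "corr m (\<lambda>i. X (Suc i)) (k - 1) = (\<Sum>l\<in>corr_set m (k - 1). sgn_eq m (m - l) * X (m + k - 2 * l))"
      unfolding corr_def
    proof (rule sum.cong[OF refl])
      fix l assume "l \<in> corr_set m (k - 1)"
      then have "l \<le> k - 1" using kn by (auto simp: corr_set_def h split: if_splits)
      then have idx: "Suc (m + (k - 1) - 2 * l) = m + k - 2 * l" using n k by simp
      have "\<not> k - 1 < m div 2" using kn h by simp
      then show "(if k - 1 < m div 2 then - sgn_eq m (m - l) else sgn_eq m (m - l)) * X (Suc (m + (k - 1) - 2 * l))
          = sgn_eq m (m - l) * X (m + k - 2 * l)" by (simp only: idx if_False)
    qed
    moreover have "corr m X k = sgn_eq m (m - k) * X (m - k)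
        + (\<Sum>l\<in>corr_set m (k - 1). sgn_eq m (m - l) * X (m + k - 2 * l))"
      using kn S(2) finite_corr_set by (simp add: corr_def S(1) h mk)
    ultimately show ?thesis by simp
  qed
qed

text \<open>These are the two corrections that enter flux and source of equation m/2, which is thus
  left uncorrected, with a residual of order \<tau>.\<close>

lemma corr_middle:
  assumes "m \<ge> 2"
  shows "corr m X (m div 2 - 1) = 0" "corr m X (m div 2) = 0"
proof -
  have "corr_set m (m div 2 - 1) = {}" "corr_set m (m div 2) = {}"
    using assms by (auto simp: corr_set_def)
  then show "corr m X (m div 2 - 1) = 0" "corr m X (m div 2) = 0" by (simp_all add: corr_def)
qed

text \<open>The residuals of the corrected profile at one point, where \<open>d0 i\<close>, \<open>d1 i\<close>, \<open>d2 i\<close> are the values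
  of \<open>\<partial>\<^sub>x\<^sup>i u\<close>, \<open>\<partial>\<^sub>t \<partial>\<^sub>x\<^sup>i u\<close>, \<open>\<partial>\<^sub>t\<^sup>2 \<partial>\<^sub>x\<^sup>i u\<close>.\<close>
lemma corrected_resid_bound:
  fixes d0 d1 d2 :: "nat \<Rightarrow> real" and f' :: "real \<Rightarrow> real"
  assumes m: "even m" "m \<ge> 2" and \<tau>: "0 < \<tau>" "\<tau> \<le> 1"
    and eq: "d1 0 + f' (d0 0) * d0 1 + sigma0 m * d0 m = 0"
    and L: "\<And>s t. \<bar>f' s - f' t\<bar> \<le> C * \<bar>s - t\<bar>" and C: "0 \<le> C"
    and bd: "\<And>i. i \<le> m \<Longrightarrow> \<bar>d0 i\<bar> \<le> B" "\<And>i. i < m \<Longrightarrow> \<bar>d1 i\<bar> \<le> B" "\<And>i. i + 2 \<le> m \<Longrightarrow> \<bar>d2 i\<bar> \<le> B" and B: "0 \<le> B"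
  defines "M \<equiv> real m * B"
  defines "\<kappa> \<equiv> B + 2 * M + (\<bar>f' 0\<bar> + C * (B + M)) * M + C * M * B"
  defines "W \<equiv> \<lambda>j. d0 j + \<tau> * corr m d1 j"
    and "Wt \<equiv> \<lambda>j. d1 j + \<tau> * corr m d2 j"
    and "Wx \<equiv> \<lambda>j. d0 (Suc j) + \<tau> * corr m (\<lambda>i. d1 (Suc i)) j"
  shows "\<bar>Wx 0\<bar> \<le> \<kappa>"
    and "j < m \<Longrightarrow> \<bar>resid m \<tau> (f' (W 0)) W Wt Wx j\<bar> \<le> (if j = 0 \<or> j = m div 2 then \<kappa> * \<tau> else \<kappa> * \<tau>\<^sup>2)"
proof -
  have M: "0 \<le> M" using B by (simp add: M_def)
  have z: "\<bar>corr m d1 k\<bar> \<le> M" "\<bar>corr m d2 k\<bar> \<le> M" "\<bar>corr m (\<lambda>i. d1 (Suc i)) k\<bar> \<le> M" if "k < m" for k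
    unfolding M_def by (rule corr_bound[OF m(1) that _ B], use bd in simp)+
  have pos: "0 \<le> (\<bar>f' 0\<bar> + C * (B + M)) * M" "0 \<le> C * M * B" using C M B by simp_all
  have m0: "0 < m" using m by simp
  have "\<bar>\<tau> * corr m (\<lambda>i. d1 (Suc i)) 0\<bar> \<le> 1 * M"
    unfolding abs_mult using z(3)[OF m0] \<tau> M by (intro mult_mono) auto
  then show "\<bar>Wx 0\<bar> \<le> \<kappa>"
    using bd(1)[of "Suc 0"] m pos M unfolding Wx_def \<kappa>_def by linarith
  assume j: "j < m"
  consider "j = 0" | "j = m div 2" "j \<noteq> 0" | "j \<noteq> 0" "j \<noteq> m div 2" by blast
  then show "\<bar>resid m \<tau> (f' (W 0)) W Wt Wx j\<bar> \<le> (if j = 0 \<or> j = m div 2 then \<kappa> * \<tau> else \<kappa> * \<tau>\<^sup>2)"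
  proof cases
    case 1
    have sig: "\<bar>sigma0 m\<bar> = 1" by (simp add: sigma0_def power_abs)
    have W0: "\<bar>W 0\<bar> \<le> B + M"
    proof -
      have "\<bar>\<tau> * corr m d1 0\<bar> \<le> 1 * M"
        unfolding abs_mult using z(1)[OF m0] \<tau> M by (intro mult_mono) auto
      then show ?thesis using bd(1)[of 0] by (simp add: W_def)
    qed
    have f1: "\<bar>f' (W 0)\<bar> \<le> \<bar>f' 0\<bar> + C * (B + M)"
    proof -
      have "\<bar>f' (W 0) - f' 0\<bar> \<le> C * (B + M)"
        using L[of "W 0" 0] mult_left_mono[OF W0 C] by simp
      then show ?thesis by linarith
    qed
    have f2: "\<bar>f' (W 0) - f' (d0 0)\<bar> \<le> \<tau> * (C * M)"
    proof -
      have "\<bar>f' (W 0) - f' (d0 0)\<bar> \<le> C * (\<tau> * \<bar>corr m d1 0\<bar>)"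
        using L[of "W 0" "d0 0"] \<tau> by (simp add: W_def abs_mult)
      also have "\<dots> \<le> C * (\<tau> * M)" using C \<tau> z(1)[OF m0] by (intro mult_left_mono) auto
      finally show ?thesis by (simp add: mult_ac)
    qed
    \<comment> \<open>The terms of order one form the equation for u. What remains is the change of
      f' caused by the corrector and the corrector's own derivatives, all with a factor
      \<tau>.\<close>
    have "resid m \<tau> (f' (W 0)) W Wt Wx j
        = (d1 0 + f' (d0 0) * d0 1 + sigma0 m * d0 m) + (f' (W 0) - f' (d0 0)) * d0 1
          + \<tau> * (corr m d2 0 + sigma0 m * corr m (\<lambda>i. d1 (Suc i)) (m - 1) + f' (W 0) * corr m (\<lambda>i. d1 (Suc i)) 0)"
      using 1 m by (simp add: resid_def tw_def Wt_def Wx_def sgn_eq_0 algebra_simps)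
    then have "\<bar>resid m \<tau> (f' (W 0)) W Wt Wx j\<bar> \<le> \<bar>(f' (W 0) - f' (d0 0)) * d0 1\<bar>
          + \<bar>\<tau> * (corr m d2 0 + sigma0 m * corr m (\<lambda>i. d1 (Suc i)) (m - 1) + f' (W 0) * corr m (\<lambda>i. d1 (Suc i)) 0)\<bar>"
      unfolding eq by (simp add: abs_triangle_ineq)
    also have "\<bar>(f' (W 0) - f' (d0 0)) * d0 1\<bar> \<le> \<tau> * (C * M) * B"
      unfolding abs_mult using f2 bd(1)[of 1] m C M \<tau> by (intro mult_mono) auto
    also have "\<bar>\<tau> * (corr m d2 0 + sigma0 m * corr m (\<lambda>i. d1 (Suc i)) (m - 1) + f' (W 0) * corr m (\<lambda>i. d1 (Suc i)) 0)\<bar>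
        \<le> \<tau> * (M + M + (\<bar>f' 0\<bar> + C * (B + M)) * M)"
    proof -
      have "\<bar>sigma0 m * corr m (\<lambda>i. d1 (Suc i)) (m - 1)\<bar> \<le> M"
        using z(3)[of "m - 1"] m0 by (simp add: abs_mult sig)
      moreover have "\<bar>f' (W 0) * corr m (\<lambda>i. d1 (Suc i)) 0\<bar> \<le> (\<bar>f' 0\<bar> + C * (B + M)) * M"
        unfolding abs_mult using f1 z(3)[OF m0] by (intro mult_mono) auto
      ultimately have "\<bar>corr m d2 0 + sigma0 m * corr m (\<lambda>i. d1 (Suc i)) (m - 1) + f' (W 0) * corr m (\<lambda>i. d1 (Suc i)) 0\<bar>
          \<le> M + M + (\<bar>f' 0\<bar> + C * (B + M)) * M"
        using z(2)[OF m0] by linarith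
      then show ?thesis unfolding abs_mult[of \<tau>] using \<tau> by simp
    qed
    finally have "\<bar>resid m \<tau> (f' (W 0)) W Wt Wx j\<bar> \<le> \<tau> * (C * M) * B + \<tau> * (M + M + (\<bar>f' 0\<bar> + C * (B + M)) * M)"
      by simp
    also have "\<dots> = (\<kappa> - B) * \<tau>" by (simp add: \<kappa>_def algebra_simps)
    also have "\<dots> \<le> \<kappa> * \<tau>" using B \<tau> by (intro mult_right_mono) auto
    finally show ?thesis using 1 by simp
  next
    case 2
    \<comment> \<open>Flux and source refer to components m/2 - 1 and m/2, whose corrections vanish;
      their uncorrected parts cancel, and only the time derivative is left.\<close>
    have "m - 1 - j = m div 2 - 1" "m - j = m div 2" "Suc (m - 1 - j) = m - j" using 2 m by (auto elim!: evenE)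
    then have "resid m \<tau> (f' (W 0)) W Wt Wx j = \<tau> * (d1 j + \<tau> * corr m d2 j)"
      using 2 by (simp add: resid_def tw_def Wt_def Wx_def W_def corr_middle[OF m(2)] corr_middle[OF m(2), unfolded One_nat_def])
    also have "\<bar>\<dots>\<bar> \<le> \<tau> * (B + M)"
    proof -
      have "\<bar>\<tau> * corr m d2 j\<bar> \<le> 1 * M"
        unfolding abs_mult using z(2)[OF j] \<tau> M by (intro mult_mono) auto
      then have "\<bar>d1 j + \<tau> * corr m d2 j\<bar> \<le> B + M" using bd(2)[OF j] by linarith
      then show ?thesis unfolding abs_mult[of \<tau>] using \<tau> by simp
    qed
    also have "\<dots> \<le> \<kappa> * \<tau>" using pos M \<tau> by (simp add: \<kappa>_def mult.commute mult_right_mono)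
    finally show ?thesis using 2 by simp
  next
    case 3
    let ?k = "m - j"
    have k: "1 \<le> ?k" "?k < m" "?k \<noteq> m div 2" "m - ?k = j" "?k - 1 = m - 1 - j" "Suc (m - 1 - j) = ?k"
      using 3 j m(1) by (auto elim!: evenE)
    \<comment> \<open>\<open>corr_step\<close> at k = m - j: after multiplication by the sign of
      equation j, whose square is 1, the corrector cancels the term \<tau>
      \<open>d1 j\<close>.\<close>
    have st: "corr m (\<lambda>i. d1 (Suc i)) (m - 1 - j) - corr m d1 (m - j) = - sgn_eq m j * d1 j"
      using corr_step[OF m k(1-3), of d1] unfolding k(4,5) .
    have "resid m \<tau> (f' (W 0)) W Wt Wx j = \<tau> * (d1 j + \<tau> * corr m d2 j)
        + \<tau> * (sgn_eq m j * (corr m (\<lambda>i. d1 (Suc i)) (m - 1 - j) - corr m d1 (m - j)))"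
      using 3 k(6) by (simp add: resid_def tw_def Wt_def Wx_def W_def algebra_simps)
    also have "\<dots> = \<tau> * (d1 j + \<tau> * corr m d2 j) - \<tau> * ((sgn_eq m j * sgn_eq m j) * d1 j)"
      unfolding st by (simp add: algebra_simps)
    also have "\<dots> = \<tau>\<^sup>2 * corr m d2 j"
      unfolding sgn_eq_square by (simp add: power2_eq_square algebra_simps)
    also have "\<bar>\<dots>\<bar> \<le> \<tau>\<^sup>2 * M" unfolding abs_mult using z(2)[OF j] by (intro mult_mono) auto
    also have "\<tau>\<^sup>2 * M \<le> \<kappa> * \<tau>\<^sup>2"
    proof -
      have "M \<le> \<kappa>" using pos M B unfolding \<kappa>_def by linarith
      from mult_right_mono[OF this, of "\<tau>\<^sup>2"] show ?thesis by (simp add: mult.commute)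
    qed
    finally show ?thesis using 3 by simp
  qed
qed

section \<open>Slice norms, the chain rule for the flux, and derivatives of the corrector\<close>

context cylinder
begin

text \<open>Completeness of Lebesgue measure. The slice norms agree with a Borel function only at
  almost every time, and their measurability enters the bound on the essential supremum.\<close>

lemma measurable_AE_eq:
  fixes N N' :: "real \<Rightarrow> ennreal"
  assumes N': "N' \<in> borel_measurable borel" and eq: "AE t in J 0 T. N t = N' t"
  shows "N \<in> borel_measurable (lebesgue_on {0<..<T})"
proof (rule measurableI)
  fix A :: "ennreal set" assume A: "A \<in> sets borel"
  have 1: "{0<..<T} \<inter> N' -` A \<in> sets lebesgue"
  proof -
    have "N' -` A \<inter> space borel \<in> sets borel" by (rule measurable_sets[OF N' A])
    then show ?thesis by (intro sets.Int) auto
  qed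
  have "AE t in lebesgue. t \<in> {0<..<T} \<inter> N' -` A \<longleftrightarrow> t \<in> {0<..<T} \<inter> N -` A"
    using eq unfolding AE_J_iff AE_completion_iff by eventually_elim auto
  from completion.in_sets_AE[OF this 1]
  have "{0<..<T} \<inter> N -` A \<in> sets lebesgue" by simp
  then show "N -` A \<inter> space (lebesgue_on {0<..<T}) \<in> sets (lebesgue_on {0<..<T})"
    by (auto simp: sets_restrict_space space_restrict_space image_iff intro!: bexI[of _ "{0<..<T} \<inter> N -` A"])
qed simp

lemma LinfL2norm_bound:
  assumes rep: "rep g g'" and c: "0 \<le> c" and le: "AE t in J 0 T. xint (\<lambda>z. (g' z)\<^sup>2) t \<le> c\<^sup>2"
  shows "LinfL2norm T a b g \<le> ennreal c"
proof -
  let ?N = "\<lambda>t. L2norm a b (\<lambda>x. g (t, x))" and ?N' = "\<lambda>t. ennreal (sqrt (xint (\<lambda>z. (g' z)\<^sup>2) t))"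
  have bb: "bb g'" "bb (\<lambda>z. (g' z)\<^sup>2)" using rep by (auto simp: rep_def intro: bb_power2)
  have eq: "AE t in J 0 T. ?N t = ?N' t"
    using rep_slice[OF rep]
  proof eventually_elim
    case (elim t)
    have b: "bb (\<lambda>x. (g' (t, x))\<^sup>2)" by (rule bb_slice[OF bb(2)])
    have ae: "AE x in circ a b. g (t, x) = g' (t, x)"
      using elim by (simp add: AE_lebesgue_on_J sl_def)
    have "(\<integral>\<^sup>+ x. ennreal ((g (t, x))\<^sup>2) \<partial>circ a b) = (\<integral>\<^sup>+ x. ennreal ((g' (t, x))\<^sup>2) \<partial>circ a b)"
      by (rule nn_integral_cong_AE) (use ae in eventually_elim, simp)
    also have "\<dots> = (\<integral>\<^sup>+ x. ennreal ((g' (t, x))\<^sup>2) * indicator {a<..<b} x \<partial>lebesgue)"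
      by (rule nn_integral_restrict_space) simp
    also have "\<dots> = (\<integral>\<^sup>+ x. ennreal ((g' (t, x))\<^sup>2) * indicator {a<..<b} x \<partial>lborel)"
      by (rule nn_integral_completion)
    also have "\<dots> = (\<integral>\<^sup>+ x. ennreal ((g' (t, x))\<^sup>2) \<partial>J a b)"
      by (rule nn_integral_restrict_space[symmetric]) simp
    also have "\<dots> = ennreal (xint (\<lambda>z. (g' z)\<^sup>2) t)"
      unfolding xint_def by (rule nn_integral_eq_integral[OF bb_integrable[OF b]]) simp
    finally have I: "(\<integral>\<^sup>+ x. ennreal ((g (t, x))\<^sup>2) \<partial>circ a b) = ennreal (xint (\<lambda>z. (g' z)\<^sup>2) t)" .
    have "0 \<le> xint (\<lambda>z. (g' z)\<^sup>2) t" unfolding xint_def by (rule integral_nonneg_AE) simp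
    then show ?case unfolding L2norm_def I by (simp add: Let_def)
  qed
  have [measurable]: "xint (\<lambda>z. (g' z)\<^sup>2) \<in> borel_measurable borel" by (rule bb_measurable[OF bb_xint[OF bb(2)]])
  have "?N \<in> borel_measurable (lebesgue_on {0<..<T})"
    by (rule measurable_AE_eq[OF _ eq]) measurable
  moreover have "AE t in lebesgue_on {0<..<T}. ?N t \<le> ennreal c"
    unfolding AE_lebesgue_on_J using eq le
  proof eventually_elim
    case (elim t)
    have "sqrt (xint (\<lambda>z. (g' z)\<^sup>2) t) \<le> c" using elim(2) c by (intro real_le_lsqrt) auto
    then show ?case unfolding elim(1) by (rule ennreal_leI)
  qed
  ultimately show ?thesis unfolding LinfL2norm_def by (rule esssup_I)
qed

lemma rep_diff: "rep f f' \<Longrightarrow> rep g g' \<Longrightarrow> rep (\<lambda>z. f z - g z) (\<lambda>z. f' z - g' z)"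
  using rep_add[of f f' "\<lambda>z. (-1) * g z" "\<lambda>z. (-1) * g' z"] rep_cmult[of g g' "-1"] by simp

text \<open>The weak derivative of f(u) that comes with the solution is some bounded function. At
  almost every time it has the same Fourier coefficients as the product provided by
  \<open>sd_chain\<close>, hence equals it almost everywhere.\<close>

lemma weak_chain_rule:
  assumes D: "\<And>s. (f has_real_derivative f' s) (at s)" and f': "continuous_on UNIV f'"
    and fu: "wderiv_cyl T a b 0 1 (\<lambda>z. f (u z)) fux" and rep: "rep u u'" "rep fux v'"
    and ux: "AE t in J 0 T. sd (sl u' t) (sl ux' t)" "bb ux'"
  shows "AE t in J 0 T. AE x in J a b. v' (t, x) = f' (u' (t, x)) * ux' (t, x)"
proof -
  have fc: "continuous_on UNIV f" using D by (meson DERIV_isCont continuous_at_imp_continuous_on)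
  have rf: "rep (\<lambda>z. f (u z)) (\<lambda>z. f (u' z))" by (rule rep_compose[OF rep(1) fc])
  have L: "Linf (cyl T a b) (\<lambda>z. f (u z))" using fu by (simp add: wderiv_cyl_def)
  have "wderiv_cyl T a b 0 0 (\<lambda>z. f (u z)) (\<lambda>z. f (u z))" using L by (simp add: wderiv_cyl_def)
  from wderiv_space[OF this _ rf rf rep(2)] fu
  have s1: "AE t in J 0 T. sd (sl (\<lambda>z. f (u' z)) t) (sl v' t)" by simp
  have bb: "bb u'" "bb v'" using rep by (auto simp: rep_def)
  have bf: "bb (\<lambda>z. f' (u' z))" by (rule bb_continuous_compose[OF f' bb(1)])
  show ?thesis
    using s1 ux(1)
  proof eventually_elim
    case (elim t)
    have s2: "sd (\<lambda>x. f (sl u' t x)) (\<lambda>x. f' (sl u' t x) * sl ux' t x)"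
      by (rule sd_chain[OF elim(2) bb_sl[OF bb(1)] bb_sl[OF ux(2)] D f'])
    have bd: "bb (\<lambda>x. f' (sl u' t x) * sl ux' t x)"
      using bb_slice[OF bb_mult[OF bf ux(2)], of t] by (simp add: sl_def)
    have "ip (\<lambda>x. sl v' t x - f' (sl u' t x) * sl ux' t x) (e k) = 0" for k
    proof -
      have "of_int k * w * ip (sl (\<lambda>z. f (u' z)) t) (e (- k)) = - ip (sl v' t) (e k)"
        using elim(1) by (simp add: sd_def)
      moreover have "of_int k * w * ip (\<lambda>x. f (sl u' t x)) (e (- k)) = - ip (\<lambda>x. f' (sl u' t x) * sl ux' t x) (e k)"
        using s2 by (simp add: sd_def)
      moreover have "sl (\<lambda>z. f (u' z)) t = (\<lambda>x. f (sl u' t x))" by (simp add: sl_def fun_eq_iff)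
      ultimately show ?thesis by (simp add: ip_diff_left bb_sl bb bd bb_e)
    qed
    from ip_zero_AE[OF bb_diff[OF bb_sl[OF bb(2)] bd] this]
    show ?case by eventually_elim (simp add: sl_def)
  qed
qed

lemma bb_corr:
  assumes "even m" "k < m" "\<And>i. i + 2 \<le> m \<Longrightarrow> bb (\<lambda>z. X z i)"
  shows "bb (\<lambda>z. corr m (X z) k)"
  unfolding corr_def using corr_index[OF assms(1,2)] assms(3)
  by (intro bb_sum bb_mult bb_const) auto

lemma sd_corr:
  assumes m: "even m" "k < m" and X: "\<And>i. i + 2 \<le> m \<Longrightarrow> bb (\<lambda>z. X z i)" "\<And>i. i + 2 \<le> m \<Longrightarrow> bb (\<lambda>z. Y z i)"
    and sd: "\<And>i. i + 2 \<le> m \<Longrightarrow> sd (sl (\<lambda>z. X z i) t) (sl (\<lambda>z. Y z i) t)"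
  shows "sd (sl (\<lambda>z. corr m (X z) k) t) (sl (\<lambda>z. corr m (Y z) k) t)"
proof -
  let ?c = "\<lambda>l. if k < m div 2 then - sgn_eq m (m - l) else sgn_eq m (m - l)"
  have "sd (\<lambda>x. \<Sum>l\<in>corr_set m k. ?c l * sl (\<lambda>z. X z (m + k - 2 * l)) t x)
      (\<lambda>x. \<Sum>l\<in>corr_set m k. ?c l * sl (\<lambda>z. Y z (m + k - 2 * l)) t x)"
    by (intro sd_sum sd_cmult sd bb_mult bb_const bb_sl X corr_index[OF m])
  then show ?thesis by (simp add: corr_def sl_def[abs_def])
qed

lemma tderiv_corr:
  assumes m: "even m" "k < m" and X: "\<And>i. i + 2 \<le> m \<Longrightarrow> bb (\<lambda>z. X z i)" "\<And>i. i + 2 \<le> m \<Longrightarrow> bb (\<lambda>z. Y z i)"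
      "\<And>i. i + 2 \<le> m \<Longrightarrow> bb (\<lambda>x. V x i)"
    and td: "\<And>i. i + 2 \<le> m \<Longrightarrow> tderiv (\<lambda>z. X z i) (\<lambda>z. Y z i) (\<lambda>x. V x i)"
  shows "tderiv (\<lambda>z. corr m (X z) k) (\<lambda>z. corr m (Y z) k) (\<lambda>x. corr m (V x) k)"
  unfolding corr_def
  by (intro tderiv_sum tderiv_cmult td bb_mult bb_const X corr_index[OF m])

end

section \<open>The comparison profile and the conclusion\<close>

lemma finite_bb_bound:
  assumes "finite A" "\<And>i. i \<in> A \<Longrightarrow> bb (F i)"
  shows "\<exists>B\<ge>0. \<forall>i\<in>A. \<forall>z. \<bar>F i z\<bar> \<le> B"
  using assms
proof (induction A rule: finite_induct)
  case empty
  show ?case by (intro exI[of _ 0]) simp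
next
  case (insert i A)
  then obtain B where B: "B \<ge> 0" "\<forall>i\<in>A. \<forall>z. \<bar>F i z\<bar> \<le> B" by auto
  obtain C where C: "C \<ge> 0" "\<And>z. \<bar>F i z\<bar> \<le> C" using bb_bound[of "F i"] insert.prems by auto
  have "\<bar>F k z\<bar> \<le> B + C" if "k \<in> insert i A" for k z
    using that B C(1) C(2)[of z] by (cases "k = i") (auto intro: add_increasing add_increasing2)
  then show ?case using B(1) C(1) by (intro exI[of _ "B + C"]) auto
qed

text \<open>Here \<open>d0 i\<close>, \<open>d1 i\<close>, \<open>d2 i\<close> are Borel
  representatives of the i-th x-derivatives of u with zero, one and two time derivatives. The traces
  \<open>g\<close> are the given initial derivatives, whereas \<open>zin\<close> is known only as
  some bounded trace of \<open>d1\<close>; it serves to bound the corrector at time 0.\<close>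

lemma (in cylinder) profile_exists:
  fixes f :: "real \<Rightarrow> real" and u :: "real \<times> real \<Rightarrow> real"
  assumes m: "even m" "m \<ge> 2"
    and D: "\<And>s. (f has_real_derivative f' s) (at s)" and f': "continuous_on UNIV f'"
    and u: "Winf_cyl T a b m u" "solves_eq f m T a b u" and tr: "initial_trace T a b u u0"
    and Du: "\<forall>j<m. wderiv_cyl T a b 0 j u (Du j)"
    and Du0: "\<forall>j<m. wderiv_circ a b j u0 (Du0 j)"
  shows "\<exists>d0 d1 d2 g zin.
      (\<forall>i\<le>m. bb (d0 i)) \<and> (\<forall>i<m. bb (d1 i)) \<and> (\<forall>i. i + 2 \<le> m \<longrightarrow> bb (d2 i) \<and> bb (zin i)) \<and> (\<forall>i<m. bb (g i)) \<and>
      rep u (d0 0) \<and> (\<forall>i. 1 \<le> i \<and> i < m \<longrightarrow> rep (Du i) (d0 i)) \<and> (\<forall>i<m. AE x in J a b. Du0 i x = g i x) \<and>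
      (\<forall>i<m. AE t in J 0 T. sd (sl (d0 i) t) (sl (d0 (Suc i)) t)) \<and>
      (\<forall>i. i + 2 \<le> m \<longrightarrow> (AE t in J 0 T. sd (sl (d1 i) t) (sl (d1 (Suc i)) t))) \<and>
      (\<forall>i<m. tderiv (d0 i) (d1 i) (g i)) \<and> (\<forall>i. i + 2 \<le> m \<longrightarrow> tderiv (d1 i) (d2 i) (zin i)) \<and>
      (AE t in J 0 T. AE x in J a b. d1 0 (t, x) + f' (d0 0 (t, x)) * d0 1 (t, x) + sigma0 m * d0 m (t, x) = 0)"
proof -
  obtain ut fux uxm where sol: "wderiv_cyl T a b 1 0 u ut" "wderiv_cyl T a b 0 1 (\<lambda>z. f (u z)) fux"
    "wderiv_cyl T a b 0 m u uxm" "AE z in cyl T a b. ut z + fux z + sigma0 m * uxm z = 0"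
    using u(2) unfolding solves_eq_def by blast
  have Lu: "Linf (cyl T a b) u" using sol(1) by (simp add: wderiv_cyl_def)
  \<comment> \<open>The representatives are tied to u and \<open>Du i\<close>, which occur in the
    final norms, and to the m-th derivative occurring in the equation.\<close>
  define O0 where "O0 i = (if i = 0 then u else if i = m then uxm else Du i)" for i
  have O0: "wderiv_cyl T a b 0 i u (O0 i)" if "i \<le> m" for i
  proof -
    have "wderiv_cyl T a b 0 0 u u" using Lu by (simp add: wderiv_cyl_def)
    then show ?thesis using that sol(3) Du[rule_format, of i] by (auto simp: O0_def)
  qed
  have W: "\<exists>v. wderiv_cyl T a b p i u v" if "p + i \<le> m" for p i
    using u(1) that by (simp add: Winf_cyl_def)
  \<comment> \<open>For i = 0 the choice is pinned to the \<open>ut\<close> of the equation, so that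
    the pointwise equation holds for \<open>d1 0\<close>.\<close>
  have "\<forall>i. \<exists>v. i < m \<longrightarrow> wderiv_cyl T a b 1 i u v \<and> (i = 0 \<longrightarrow> v = ut)"
    using W[of 1] sol(1) by (metis One_nat_def Suc_leI add_Suc plus_nat.add_0)
  from choice[OF this] obtain O1 where O1': "\<forall>i. i < m \<longrightarrow> wderiv_cyl T a b 1 i u (O1 i) \<and> (i = 0 \<longrightarrow> O1 i = ut)"
    by (rule exE)
  then have O1: "wderiv_cyl T a b 1 i u (O1 i)" if "i < m" for i using that by blast
  have O10: "O1 0 = ut" using O1'[rule_format, of 0] m by simp
  have "\<forall>i. \<exists>v. i + 2 \<le> m \<longrightarrow> wderiv_cyl T a b 2 i u v" using W[of 2] by (metis add.commute)
  from choice[OF this] obtain O2 where O2: "\<forall>i. i + 2 \<le> m \<longrightarrow> wderiv_cyl T a b 2 i u (O2 i)" by (rule exE)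
  have Lw: "Linf (cyl T a b) v" if "wderiv_cyl T a b p i u v" for p i v
    using that by (simp add: wderiv_cyl_def)
  have "\<forall>i. \<exists>v. i \<le> m \<longrightarrow> rep (O0 i) v" using rep_exists[OF Lw[OF O0]] by blast
  from choice[OF this] obtain d0 where d0: "\<forall>i. i \<le> m \<longrightarrow> rep (O0 i) (d0 i)" by (rule exE)
  have "\<forall>i. \<exists>v. i < m \<longrightarrow> rep (O1 i) v" using rep_exists[OF Lw[OF O1]] by blast
  from choice[OF this] obtain d1 where d1: "\<forall>i. i < m \<longrightarrow> rep (O1 i) (d1 i)" by (rule exE)
  have "\<forall>i. \<exists>v. i + 2 \<le> m \<longrightarrow> rep (O2 i) v" using rep_exists[OF Lw] O2 by blast
  from choice[OF this] obtain d2 where d2: "\<forall>i. i + 2 \<le> m \<longrightarrow> rep (O2 i) (d2 i)" by (rule exE)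
  have "\<forall>i. \<exists>v. i < m \<longrightarrow> bb v \<and> (AE x in J a b. Du0 i x = v x)"
  proof
    fix i
    have "\<exists>v. bb v \<and> (AE x in J a b. Du0 i x = v x)" if "i < m"
    proof -
      have "Linf (circ a b) (Du0 i)" using Du0[rule_format, OF that] by (simp add: wderiv_circ_def)
      then obtain v where "bb v" "AE x in circ a b. Du0 i x = v x"
        by (rule Linf_representative[rotated]) auto
      then show ?thesis by (auto simp: AE_lebesgue_on_J)
    qed
    then show "\<exists>v. i < m \<longrightarrow> bb v \<and> (AE x in J a b. Du0 i x = v x)" by blast
  qed
  from choice[OF this] obtain g where g: "\<forall>i. i < m \<longrightarrow> bb (g i) \<and> (AE x in J a b. Du0 i x = g i x)" by (rule exE)
  have ru: "rep u (d0 0)" using d0[rule_format, of 0] by (simp add: O0_def)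
  have sd0: "AE t in J 0 T. sd (sl (d0 i) t) (sl (d0 (Suc i)) t)" if "i < m" for i
    by (rule wderiv_space[OF O0[of i] O0[of "Suc i"] ru]) (use d0 that in auto)
  have sd1: "AE t in J 0 T. sd (sl (d1 i) t) (sl (d1 (Suc i)) t)" if "i + 2 \<le> m" for i
    by (rule wderiv_space[OF O1[of i] O1[of "Suc i"] ru]) (use d1 that in auto)
  have td0: "tderiv (d0 i) (d1 i) (g i)" if "i < m" for i
    by (rule wderiv_initial[OF O0[of i] O1[of i] ru _ _ Du0[rule_format, of i] tr]) (use d0 d1 g that in auto)
  have "\<forall>i. \<exists>v. i + 2 \<le> m \<longrightarrow> bb v \<and> tderiv (d1 i) (d2 i) v"
  proof
    fix i
    have "\<exists>v. bb v \<and> tderiv (d1 i) (d2 i) v" if "i + 2 \<le> m"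
      by (rule wderiv_trace[OF O1[of i] _ ru]) (use that O2 d1 d2 in \<open>auto simp: numeral_2_eq_2\<close>)
    then show "\<exists>v. i + 2 \<le> m \<longrightarrow> bb v \<and> tderiv (d1 i) (d2 i) v" by blast
  qed
  from choice[OF this] obtain zin where zin: "\<forall>i. i + 2 \<le> m \<longrightarrow> bb (zin i) \<and> tderiv (d1 i) (d2 i) (zin i)" by (rule exE)
  have eq: "AE t in J 0 T. AE x in J a b. d1 0 (t, x) + f' (d0 0 (t, x)) * d0 1 (t, x) + sigma0 m * d0 m (t, x) = 0"
  proof -
    have "Linf (cyl T a b) fux" using sol(2) by (simp add: wderiv_cyl_def)
    then obtain v where v: "rep fux v" using rep_exists by blast
    have rut: "rep ut (d1 0)" using d1[rule_format, of 0] O10 m by simp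
    have rum: "rep uxm (d0 m)" using d0[rule_format, of m] m by (simp add: O0_def)
    have "AE z in cyl T a b. fux z = v z" "AE z in cyl T a b. ut z = d1 0 z" "AE z in cyl T a b. uxm z = d0 m z"
      using v rut rum by (auto simp: rep_def)
    then have "AE z in cyl T a b. d1 0 z + v z + sigma0 m * d0 m z = 0"
      using sol(4) by eventually_elim simp
    from AE_cyl_iterated[OF this]
    have 1: "AE t in J 0 T. AE x in J a b. d1 0 (t, x) + v (t, x) + sigma0 m * d0 m (t, x) = 0" .
    have "AE t in J 0 T. AE x in J a b. v (t, x) = f' (d0 0 (t, x)) * d0 1 (t, x)"
      by (rule weak_chain_rule[OF D f' sol(2) ru v])
        (use sd0[of 0] d0[rule_format, of 1, THEN rep_bb] m in auto)
    with 1 show ?thesis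
    proof eventually_elim
      case (elim t)
      then show ?case by eventually_elim simp
    qed
  qed
  have reps: "\<forall>i. 1 \<le> i \<and> i < m \<longrightarrow> rep (Du i) (d0 i)"
  proof (intro allI impI)
    fix i assume i: "1 \<le> i \<and> i < m"
    then have "O0 i = Du i" by (auto simp: O0_def)
    then show "rep (Du i) (d0 i)" using d0[rule_format, of i] i by simp
  qed
  show ?thesis
    using d0[rule_format, THEN rep_bb] d1[rule_format, THEN rep_bb] d2[rule_format, THEN rep_bb] zin g
      ru reps sd0 sd1 td0 eq
    by (intro exI[of _ d0] exI[of _ d1] exI[of _ d2] exI[of _ g] exI[of _ zin]) simp
qed

lemma (in cylinder) entropy_evol_weighted:
  assumes ent: "entropy_solution f \<Phi> m T a b \<tau> qin q" and m: "m \<ge> 2" and f: "continuous_on UNIV f"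
    and rep: "\<And>j. j < m \<Longrightarrow> rep (q j) (q' j)"
    and qin: "\<And>j. j < m \<Longrightarrow> Linf (circ a b) (qin j)" "\<And>j. j < m \<Longrightarrow> bb (qin' j)"
      "\<And>j. j < m \<Longrightarrow> AE x in J a b. qin j x = qin' j x"
    and j: "j < m"
  shows "evol (\<lambda>z. tw \<tau> j * q' j z) (\<lambda>z. flux_j m (f (q' 0 z)) (\<lambda>i. q' i z) j)
      (\<lambda>z. source_j m (\<lambda>i. q' i z) j) (\<lambda>x. tw \<tau> j * qin' j x)"
proof (cases "j = 0")
  case True
  have "evol (q' 0) (\<lambda>z. f (q' 0 z) + sigma0 m * q' (m - 1) z) (\<lambda>z. 0) (qin' 0)"
    by (rule entropy_evol(1)[OF ent m f rep qin]) assumption+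
  then show ?thesis
    using True m by (simp add: tw_def flux_j_def source_j_def sgn_eq_0 add.commute)
next
  case False
  then have jm: "j \<in> {1..m - 1}" using j by auto
  have "evol (\<lambda>z. \<tau> * q' j z) (\<lambda>z. sgn_eq m j * q' (m - j - 1) z)
      (\<lambda>z. sgn_eq m j * q' (m - j) z) (\<lambda>x. \<tau> * qin' j x)"
    by (rule entropy_evol(2)[OF ent m f rep qin jm]) assumption+
  moreover have "m - j - 1 = m - 1 - j" by simp
  ultimately show ?thesis using False by (simp add: tw_def flux_j_def source_j_def)
qed

text \<open>All components are handled at once through \<open>tw\<close>: dividing by its square
  root gives the order \<tau> for component 0 and the order sqrt(\<tau>) for the others. The
  constant is fixed before \<tau> and q.\<close>

lemma (in cylinder) entropy_solution_distance:
  fixes m :: nat and f f' \<Phi> :: "real \<Rightarrow> real" and u :: "real \<times> real \<Rightarrow> real"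
    and Du :: "nat \<Rightarrow> real \<times> real \<Rightarrow> real" and u0 :: "real \<Rightarrow> real" and Du0 :: "nat \<Rightarrow> real \<Rightarrow> real"
  assumes m: "even m" "m \<ge> 2"
    and D: "\<And>s. (f has_real_derivative f' s) (at s)" and L: "\<And>s t. \<bar>f' s - f' t\<bar> \<le> C * \<bar>s - t\<bar>" and C: "0 \<le> C"
    and u: "Winf_cyl T a b m u" "solves_eq f m T a b u" and tr: "initial_trace T a b u u0"
    and Du: "\<forall>j<m. wderiv_cyl T a b 0 j u (Du j)"
    and Du0: "\<forall>j<m. wderiv_circ a b j u0 (Du0 j)"
  shows "\<exists>c\<ge>0. \<forall>\<tau> q. 0 < \<tau> \<longrightarrow> \<tau> \<le> 1 \<longrightarrow> entropy_solution f \<Phi> m T a b \<tau> Du0 q \<longrightarrow>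
      (\<forall>j<m. LinfL2norm T a b (\<lambda>z. (if j = 0 then u z else Du j z) - q j z) \<le> ennreal (c * \<tau> / sqrt (tw \<tau> j)))"
proof -
  have fc: "continuous_on UNIV f" using D by (meson DERIV_isCont continuous_at_imp_continuous_on)
  have "C-lipschitz_on UNIV f'"
    by (rule lipschitz_onI) (use L C in \<open>auto simp: dist_real_def\<close>)
  then have f'c: "continuous_on UNIV f'" by (rule lipschitz_on_continuous_on)
  obtain d0 d1 d2 g zin where P:
    "\<forall>i\<le>m. bb (d0 i)" "\<forall>i<m. bb (d1 i)" "\<forall>i. i + 2 \<le> m \<longrightarrow> bb (d2 i) \<and> bb (zin i)" "\<forall>i<m. bb (g i)"
    "rep u (d0 0)" "\<forall>i. 1 \<le> i \<and> i < m \<longrightarrow> rep (Du i) (d0 i)" "\<forall>i<m. AE x in J a b. Du0 i x = g i x"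
    "\<forall>i<m. AE t in J 0 T. sd (sl (d0 i) t) (sl (d0 (Suc i)) t)"
    "\<forall>i. i + 2 \<le> m \<longrightarrow> (AE t in J 0 T. sd (sl (d1 i) t) (sl (d1 (Suc i)) t))"
    "\<forall>i<m. tderiv (d0 i) (d1 i) (g i)" "\<forall>i. i + 2 \<le> m \<longrightarrow> tderiv (d1 i) (d2 i) (zin i)"
    "AE t in J 0 T. AE x in J a b. d1 0 (t, x) + f' (d0 0 (t, x)) * d0 1 (t, x) + sigma0 m * d0 m (t, x) = 0"
    using profile_exists[OF m D f'c u tr Du Du0] by (elim exE conjE) (rule that)
  obtain B0 B1 B2 B3 where Bs: "B0 \<ge> 0" "\<forall>i\<in>{..m}. \<forall>z. \<bar>d0 i z\<bar> \<le> B0" "B1 \<ge> 0" "\<forall>i\<in>{..<m}. \<forall>z. \<bar>d1 i z\<bar> \<le> B1"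
    "B2 \<ge> 0" "\<forall>i\<in>{..m - 2}. \<forall>z. \<bar>d2 i z\<bar> \<le> B2" "B3 \<ge> 0" "\<forall>i\<in>{..m - 2}. \<forall>z. \<bar>zin i z\<bar> \<le> B3"
  proof -
    have "\<exists>B\<ge>0. \<forall>i\<in>{..m}. \<forall>z. \<bar>d0 i z\<bar> \<le> B" by (rule finite_bb_bound) (use P(1) in auto)
    moreover have "\<exists>B\<ge>0. \<forall>i\<in>{..<m}. \<forall>z. \<bar>d1 i z\<bar> \<le> B" by (rule finite_bb_bound) (use P(2) in auto)
    moreover have "\<exists>B\<ge>0. \<forall>i\<in>{..m - 2}. \<forall>z. \<bar>d2 i z\<bar> \<le> B" by (rule finite_bb_bound) (use P(3) m in auto)
    moreover have "\<exists>B\<ge>0. \<forall>i\<in>{..m - 2}. \<forall>z. \<bar>zin i z\<bar> \<le> B" by (rule finite_bb_bound) (use P(3) m in auto)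
    ultimately show ?thesis using that by blast
  qed
  define B where "B = B0 + B1 + B2 + B3"
  have B: "0 \<le> B" using Bs by (simp add: B_def)
  have bd: "\<bar>d0 i z\<bar> \<le> B" if "i \<le> m" for i z using Bs(2)[rule_format, of i z] that Bs(1,3,5,7) by (simp add: B_def)
  have bd1: "\<bar>d1 i z\<bar> \<le> B" if "i < m" for i z using Bs(4)[rule_format, of i z] that Bs(1,3,5,7) by (simp add: B_def)
  have bd2: "\<bar>d2 i z\<bar> \<le> B" if "i + 2 \<le> m" for i z using Bs(6)[rule_format, of i z] that Bs(1,3,5,7) by (simp add: B_def le_diff_conv2)
  have bd3: "\<bar>zin i x\<bar> \<le> B" if "i + 2 \<le> m" for i x using Bs(8)[rule_format, of i x] that Bs(1,3,5,7) by (simp add: B_def le_diff_conv2)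
  \<comment> \<open>\<open>M\<close> bounds the corrector, and \<kappa> repeats the constant of
    \<open>corrected_resid_bound\<close> literally, so that its conclusions can be folded. Both are
    independent of \<tau>.\<close>
  define M where "M = real m * B"
  define \<kappa> where "\<kappa> = B + 2 * M + (\<bar>f' 0\<bar> + C * (B + M)) * M + C * M * B"
  have M: "0 \<le> M" using B by (simp add: M_def)
  have M\<kappa>: "M \<le> \<kappa>"
  proof -
    have "0 \<le> (\<bar>f' 0\<bar> + C * (B + M)) * M" "0 \<le> C * M * B" using C M B by simp_all
    then show ?thesis using B M unfolding \<kappa>_def by linarith
  qed
  define K where "K = 1 + 2 * C * \<kappa>"
  define E where "E = real m * \<kappa>\<^sup>2 / 2 * (b - a) * (1 + T) * (1 + K * T * exp (K * T))"
  have K0: "0 \<le> K" using C M\<kappa> M by (simp add: K_def)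
  have E0: "0 \<le> E" using a_less_b T_pos K0 by (simp add: E_def)
  have bbX: "bb (\<lambda>z. d1 i z)" "bb (\<lambda>z. d1 (Suc i) z)" "bb (\<lambda>z. d2 i z)" "bb (\<lambda>x. zin i x)" if "i + 2 \<le> m" for i
    using P(2,3) that by auto
  let ?Z = "\<lambda>j z. corr m (\<lambda>i. d1 i z) j" and ?Zt = "\<lambda>j z. corr m (\<lambda>i. d2 i z) j"
    and ?Zx = "\<lambda>j z. corr m (\<lambda>i. d1 (Suc i) z) j" and ?Zin = "\<lambda>j x. corr m (\<lambda>i. zin i x) j"
  have bbZ: "bb (?Z j)" "bb (?Zt j)" "bb (?Zx j)" "bb (?Zin j)" if "j < m" for j
    by (rule bb_corr[OF m(1) that], rule bbX, assumption)+
  \<comment> \<open>From (x + y)^2 <= 2 x^2 + 2 y^2: the energy controls the square of q - W up to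
    the factor 2 / \<open>tw \<tau> j\<close>, which yields 4 E, and the corrector \<tau> Z yields 2
    M^2 (b - a).\<close>
  define c where "c = sqrt (4 * E + 2 * M\<^sup>2 * (b - a))"
  have c2: "c\<^sup>2 = 4 * E + 2 * M\<^sup>2 * (b - a)" and c0: "0 \<le> c"
    using E0 a_less_b by (simp_all add: c_def)
  show ?thesis
  proof (intro exI[of _ c] conjI c0 allI impI)
    fix \<tau> q j
    assume \<tau>: "0 < \<tau>" "\<tau> \<le> 1" and ent: "entropy_solution f \<Phi> m T a b \<tau> Du0 q" and j: "j < m"
    have "\<forall>i. \<exists>v. i < m \<longrightarrow> rep (q i) v"
      using ent rep_exists by (auto simp: entropy_solution_def)
    from choice[OF this] obtain q' where q': "\<forall>i. i < m \<longrightarrow> rep (q i) (q' i)" by (rule exE)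
    then have rq: "rep (q i) (q' i)" if "i < m" for i using that by blast
    have bq: "bb (q' i)" if "i < m" for i by (rule rep_bb[OF rq[OF that]])
    have Lin: "Linf (circ a b) (Du0 i)" if "i < m" for i
      using Du0[rule_format, OF that] by (simp add: wderiv_circ_def)
    have gb: "bb (g i)" "AE x in J a b. Du0 i x = g i x" if "i < m" for i
      using P(4,7) that by auto
    let ?W = "\<lambda>i z. d0 i z + \<tau> * ?Z i z" and ?Wt = "\<lambda>i z. d1 i z + \<tau> * ?Zt i z"
      and ?Wx = "\<lambda>i z. d0 (Suc i) z + \<tau> * ?Zx i z" and ?Win = "\<lambda>i x. g i x + \<tau> * ?Zin i x"
    have bbW: "bb (?W i)" "bb (?Wt i)" "bb (?Wx i)" "bb (?Win i)" if "i < m" for i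
      by (rule bb_add[OF _ bb_mult[OF bb_const bbZ(1)[OF that]]] bb_add[OF _ bb_mult[OF bb_const bbZ(2)[OF that]]]
          bb_add[OF _ bb_mult[OF bb_const bbZ(3)[OF that]]] bb_add[OF _ bb_mult[OF bb_const bbZ(4)[OF that]]],
          use P(1,2,4) that in simp)+
    have est: "AE t in J 0 T. xint (\<lambda>z. energy m \<tau> (\<lambda>i. q' i z - ?W i z)) t \<le> E * \<tau>\<^sup>2"
      unfolding E_def K_def
    proof (rule relative_energy_estimate[where ?f = f and ?f' = f' and ?qin = g and ?Win = ?Win and ?Wt = ?Wt and ?Wx = ?Wx,
          OF m \<tau> D L C bq bbW(1,2,3) gb(1) bbW(4)])
      show "evol (\<lambda>z. tw \<tau> i * q' i z) (\<lambda>z. flux_j m (f (q' 0 z)) (\<lambda>i. q' i z) i)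
        (\<lambda>z. source_j m (\<lambda>i. q' i z) i) (\<lambda>x. tw \<tau> i * g i x)" if "i < m" for i
        by (rule entropy_evol_weighted[OF ent m(2) fc rq Lin gb that]) assumption+
      show "AE t in J 0 T. xint (\<lambda>z. energy m \<tau> (\<lambda>j. q' j z)) t
        \<le> (LINT x|J a b. energy m \<tau> (\<lambda>j. g j x)) + pint (\<lambda>z. energy_source m (\<lambda>j. q' j z)) t"
        by (rule entropy_energy[OF ent m(2) rq Lin gb]) assumption+
      show "tderiv (?W i) (?Wt i) (?Win i)" if i: "i < m" for i
      proof (rule tderiv_add)
        show "tderiv (\<lambda>z. \<tau> * ?Z i z) (\<lambda>z. \<tau> * ?Zt i z) (\<lambda>x. \<tau> * ?Zin i x)"
          by (rule tderiv_cmult, rule tderiv_corr[OF m(1) i]) (use bbX P(11) in auto)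
      qed (use P(1,2,4,10) i in \<open>auto intro!: bb_mult bb_const bbZ\<close>)
      show "AE t in J 0 T. sd (sl (?W i) t) (sl (?Wx i) t)" if i: "i < m" for i
      proof -
        have "AE t in J 0 T. \<forall>k\<in>{..m - 2}. sd (sl (d1 k) t) (sl (d1 (Suc k)) t)"
          by (rule AE_finite_allI) (use P(9) m in auto)
        moreover have "AE t in J 0 T. sd (sl (d0 i) t) (sl (d0 (Suc i)) t)" using P(8) i by blast
        ultimately show ?thesis
        proof eventually_elim
          case (elim t)
          have "sd (sl (?Z i) t) (sl (?Zx i) t)"
            by (rule sd_corr[OF m(1) i]) (use bbX elim(1) in auto)
          then have "sd (\<lambda>x. \<tau> * sl (?Z i) t x) (\<lambda>x. \<tau> * sl (?Zx i) t x)" by (rule sd_cmult)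
          with elim(2) have "sd (\<lambda>x. sl (d0 i) t x + \<tau> * sl (?Z i) t x) (\<lambda>x. sl (d0 (Suc i)) t x + \<tau> * sl (?Zx i) t x)"
            by (rule sd_add) (use P(1) i in \<open>auto intro!: bb_mult bb_const bb_sl bbZ\<close>)
          then show ?case by (simp add: sl_def[abs_def])
        qed
      qed
      show "AE t in J 0 T. AE x in J a b. \<bar>?Wx 0 (t, x)\<bar> \<le> \<kappa> \<and>
        (\<forall>j<m. \<bar>resid m \<tau> (f' (?W 0 (t, x))) (\<lambda>i. ?W i (t, x)) (\<lambda>i. ?Wt i (t, x)) (\<lambda>i. ?Wx i (t, x)) j\<bar>
          \<le> (if j = 0 \<or> j = m div 2 then \<kappa> * \<tau> else \<kappa> * \<tau>\<^sup>2))"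
        using P(12)
      proof eventually_elim
        case (elim t)
        then show ?case
        proof eventually_elim
          case (elim x)
          note R = corrected_resid_bound[OF m \<tau>, of "\<lambda>i. d1 i (t, x)" f' "\<lambda>i. d0 i (t, x)" C B "\<lambda>i. d2 i (t, x)",
              OF elim L C bd bd1 bd2 B, folded M_def, folded \<kappa>_def]
          show ?case using R by blast
        qed
      qed
      show "\<bar>g i x - ?Win i x\<bar> \<le> \<kappa> * \<tau>" if i: "i < m" for i x
      proof -
        have "\<bar>?Zin i x\<bar> \<le> M" unfolding M_def by (rule corr_bound[OF m(1) i bd3 B])
        then have "\<tau> * \<bar>?Zin i x\<bar> \<le> \<tau> * \<kappa>" using \<tau> M\<kappa> by (intro mult_left_mono) auto
        then show ?thesis using \<tau> by (simp add: abs_mult mult.commute)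
      qed
    qed
    have tw: "0 < tw \<tau> j" "tw \<tau> j \<le> 1" using \<tau> by (auto simp: tw_def)
    have rd: "rep (\<lambda>z. (if j = 0 then u z else Du j z)) (d0 j)" using P(5,6) j by (cases "j = 0") auto
    show "LinfL2norm T a b (\<lambda>z. (if j = 0 then u z else Du j z) - q j z) \<le> ennreal (c * \<tau> / sqrt (tw \<tau> j))"
    proof (rule LinfL2norm_bound[OF rep_diff[OF rd rq[OF j]]])
      show "0 \<le> c * \<tau> / sqrt (tw \<tau> j)" using c0 \<tau> tw by simp
      show "AE t in J 0 T. xint (\<lambda>z. (d0 j z - q' j z)\<^sup>2) t \<le> (c * \<tau> / sqrt (tw \<tau> j))\<^sup>2"
        using est
      proof eventually_elim
        case (elim t)
        let ?e = "\<lambda>z. energy m \<tau> (\<lambda>i. q' i z - ?W i z)"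
        have bbe: "bb ?e" by (rule bb_energy[OF _ m(2)]) (intro bb_diff bq bbW)
        have pw: "(d0 j z - q' j z)\<^sup>2 \<le> (4 / tw \<tau> j) * ?e z + 2 * M\<^sup>2 * \<tau>\<^sup>2 / tw \<tau> j" for z
        proof -
          have "tw \<tau> j / 2 * (q' j z - ?W j z)\<^sup>2 \<le> ?e z"
            unfolding energy_weighted[OF m(2)]
            by (rule member_le_sum) (use j \<tau> in \<open>auto simp: tw_def\<close>)
          then have 1: "2 * (q' j z - ?W j z)\<^sup>2 \<le> (4 / tw \<tau> j) * ?e z"
            using tw by (simp add: field_simps)
          have "\<bar>?Z j z\<bar> \<le> M" unfolding M_def
            by (rule corr_bound[OF m(1) j _ B]) (rule bd1, simp)
          then have "(?Z j z)\<^sup>2 \<le> M\<^sup>2" using M by (simp add: abs_le_square_iff[symmetric])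
          then have "\<tau>\<^sup>2 * (?Z j z)\<^sup>2 \<le> \<tau>\<^sup>2 * M\<^sup>2" by (intro mult_left_mono) auto
          then have "2 * (\<tau> * ?Z j z)\<^sup>2 \<le> 2 * M\<^sup>2 * \<tau>\<^sup>2"
            by (simp add: power_mult_distrib mult.commute)
          also have "\<dots> \<le> 2 * M\<^sup>2 * \<tau>\<^sup>2 / tw \<tau> j"
            using tw by (simp add: le_divide_eq mult_left_le)
          finally have 2: "2 * (\<tau> * ?Z j z)\<^sup>2 \<le> 2 * M\<^sup>2 * \<tau>\<^sup>2 / tw \<tau> j" .
          have "d0 j z - q' j z = - ((q' j z - ?W j z) + \<tau> * ?Z j z)" by simp
          then have "(d0 j z - q' j z)\<^sup>2 = ((q' j z - ?W j z) + \<tau> * ?Z j z)\<^sup>2" by (simp only: power2_minus)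
          also have "\<dots> \<le> 2 * (q' j z - ?W j z)\<^sup>2 + 2 * (\<tau> * ?Z j z)\<^sup>2"
          proof -
            have "(x + y)\<^sup>2 \<le> 2 * x\<^sup>2 + 2 * y\<^sup>2" for x y :: real
              using zero_le_power2[of "x - y"] by (simp add: power2_sum power2_diff)
            then show ?thesis .
          qed
          finally show ?thesis using 1 2 by linarith
        qed
        have b1: "bb (\<lambda>z. (4 / tw \<tau> j) * ?e z)" by (intro bb_mult bb_const bbe)
        have "xint (\<lambda>z. (d0 j z - q' j z)\<^sup>2) t \<le> xint (\<lambda>z. (4 / tw \<tau> j) * ?e z + 2 * M\<^sup>2 * \<tau>\<^sup>2 / tw \<tau> j) t"
        proof (rule xint_mono_AE)
          show "bb (\<lambda>z. (d0 j z - q' j z)\<^sup>2)" using P(1) j bq by (intro bb_power2 bb_diff) auto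
          show "bb (\<lambda>z. (4 / tw \<tau> j) * ?e z + 2 * M\<^sup>2 * \<tau>\<^sup>2 / tw \<tau> j)" by (intro bb_add b1 bb_const)
          show "AE x in J a b. (d0 j (t, x) - q' j (t, x))\<^sup>2
              \<le> (4 / tw \<tau> j) * ?e (t, x) + 2 * M\<^sup>2 * \<tau>\<^sup>2 / tw \<tau> j"
            by (intro AE_I2 pw)
        qed
        also have "\<dots> = (4 / tw \<tau> j) * xint ?e t + 2 * M\<^sup>2 * \<tau>\<^sup>2 / tw \<tau> j * (b - a)"
          unfolding xint_add[OF b1 bb_const] xint_cmult
          using a_less_b by (simp add: xint_def space_J measure_J mult.commute)
        also have "\<dots> \<le> (4 / tw \<tau> j) * (E * \<tau>\<^sup>2) + 2 * M\<^sup>2 * \<tau>\<^sup>2 / tw \<tau> j * (b - a)"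
          using elim tw by (intro add_mono mult_left_mono) auto
        also have "\<dots> = c\<^sup>2 * \<tau>\<^sup>2 / tw \<tau> j" unfolding c2 using tw by (simp add: field_simps)
        also have "\<dots> = (c * \<tau> / sqrt (tw \<tau> j))\<^sup>2"
          using tw by (simp add: power_mult_distrib power_divide)
        finally show ?case .
      qed
    qed
  qed
qed

theorem theorem3p5:
  fixes m :: nat and T a b :: real
    and f f2 \<Phi> :: "real \<Rightarrow> real"
    and u :: "real \<times> real \<Rightarrow> real"
    and Du :: "nat \<Rightarrow> real \<times> real \<Rightarrow> real"
    and u0 :: "real \<Rightarrow> real"
    and Du0 :: "nat \<Rightarrow> real \<Rightarrow> real"
  assumes "even m" and "m \<ge> 2" and "T > 0" and "a < b"
    and "Winf_loc 2 f" and "continuous_on UNIV f"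
    and "wderiv_line 2 f f2" and "Linf lebesgue f2"
    and "\<And>s. (\<Phi> has_real_derivative s * deriv f s) (at s)"
    and "Winf_cyl T a b m u" and "solves_eq f m T a b u"
    and "Winf_circ a b m u0" and "initial_trace T a b u u0"
    and "\<And>j. j < m \<Longrightarrow> wderiv_cyl T a b 0 j u (Du j)"
    and "\<And>j. j < m \<Longrightarrow> wderiv_circ a b j u0 (Du0 j)"
  shows "\<exists>C>0. \<exists>\<tau>0>0. \<forall>\<tau>. 0 < \<tau> \<and> \<tau> \<le> \<tau>0 \<longrightarrow>
           (\<forall>q. entropy_solution f \<Phi> m T a b \<tau> Du0 q \<longrightarrow>
              LinfL2norm T a b (\<lambda>z. u z - q 0 z)
                + (\<Sum>j = 1..m - 1. ennreal (sqrt \<tau>) * LinfL2norm T a b (\<lambda>z. Du j z - q j z))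
              \<le> ennreal (C * \<tau>))"
proof -
  interpret cylinder a b T by unfold_locales (use assms(3,4) in auto)
  obtain C where C: "C \<ge> 0" "\<And>s. (f has_real_derivative deriv f s) (at s)"
    "\<And>s t. \<bar>deriv f s - deriv f t\<bar> \<le> C * \<bar>s - t\<bar>"
    using flux_derivative_lipschitz[OF assms(5-8)] by blast
  obtain c where c: "c \<ge> 0" "\<And>\<tau> q j. 0 < \<tau> \<Longrightarrow> \<tau> \<le> 1 \<Longrightarrow> entropy_solution f \<Phi> m T a b \<tau> Du0 q \<Longrightarrow> j < m \<Longrightarrow>
      LinfL2norm T a b (\<lambda>z. (if j = 0 then u z else Du j z) - q j z) \<le> ennreal (c * \<tau> / sqrt (tw \<tau> j))"
  proof -
    have "\<forall>j<m. wderiv_cyl T a b 0 j u (Du j)" "\<forall>j<m. wderiv_circ a b j u0 (Du0 j)"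
      using assms(14,15) by blast+
    from entropy_solution_distance[OF assms(1,2) C(2,3,1) assms(10,11,13) this, of \<Phi>]
    show ?thesis using that by blast
  qed
  show ?thesis
  \<comment> \<open>Each of the m norms contributes \<open>c * \<tau>\<close>, since the factor
    sqrt(\<tau>) compensates the loss in the components j >= 1; the summand 1 makes the constant
    positive.\<close>
  proof (rule exI[of _ "real m * c + 1"], intro conjI exI[of _ "1::real"] allI impI)
    fix \<tau> q assume \<tau>: "0 < \<tau> \<and> \<tau> \<le> 1" and ent: "entropy_solution f \<Phi> m T a b \<tau> Du0 q"
    note n = c(2)[OF conjunct1[OF \<tau>] conjunct2[OF \<tau>] ent]
    have "LinfL2norm T a b (\<lambda>z. u z - q 0 z) \<le> ennreal (c * \<tau>)"
      using n[of 0] assms(2) by (simp add: tw_def)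
    moreover have "(\<Sum>j = 1..m - 1. ennreal (sqrt \<tau>) * LinfL2norm T a b (\<lambda>z. Du j z - q j z))
        \<le> (\<Sum>j = 1..m - 1. ennreal (c * \<tau>))"
    proof (rule sum_mono)
      fix j assume j: "j \<in> {1..m - 1}"
      then have "LinfL2norm T a b (\<lambda>z. Du j z - q j z) \<le> ennreal (c * \<tau> / sqrt \<tau>)"
        using n[of j] assms(2) by (auto simp: tw_def)
      then have "ennreal (sqrt \<tau>) * LinfL2norm T a b (\<lambda>z. Du j z - q j z) \<le> ennreal (sqrt \<tau>) * ennreal (c * \<tau> / sqrt \<tau>)"
        by (intro mult_left_mono) auto
      also have "\<dots> = ennreal (c * \<tau>)"
        using \<tau> c(1) by (simp add: ennreal_mult[symmetric])
      finally show "ennreal (sqrt \<tau>) * LinfL2norm T a b (\<lambda>z. Du j z - q j z) \<le> ennreal (c * \<tau>)" .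
    qed
    ultimately have "LinfL2norm T a b (\<lambda>z. u z - q 0 z)
        + (\<Sum>j = 1..m - 1. ennreal (sqrt \<tau>) * LinfL2norm T a b (\<lambda>z. Du j z - q j z))
        \<le> ennreal (c * \<tau>) + (\<Sum>j = 1..m - 1. ennreal (c * \<tau>))" by (rule add_mono)
    also have "\<dots> = ennreal (c * \<tau> + (\<Sum>j = 1..m - 1. c * \<tau>))"
      using c(1) \<tau> by (simp add: sum_ennreal ennreal_plus[symmetric] sum_nonneg del: sum_constant ennreal_plus)
    also have "\<dots> \<le> ennreal ((real m * c + 1) * \<tau>)"
    proof (rule ennreal_leI)
      have "c * \<tau> + (\<Sum>j = 1..m - 1. c * \<tau>) = real m * c * \<tau>"
        using assms(2) by (simp add: of_nat_diff algebra_simps)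
      then show "c * \<tau> + (\<Sum>j = 1..m - 1. c * \<tau>) \<le> (real m * c + 1) * \<tau>"
        using \<tau> by (simp add: algebra_simps)
    qed
    finally show "LinfL2norm T a b (\<lambda>z. u z - q 0 z)
        + (\<Sum>j = 1..m - 1. ennreal (sqrt \<tau>) * LinfL2norm T a b (\<lambda>z. Du j z - q j z))
        \<le> ennreal ((real m * c + 1) * \<tau>)" .
  next
    show "0 < real m * c + 1" using c(1) by (simp add: add_nonneg_pos)
  qed simp
qed

end
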